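(* Let $d\ge 1$, let $\vec\alpha=(\alpha_1,\dots,\alpha_{2d})\in(0,+\infty)^{2d}$, and let $\mu=\bigotimes_{x\in\mathbb{Z}^d}\lambda^{\vec\alpha}$. Assume that there exists $i\in\{1,\dots,2d\}$ such that $\alpha_{e_i}>1+\alpha_{-e_i}$. Then the process $(X_n)$ is transient under $P^\mu$, and there exists $v\in\mathbb{R}^d\setminus\{0\}$ such that $$P^\mu\Big(\frac{X_n}{n}\xrightarrow[n\to\infty]{}v\Big)=1.$$ Moreover, for all $i\in\{1,\dots,d\}$, $$\frac{\alpha_{e_i}-\alpha_{-e_i}-1}{\big(\sum_{k=1}^{2d}\alpha_k\big)-1}\;\le\; v\cdot e_i\;\le\;\frac{\alpha_{e_i}-\alpha_{-e_i}+1}{\big(\sum_{k=1}^{2d}\alpha_k\big)-1}.$$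
   Context: Unit vectors: $(e_i)_{1\le i\le d}$ is the canonical basis of $\mathbb{R}^d$, and $e_j=-e_{j-d}$ for $j\in\{d+1,\dots,2d\}$. For a unit vector $e$ of $\mathbb{Z}^d$ (i.e. $e=e_i$ for some $i\in\{1,\dots,2d\}$), $\alpha_e$ denotes $\alpha_i$ where $i$ is the index with $e_i=e$. Let $T_{2d}=\{(x_1,\dots,x_{2d})\in(0,1]^{2d}:\sum_{i=1}^{2d}x_i=1\}$. For $\vec\alpha\in(0,+\infty)^{2d}$, $\lambda^{\vec\alpha}$ is the Dirichlet probability measure on $T_{2d}$ with parameters $(\alpha_1,\dots,\alpha_{2d})$, i.e. the measure $$\frac{\Gamma(\alpha_1+\dots+\alpha_{2d})}{\Gamma(\alpha_1)\cdots\Gamma(\alpha_{2d})}\,x_1^{\alpha_1-1}\cdots x_{2d}^{\alpha_{2d}-1}\,dx_1\cdots dx_{2d-1}.$$ An environment is $\omega=(\omega(x))_{x\in\mathbb{Z}^d}$ with $\omega(x)=(\omega(x,x+e_1),\dots,\omega(x,x+e_{2d}))\in T_{2d}$ for every $x$. Under $\mu=\bigotimes_{x\in\mathbb{Z}^d}\lambda^{\vec\alpha}$ the $\omega(x)$, $x\in\mathbb{Z}^d$, are independent with law $\lambda^{\vec\alpha}$. $P^\omega$ is the law of the Markov chain $(X_n)_{n\ge0}$ on $\mathbb{Z}^d$ started at $0$ with $P^\omega(X_{k+1}=x+e_i\mid X_k=x)=\omega(x,x+e_i)$ for all $x\in\mathbb{Z}^d$, $k\in\mathbb{N}$, $i=1,\dots,2d$.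 The annealed law is $P^\mu=\int P^\omega\,d\mu(\omega)$. *)

theory Defs
  imports "HOL-Probability.Probability"
begin

text \<open>
  The dimension is \<open>d = CARD('d)\<close>. The index set \<open>{1, \<dots>, 2d}\<close> is the type \<^typ>\<open>'d + 'd\<close>:
  \<open>Inl i\<close> stands for the index \<open>i\<close> and \<open>Inr i\<close> for the index \<open>i + d\<close>.
\<close>

primrec unit_vec :: "'d + 'd \<Rightarrow> int ^ 'd" where
  "unit_vec (Inl i) = axis i 1"
| "unit_vec (Inr i) = - axis i 1"

lemma inj_unit_vec: "inj (unit_vec :: 'd::finite + 'd \<Rightarrow> int ^ 'd)"
proof (rule injI)
  fix a b :: "'d + 'd"
  assume eq: "unit_vec a = unit_vec b"
  have "unit_vec a $ i = unit_vec b $ i" for i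
    using eq by simp
  then show "a = b"
    by (cases a; cases b) (auto simp: axis_def split: if_splits, (metis zero_neq_one zero_neq_neg_one one_neq_neg_one)+)
qed

definition weight_at :: "('d + 'd \<Rightarrow> real) \<Rightarrow> int ^ 'd::finite \<Rightarrow> real" where
  "weight_at \<alpha> e = \<alpha> (THE k. unit_vec k = e)"

lemma weight_at_unit_vec: "weight_at \<alpha> (unit_vec k) = \<alpha> k"
proof -
  have "(THE k'. unit_vec k' = unit_vec k) = k"
    by (rule the_equality) (auto dest: injD[OF inj_unit_vec])
  then show ?thesis
    by (simp add: weight_at_def)
qed

lemma weight_at_uminus_unit_vec:
  "weight_at \<alpha> (- unit_vec (Inl i)) = \<alpha> (Inr i)" "weight_at \<alpha> (- unit_vec (Inr i)) = \<alpha> (Inl i)"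
  using weight_at_unit_vec[of \<alpha> "Inr i"] weight_at_unit_vec[of \<alpha> "Inl i"] by simp_all

definition real_vec :: "int ^ 'd \<Rightarrow> real ^ 'd" where
  "real_vec x = (\<chi> i. real_of_int (x $ i))"

definition prob_simplex :: "('k::finite \<Rightarrow> real) set" where
  "prob_simplex = {x. (\<forall>k. 0 < x k \<and> x k \<le> 1) \<and> (\<Sum>k\<in>UNIV. x k) = 1}"

text \<open>
  The measure \<open>dx\<^sub>1 \<cdots> dx\<^sub>n\<^sub>-\<^sub>1\<close> on the hyperplane \<open>x\<^sub>1 + \<cdots> + x\<^sub>n = 1\<close>: all coordinates except
  \<open>l\<close> are integrated against Lebesgue measure, and the coordinate \<open>l\<close> is determined by them.
\<close>

definition hyperplane_lebesgue :: "'k::finite \<Rightarrow> ('k \<Rightarrow> real) measure" where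
  "hyperplane_lebesgue l =
     distr (\<Pi>\<^sub>M k\<in>UNIV - {l}. lborel) (\<Pi>\<^sub>M k\<in>UNIV. borel)
       (\<lambda>x. x(l := 1 - (\<Sum>k\<in>UNIV - {l}. x k)))"

text \<open>
  An unordered index type has no last index; by \<open>hyperplane_lebesgue_eq\<close> below the choice
  of the omitted coordinate is immaterial.
\<close>

definition dirichlet :: "('k::finite \<Rightarrow> real) \<Rightarrow> ('k \<Rightarrow> real) measure" where
  "dirichlet \<alpha> =
     density (restrict_space (hyperplane_lebesgue (SOME l. True)) prob_simplex)
       (\<lambda>x. ennreal (Gamma (\<Sum>k\<in>UNIV. \<alpha> k) / (\<Prod>k\<in>UNIV. Gamma (\<alpha> k))
                      * (\<Prod>k\<in>UNIV. x k powr (\<alpha> k - 1))))"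

lemma measurable_hyperplane_map [measurable]:
  fixes l :: "'k::finite"
  shows "(\<lambda>x. x(l := 1 - (\<Sum>k\<in>UNIV - {l}. x k)))
    \<in> measurable (\<Pi>\<^sub>M k\<in>UNIV - {l}. lborel) (\<Pi>\<^sub>M k\<in>UNIV. borel)"
proof (rule measurable_PiM_single')
  fix i :: 'k
  show "(\<lambda>x. (x(l := 1 - (\<Sum>k\<in>UNIV - {l}. x k))) i) \<in> borel_measurable (\<Pi>\<^sub>M k\<in>UNIV - {l}. lborel)"
    by (cases "i = l") (auto simp: fun_upd_def)
qed (auto simp: PiE_def)

lemma nn_integral_lborel_reflect:
  fixes f :: "real \<Rightarrow> ennreal"
  assumes [measurable]: "f \<in> borel_measurable borel"
  shows "(\<integral>\<^sup>+y. f (c - y) \<partial>lborel) = (\<integral>\<^sup>+y. f y \<partial>lborel)"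
  using nn_integral_real_affine[of f "-1" c] by simp

lemma hyperplane_lebesgue_eq:
  fixes l m :: "'k::finite"
  shows "hyperplane_lebesgue l = hyperplane_lebesgue m"
proof (cases "l = m")
  case False
  interpret product_sigma_finite "\<lambda>_::'k. lborel :: real measure"
    by standard
  define J where "J = UNIV - {l, m}"
  have Jl: "UNIV - {l} = insert m J" and Jm: "UNIV - {m} = insert l J"
    using False by (auto simp: J_def)
  have J: "finite J" "l \<notin> J" "m \<notin> J"
    by (auto simp: J_def)
  define \<phi> where "\<phi> = (\<lambda>(a::'k) (x::'k \<Rightarrow> real). x(a := 1 - (\<Sum>k\<in>UNIV - {a}. x k)))"
  have \<phi> [measurable]: "\<phi> a \<in> measurable (\<Pi>\<^sub>M k\<in>UNIV - {a}. lborel) (\<Pi>\<^sub>M k\<in>UNIV. borel)" for a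
    unfolding \<phi>_def by (rule measurable_hyperplane_map)
  show ?thesis
  proof (rule measure_eqI)
    show "sets (hyperplane_lebesgue l) = sets (hyperplane_lebesgue m)"
      by (simp add: hyperplane_lebesgue_def)
    fix A assume "A \<in> sets (hyperplane_lebesgue l)"
    then have A [measurable]: "A \<in> sets (\<Pi>\<^sub>M k\<in>(UNIV::'k set). (borel :: real measure))"
      by (simp add: hyperplane_lebesgue_def)
    have *: "emeasure (hyperplane_lebesgue a) A =
        (\<integral>\<^sup>+x. (\<integral>\<^sup>+y. indicator A (\<phi> a (x(b := y))) \<partial>lborel) \<partial>(\<Pi>\<^sub>M k\<in>J. lborel))"
      if ab: "UNIV - {a} = insert b J" "b \<notin> J" for a b
    proof -
      have "emeasure (hyperplane_lebesgue a) A =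
          (\<integral>\<^sup>+x. indicator A x \<partial>hyperplane_lebesgue a)"
        using A by (subst nn_integral_indicator) (auto simp: hyperplane_lebesgue_def)
      also have "\<dots> = (\<integral>\<^sup>+x. indicator A (\<phi> a x) \<partial>(\<Pi>\<^sub>M k\<in>UNIV - {a}. lborel))"
        unfolding hyperplane_lebesgue_def \<phi>_def by (subst nn_integral_distr) measurable
      also have "\<dots> = (\<integral>\<^sup>+x. indicator A (\<phi> a x) \<partial>(\<Pi>\<^sub>M k\<in>insert b J. lborel))"
        by (simp add: ab)
      also have "\<dots> = (\<integral>\<^sup>+x. (\<integral>\<^sup>+y. indicator A (\<phi> a (x(b := y))) \<partial>lborel) \<partial>(\<Pi>\<^sub>M k\<in>J. lborel))"
      proof (rule product_nn_integral_insert)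
        show "(\<lambda>x. indicator A (\<phi> a x)) \<in> borel_measurable (\<Pi>\<^sub>M k\<in>insert b J. lborel)"
          using \<phi>[of a] unfolding ab(1) by measurable
      qed (use J ab in auto)
      finally show ?thesis .
    qed
    have "(\<integral>\<^sup>+y. indicator A (\<phi> l (x(m := y))) \<partial>lborel) =
          (\<integral>\<^sup>+y. indicator A (\<phi> m (x(l := y))) \<partial>(lborel::real measure))"
      if x: "x \<in> space (\<Pi>\<^sub>M k\<in>J. lborel)" for x :: "'k \<Rightarrow> real"
    proof -
      define c where "c = 1 - (\<Sum>k\<in>J. x k)"
      define g where "g = (\<lambda>y. x(l := y, m := c - y))"
      have 1: "\<phi> l (x(m := y)) = g (c - y)" for y
      proof -
        have "(\<Sum>k\<in>insert m J. (x(m := y)) k) = y + (\<Sum>k\<in>J. x k)"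
          using J by (subst sum.insert) (auto intro!: sum.cong)
        then show ?thesis
          using False by (auto simp: \<phi>_def g_def c_def Jl fun_eq_iff)
      qed
      have 2: "\<phi> m (x(l := y)) = g y" for y
      proof -
        have "(\<Sum>k\<in>insert l J. (x(l := y)) k) = y + (\<Sum>k\<in>J. x k)"
          using J by (subst sum.insert) (auto intro!: sum.cong)
        then show ?thesis
          using False by (auto simp: \<phi>_def g_def c_def Jm fun_eq_iff)
      qed
      have [measurable]: "g \<in> measurable borel (\<Pi>\<^sub>M k\<in>UNIV. borel)"
      proof (rule measurable_PiM_single')
        fix i :: 'k
        show "(\<lambda>y. g y i) \<in> borel_measurable borel"
          by (cases "i = l"; cases "i = m") (auto simp: g_def)
      qed auto
      have "(\<integral>\<^sup>+y. indicator A (g (c - y)) \<partial>lborel) = (\<integral>\<^sup>+y. indicator A (g y) \<partial>lborel)"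
        by (rule nn_integral_lborel_reflect) measurable
      then show ?thesis
        by (simp add: 1 2)
    qed
    then show "emeasure (hyperplane_lebesgue l) A = emeasure (hyperplane_lebesgue m) A"
      unfolding *[OF Jl J(3)] *[OF Jm J(2)] by (rule nn_integral_cong)
  qed
qed simp

type_synonym 'd environment = "int ^ 'd \<Rightarrow> 'd + 'd \<Rightarrow> real"

definition dirichlet_environment ::
  "('d + 'd \<Rightarrow> real) \<Rightarrow> ('d::finite) environment measure" where
  "dirichlet_environment \<alpha> = (\<Pi>\<^sub>M x\<in>UNIV. dirichlet \<alpha>)"

lemma sets_hyperplane_lebesgue [simp]:
  "sets (hyperplane_lebesgue l) = sets (\<Pi>\<^sub>M k\<in>UNIV. borel)"
  by (simp add: hyperplane_lebesgue_def)

lemma space_hyperplane_lebesgue [simp]: "space (hyperplane_lebesgue l) = UNIV"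
  by (simp add: hyperplane_lebesgue_def space_PiM)

lemma space_dirichlet: "space (dirichlet \<alpha>) = prob_simplex"
  by (simp add: dirichlet_def space_restrict_space)

lemma space_dirichlet_environment:
  "space (dirichlet_environment \<alpha>) = {\<omega>. \<forall>x. \<omega> x \<in> prob_simplex}"
  by (auto simp: dirichlet_environment_def space_PiM space_dirichlet PiE_def)

definition walk_step :: "('d::finite) environment \<Rightarrow> int ^ 'd \<Rightarrow> (int ^ 'd) pmf" where
  "walk_step \<omega> x = map_pmf (\<lambda>k. x + unit_vec k) (embed_pmf (\<omega> x))"

lemma pmf_walk_step:
  assumes "\<omega> x \<in> prob_simplex"
  shows "pmf (walk_step \<omega> x) (x + unit_vec k) = \<omega> x k"
proof -
  have "inj (\<lambda>k::'a + 'a. x + unit_vec k)"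
    using inj_unit_vec by (auto simp: inj_def)
  then have "pmf (walk_step \<omega> x) (x + unit_vec k) = pmf (embed_pmf (\<omega> x)) k"
    unfolding walk_step_def by (rule pmf_map_inj')
  also have "\<dots> = \<omega> x k"
  proof (rule pmf_embed_pmf)
    show "0 \<le> \<omega> x k" for k
      using assms by (auto simp: prob_simplex_def less_imp_le)
    then have "(\<integral>\<^sup>+k. ennreal (\<omega> x k) \<partial>count_space UNIV) = ennreal (\<Sum>k\<in>UNIV. \<omega> x k)"
      by (simp add: nn_integral_count_space_finite)
    then show "(\<integral>\<^sup>+k. ennreal (\<omega> x k) \<partial>count_space UNIV) = 1"
      using assms by (simp add: prob_simplex_def)
  qed
  finally show ?thesis .
qed

text \<open>
  The law on the path space of the Markov chain with transition kernel \<open>K\<close> started at \<open>x\<^sub>0\<close>, given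
  by the Ionescu-Tulcea theorem. Its finite-dimensional distributions are computed in
  \<open>emeasure_markov_law_cylinder\<close>.
\<close>

definition markov_transition :: "'s \<Rightarrow> ('s \<Rightarrow> 's pmf) \<Rightarrow> nat \<Rightarrow> (nat \<Rightarrow> 's) \<Rightarrow> 's measure" where
  "markov_transition x\<^sub>0 K n h = measure_pmf (case n of 0 \<Rightarrow> return_pmf x\<^sub>0 | Suc m \<Rightarrow> K (h m))"

definition markov_law :: "'s \<Rightarrow> ('s \<Rightarrow> 's pmf) \<Rightarrow> (nat \<Rightarrow> 's) measure" where
  "markov_law x\<^sub>0 K =
     projective_family.lim UNIV
       (Ionescu_Tulcea.CI (markov_transition x\<^sub>0 K) (\<lambda>_. count_space UNIV)) (\<lambda>_. count_space UNIV)"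

lemma Ionescu_Tulcea_markov_transition:
  fixes K :: "'s::countable \<Rightarrow> 's pmf"
  shows "Ionescu_Tulcea (markov_transition x\<^sub>0 K) (\<lambda>_. count_space UNIV)"
proof (rule Ionescu_Tulcea.intro)
  fix n
  show "markov_transition x\<^sub>0 K n
      \<in> measurable (\<Pi>\<^sub>M i\<in>{0..<n}. count_space UNIV) (subprob_algebra (count_space UNIV))"
  proof (cases n)
    case 0
    then show ?thesis
      by (simp add: markov_transition_def[abs_def] measure_pmf_in_subprob_algebra)
  next
    case (Suc m)
    have "(\<lambda>h. measure_pmf (K (h m)))
        \<in> measurable (\<Pi>\<^sub>M i\<in>{0..<Suc m}. count_space UNIV) (subprob_algebra (count_space UNIV))"
    proof (rule measurable_compose[of "\<lambda>h. h m" _ "count_space UNIV"])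
      show "(\<lambda>h. h m) \<in> measurable (\<Pi>\<^sub>M i\<in>{0..<Suc m}. count_space UNIV) (count_space (UNIV::'s set))"
        by (rule measurable_component_singleton) simp
    qed (simp add: measure_pmf_in_subprob_algebra)
    then show ?thesis
      by (simp add: Suc markov_transition_def[abs_def])
  qed
next
  show "prob_space (markov_transition x\<^sub>0 K n h)" for n h
    by (simp add: markov_transition_def prob_space_measure_pmf)
qed

lemma emeasure_markov_law_cylinder:
  fixes K :: "'s::countable \<Rightarrow> 's pmf"
  shows "emeasure (markov_law x\<^sub>0 K) {X. \<forall>i\<le>n. X i = p i} =
    (if p 0 = x\<^sub>0 then ennreal (\<Prod>i<n. pmf (K (p i)) (p (Suc i))) else 0)"
proof -
  interpret IT: Ionescu_Tulcea "markov_transition x\<^sub>0 K" "\<lambda>_. count_space UNIV"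
    by (rule Ionescu_Tulcea_markov_transition)
  let ?M = "\<lambda>n. \<Pi>\<^sub>M i\<in>{0..<n}. count_space (UNIV :: 's set)"
  have single: "{restrict p {0..<n}} \<in> sets (?M n)" for n
  proof -
    have "{restrict p {0..<n}} = PiE {0..<n} (\<lambda>i. {p i})"
      by (auto simp: restrict_def PiE_iff extensional_def fun_eq_iff)
    then show ?thesis
      by (simp add: sets_PiM_I_finite)
  qed
  have step: "emeasure (IT.C 0 (Suc n) (\<lambda>_. undefined)) {restrict p {0..<Suc n}} =
      ennreal (pmf (case n of 0 \<Rightarrow> return_pmf x\<^sub>0 | Suc m \<Rightarrow> K (p m)) (p n)) *
      emeasure (IT.C 0 n (\<lambda>_. undefined)) {restrict p {0..<n}}" for n
  proof -
    have sp: "(\<lambda>_. undefined) \<in> space (?M 0)"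
      by (simp add: space_PiM PiE_iff extensional_def)
    have sets_C: "sets (IT.C 0 n (\<lambda>_. undefined)) = sets (?M n)"
      using IT.sets_C[OF sp, of n] by simp
    have space_C: "space (IT.C 0 n (\<lambda>_. undefined)) = space (?M n)"
      using sets_C by (rule sets_eq_imp_space_eq)
    have "emeasure (IT.C 0 (Suc n) (\<lambda>_. undefined)) {restrict p {0..<Suc n}} =
        (\<integral>\<^sup>+h. emeasure (IT.eP n h) {restrict p {0..<Suc n}} \<partial>IT.C 0 n (\<lambda>_. undefined))"
      unfolding IT.C.simps add_0
    proof (rule emeasure_bind)
      show "space (IT.C 0 n (\<lambda>_. undefined)) \<noteq> {}"
        by (auto simp: space_C space_PiM_empty_iff)
      show "IT.eP n \<in> IT.C 0 n (\<lambda>_. undefined) \<rightarrow>\<^sub>M subprob_algebra (?M (Suc n))"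
        using IT.measurable_eP[of n] by (simp cong: measurable_cong_sets add: measurable_cong_sets[OF sets_C refl])
    qed (rule single)
    also have "\<dots> = (\<integral>\<^sup>+h. ennreal (pmf (case n of 0 \<Rightarrow> return_pmf x\<^sub>0 | Suc m \<Rightarrow> K (p m)) (p n)) *
        indicator {restrict p {0..<n}} h \<partial>IT.C 0 n (\<lambda>_. undefined))"
    proof (rule nn_integral_cong)
      fix h assume "h \<in> space (IT.C 0 n (\<lambda>_. undefined))"
      then have h: "h \<in> space (?M n)"
        by (simp add: space_C)
      have ext: "h \<in> extensional {0..<n}"
        using h by (simp add: space_PiM PiE_def)
      have iff: "h(n := y) = restrict p {0..<Suc n} \<longleftrightarrow> h = restrict p {0..<n} \<and> y = p n" for y
      proof
        assume eq: "h(n := y) = restrict p {0..<Suc n}"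
        have "h i = restrict p {0..<n} i" for i
          using fun_cong[OF eq, of i] ext by (cases "i < n") (auto simp: extensional_def split: if_splits)
        moreover have "y = p n"
          using fun_cong[OF eq, of n] by simp
        ultimately show "h = restrict p {0..<n} \<and> y = p n"
          by (auto simp: fun_eq_iff)
      qed (auto simp: restrict_def fun_eq_iff)
      have pre: "(\<lambda>y. h(n := y)) -` {restrict p {0..<Suc n}} \<inter> space (count_space UNIV) =
          (if h = restrict p {0..<n} then {p n} else {})"
        by (simp add: set_eq_iff iff)
      have "emeasure (IT.eP n h) {restrict p {0..<Suc n}} =
          emeasure (markov_transition x\<^sub>0 K n h) (if h = restrict p {0..<n} then {p n} else {})"
        unfolding IT.emeasure_eP[OF h single] pre ..
      then show "emeasure (IT.eP n h) {restrict p {0..<Suc n}} =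
          ennreal (pmf (case n of 0 \<Rightarrow> return_pmf x\<^sub>0 | Suc m \<Rightarrow> K (p m)) (p n)) *
          indicator {restrict p {0..<n}} h"
        by (cases n) (auto simp: markov_transition_def emeasure_pmf_single split: split_indicator)
    qed
    also have "\<dots> = ennreal (pmf (case n of 0 \<Rightarrow> return_pmf x\<^sub>0 | Suc m \<Rightarrow> K (p m)) (p n)) *
      emeasure (IT.C 0 n (\<lambda>_. undefined)) {restrict p {0..<n}}"
      using single[of n] by (subst nn_integral_cmult_indicator) (simp_all add: sets_C)
    finally show ?thesis .
  qed
  have C: "emeasure (IT.C 0 (Suc n) (\<lambda>_. undefined)) {restrict p {0..<Suc n}} =
      (if p 0 = x\<^sub>0 then ennreal (\<Prod>i<n. pmf (K (p i)) (p (Suc i))) else 0)" for n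
  proof (induction n)
    case 0
    have "emeasure (IT.C 0 0 (\<lambda>_. undefined)) {restrict p {0..<0}} = 1"
      using single[of 0] by (simp add: restrict_def)
    then show ?case
      by (subst step) (simp add: pmf_return)
  next
    case (Suc n)
    show ?case
      by (subst step, subst Suc) (simp add: ennreal_mult'[symmetric] pmf_nonneg mult.commute)
  qed
  have "{X. \<forall>i\<le>n. X i = p i} =
      prod_emb UNIV (\<lambda>_. count_space UNIV) {0..<Suc n} {restrict p {0..<Suc n}}"
    by (auto simp: prod_emb_def space_PiM fun_eq_iff restrict_def less_Suc_eq_le) meson
  then have "emeasure (markov_law x\<^sub>0 K) {X. \<forall>i\<le>n. X i = p i} =
      emeasure (IT.CI {0..<Suc n}) {restrict p {0..<Suc n}}"
    unfolding markov_law_def by (simp only: IT.lim[OF finite_atLeastLessThan single])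
  also have "\<dots> = emeasure (IT.C 0 (Suc n) (\<lambda>_. undefined)) {restrict p {0..<Suc n}}"
    using single[of "Suc n"] by (subst IT.emeasure_CI[OF subset_refl]) (auto simp: prod_emb_id dest: sets.sets_into_space)
  finally show ?thesis
    unfolding C .
qed

lemma sets_markov_law:
  fixes K :: "'s::countable \<Rightarrow> 's pmf"
  shows "sets (markov_law x\<^sub>0 K) = sets (\<Pi>\<^sub>M i\<in>UNIV. count_space UNIV)"
proof -
  interpret IT: Ionescu_Tulcea "markov_transition x\<^sub>0 K" "\<lambda>_. count_space UNIV"
    by (rule Ionescu_Tulcea_markov_transition)
  show ?thesis
    unfolding markov_law_def by (rule IT.PF.sets_lim)
qed

lemma prob_space_markov_law:
  fixes K :: "'s::countable \<Rightarrow> 's pmf"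
  shows "prob_space (markov_law x\<^sub>0 K)"
proof -
  interpret IT: Ionescu_Tulcea "markov_transition x\<^sub>0 K" "\<lambda>_. count_space UNIV"
    by (rule Ionescu_Tulcea_markov_transition)
  have "emeasure IT.PF.lim (IT.PF.emb UNIV {} (space (\<Pi>\<^sub>M i\<in>{}. count_space UNIV))) =
      emeasure (IT.CI {}) (space (\<Pi>\<^sub>M i\<in>{}. count_space UNIV))"
    by (rule IT.lim) auto
  also have "\<dots> = 1"
    using IT.PF.prob_space_P[of "{}"] prob_space.emeasure_space_1
    by (fastforce simp: IT.CI_def)
  finally show ?thesis
    by (intro prob_spaceI) (simp add: markov_law_def prod_emb_def space_PiM vimage_def restrict_def)
qed

definition quenched_law :: "('d::finite) environment \<Rightarrow> (nat \<Rightarrow> int ^ 'd) measure" where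
  "quenched_law \<omega> = markov_law 0 (walk_step \<omega>)"

lemma measurable_environment_component:
  "(\<lambda>\<omega>. \<omega> x k) \<in> borel_measurable (dirichlet_environment \<alpha>)"
proof (rule measurable_compose[of "\<lambda>\<omega>. \<omega> x" _ "dirichlet \<alpha>"])
  show "(\<lambda>\<omega>. \<omega> x) \<in> measurable (dirichlet_environment \<alpha>) (dirichlet \<alpha>)"
    unfolding dirichlet_environment_def by (rule measurable_component_singleton) simp
  have "(\<lambda>y. y k) \<in> borel_measurable (hyperplane_lebesgue l)" for l :: "'a + 'a"
    unfolding hyperplane_lebesgue_def by simp
  then show "(\<lambda>y. y k) \<in> borel_measurable (dirichlet \<alpha>)"
    unfolding dirichlet_def by (simp add: measurable_restrict_space1)
qed

lemma measurable_pmf_walk_step: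
  "(\<lambda>\<omega>. pmf (walk_step \<omega> x) y) \<in> borel_measurable (dirichlet_environment \<alpha>)"
proof (cases "\<exists>k. y = x + unit_vec k")
  case True
  then obtain k where k: "y = x + unit_vec k" ..
  have "pmf (walk_step \<omega> x) y = \<omega> x k" if "\<omega> \<in> space (dirichlet_environment \<alpha>)" for \<omega>
    using that by (simp add: k pmf_walk_step space_dirichlet_environment)
  then show ?thesis
    using measurable_environment_component[of x k \<alpha>] by (simp cong: measurable_cong)
next
  case False
  then have "pmf (walk_step \<omega> x) y = 0" for \<omega>
    by (auto simp: pmf_eq_0_set_pmf walk_step_def)
  then show ?thesis
    by simp
qed

lemma sets_path_space_eq_cylinders:
  "sets (\<Pi>\<^sub>M i\<in>(UNIV :: nat set). count_space (UNIV :: 's::countable set)) =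
    sigma_sets UNIV (insert {} {{X. \<forall>i\<le>n. X i = p i} |n p. True})"
  (is "_ = sigma_sets _ ?G")
proof
  have "{X. \<forall>i\<le>n. X i = p i} \<in> sets (\<Pi>\<^sub>M i\<in>UNIV. count_space UNIV)" for n :: nat and p :: "nat \<Rightarrow> 's"
  proof -
    have "{X. \<forall>i\<le>n. X i = p i} = prod_emb UNIV (\<lambda>_. count_space UNIV) {..n} (PiE {..n} (\<lambda>i. {p i}))"
      by (auto simp: prod_emb_def space_PiM PiE_iff)
    then show ?thesis
      by (simp add: sets_PiM_I)
  qed
  then have "?G \<subseteq> sets (\<Pi>\<^sub>M i\<in>UNIV. count_space UNIV)"
    by auto
  from sets.sigma_sets_subset[OF this]
  show "sigma_sets UNIV ?G \<subseteq> sets (\<Pi>\<^sub>M i\<in>UNIV. count_space UNIV)"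
    by (simp add: space_PiM)
next
  interpret sigma_algebra UNIV "sigma_sets UNIV ?G"
    by (rule sigma_algebra_sigma_sets) simp
  have "{X. X i \<in> A} \<in> sigma_sets UNIV ?G" for i and A :: "'s set"
  proof -
    let ?L = "{xs :: 's list. length xs = Suc i \<and> xs ! i \<in> A}"
    have "X \<in> (\<Union>xs\<in>?L. {X. \<forall>j\<le>i. X j = xs ! j})" if "X i \<in> A" for X
      by (rule UN_I[of "map X [0..<Suc i]"]) (use that in \<open>auto simp del: upt_Suc\<close>)
    then have "{X. X i \<in> A} = (\<Union>xs\<in>?L. {X. \<forall>j\<le>i. X j = xs ! j})"
      by auto
    also have "\<dots> \<in> sigma_sets UNIV ?G"
      by (rule countable_UN') (auto intro!: sigma_sets.Basic)
    finally show ?thesis .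
  qed
  then have "sigma_sets UNIV {{X :: nat \<Rightarrow> 's. X i \<in> A} |i A. True} \<subseteq> sigma_sets UNIV ?G"
    by (intro sigma_sets_mono) auto
  then show "sets (\<Pi>\<^sub>M i\<in>UNIV. count_space UNIV) \<subseteq> sigma_sets UNIV ?G"
    by (simp add: sets_PiM_single)
qed

text \<open>Hence the integral of the quenched laws in \<open>annealed_law\<close> below is well defined.\<close>

lemma measurable_quenched_law:
  "quenched_law \<in> measurable (dirichlet_environment \<alpha>)
    (prob_algebra (\<Pi>\<^sub>M i\<in>UNIV. count_space UNIV))"
proof (rule measurable_prob_algebra_generated[OF sets_path_space_eq_cylinders])
  let ?G = "insert {} {{X :: nat \<Rightarrow> int ^ 'a. \<forall>i\<le>n. X i = p i} |n p. True}"
  have Int: "{X :: nat \<Rightarrow> int ^ 'a. \<forall>i\<le>n. X i = p i} \<inter> {X. \<forall>i\<le>m. X i = q i} \<in> ?G" for n m p q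
  proof (cases "\<forall>i\<le>min n m. p i = q i")
    case True
    define r where "r = (\<lambda>i. if i \<le> n then p i else q i)"
    have "{X. \<forall>i\<le>n. X i = p i} \<inter> {X. \<forall>i\<le>m. X i = q i} = {X. \<forall>i\<le>max n m. X i = r i}"
      using True by (auto simp: r_def le_max_iff_disj)
    then show ?thesis
      by blast
  next
    case False
    then obtain i where "i \<le> n" "i \<le> m" "p i \<noteq> q i"
      by auto
    then have "{X. \<forall>i\<le>n. X i = p i} \<inter> {X. \<forall>i\<le>m. X i = q i} = {}"
      by fastforce
    then show ?thesis
      by simp
  qed
  show "Int_stable ?G"
  proof (rule Int_stableI)
    fix A B assume "A \<in> ?G" "B \<in> ?G"
    then show "A \<inter> B \<in> ?G"
      using Int by (elim insertE CollectE exE conjE) (simp only: Int_empty_left Int_empty_right insertI1)+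
  qed
  show "prob_space (quenched_law \<omega>)" for \<omega> :: "'a environment"
    by (simp add: quenched_law_def prob_space_markov_law)
  show "sets (quenched_law \<omega>) = sets (\<Pi>\<^sub>M i\<in>UNIV. count_space UNIV)" for \<omega> :: "'a environment"
    by (simp add: quenched_law_def sets_markov_law)
  fix A assume "A \<in> ?G"
  then consider "A = {}" | n p where "A = {X. \<forall>i\<le>n. X i = p i}"
    by auto
  then show "(\<lambda>\<omega>. emeasure (quenched_law \<omega>) A) \<in> borel_measurable (dirichlet_environment \<alpha>)"
  proof cases
    case 2
    have [measurable]:
      "(\<lambda>\<omega>. pmf (walk_step \<omega> x) y) \<in> borel_measurable (dirichlet_environment \<alpha>)" for x y
      by (rule measurable_pmf_walk_step)
    show ?thesis
      unfolding 2 quenched_law_def emeasure_markov_law_cylinder by measurable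
  qed simp
qed simp

definition annealed_law :: "('d + 'd \<Rightarrow> real) \<Rightarrow> (nat \<Rightarrow> int ^ 'd::finite) measure" where
  "annealed_law \<alpha> = dirichlet_environment \<alpha> \<bind> quenched_law"

text \<open>
  The annealed walk is not a Markov chain, so transience is expressed on paths: almost surely, every
  site is visited only finitely often.
\<close>

definition transient :: "(nat \<Rightarrow> 's) measure \<Rightarrow> bool" where
  "transient P \<longleftrightarrow> (AE X in P. \<forall>x. finite {n. X n = x})"

end

(*
  Integrating out the environment turns the walk into a directed-edge reinforced walk: a finite
  word of steps has a probability depending only on the multiset of directed edges it uses, as a
  product over the sites of Polya urn weights.

  Permuting the loops of a word at a site z preserves this multiset. Together with the urn
  recursion, this gives a Kalikow-type estimate: if g is the expected number of visits of z before
  leaving a set or a time horizon and g_k counts those followed by a step k, then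
  (alpha_k - 1) g <= (A - 1) g_k <= alpha_k g, where A is the sum of the weights. Applied to half
  spaces, it bounds the expected hitting time of level L by a multiple of L, and shows that with
  positive probability the walk never goes below its starting level. Applied to the whole space,
  it bounds the expected displacement.

  At a new strict maximum, the future that stays above it visits fresh sites only and is
  independent of the past. So on the event D of never going below the starting level, the law is
  invariant under the shift to the next regeneration time tau, counting times before level 2K
  shows that tau is integrable on D, and shift invariant events that meet D have probability one.
  A Birkhoff-type maximal inequality for this shift gives the law of large numbers; its limit v is
  nonzero by the displacement bounds, which implies transience.
*)

theory Submission
  imports Defs
begin

section \<open>Words and their loops\<close>

text \<open>Given the past, the walk leaves a site along \<open>k\<close> with probability (\<alpha>
  k + N_k) / (A + n), where n counts the earlier exits from that site and N_k those along
  \<open>k\<close>. The memory term N_k is unbounded and prevents a direct comparison with a biased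
  walk. Averaging over the rotations of the loops at the site replaces N_k by n times the indicator
  that the last exit was along \<open>k\<close>. This quantity telescopes over successive visits,
  and the remainder lies between 0 and the number of visits. Memory thus costs at most one unit of
  weight per visit, which is the origin of the 1 in the drift condition and in the bounds on
  \<open>v\<close>.

  The drift along one axis serves all coordinates: regenerations are defined by the height along
  that axis, while the law of large numbers is proved for sums of an arbitrary real function of the
  steps. There, invariance of the law on \<open>D\<close> supplies stationarity, and a zero-one
  argument on cylinders takes the place of ergodicity.\<close>

definition endpoint :: "('k \<Rightarrow> 'a::ab_group_add) \<Rightarrow> 'a \<Rightarrow> 'k list \<Rightarrow> 'a" where
  "endpoint e x w = x + sum_list (map e w)"

fun edges :: "('k \<Rightarrow> 'a::ab_group_add) \<Rightarrow> 'a \<Rightarrow> 'k list \<Rightarrow> ('a \<times> 'k) multiset" where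
  "edges e x [] = {#}"
| "edges e x (k # w) = add_mset (x, k) (edges e (x + e k) w)"

fun exits :: "('k \<Rightarrow> 'a::ab_group_add) \<Rightarrow> 'a \<Rightarrow> 'a \<Rightarrow> 'k list \<Rightarrow> 'k list" where
  "exits e z x [] = []"
| "exits e z x (k # w) = (if x = z then [k] else []) @ exits e z (x + e k) w"

lemma endpoint_simps [simp]:
  "endpoint e x [] = x" "endpoint e x (k # w) = endpoint e (x + e k) w"
  "endpoint e x (u @ v) = endpoint e (endpoint e x u) v"
  by (simp_all add: endpoint_def add.assoc)

lemma edges_append [simp]: "edges e x (u @ v) = edges e x u + edges e (endpoint e x u) v"
  by (induction u arbitrary: x) auto

lemma exits_append [simp]: "exits e z x (u @ v) = exits e z x u @ exits e z (endpoint e x u) v"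
  by (induction u arbitrary: x) auto

lemma count_edges: "count (edges e x w) (z, k) = count_list (exits e z x w) k"
  by (induction w arbitrary: x) auto

lemma size_edges [simp]: "size (edges e x w) = length w"
  by (induction w arbitrary: x) auto

section \<open>Cutting a word at its visits to a site\<close>

fun cut_at :: "('k \<Rightarrow> 'a::ab_group_add) \<Rightarrow> 'a \<Rightarrow> 'a \<Rightarrow> 'k list \<Rightarrow> 'k list \<times> 'k list list" where
  "cut_at e z x [] = ([], [])"
| "cut_at e z x (k # w) = (case cut_at e z (x + e k) w of (p, ls) \<Rightarrow>
     if x = z then ([], (k # p) # ls) else (k # p, ls))"

definition loops :: "('k \<Rightarrow> 'a::ab_group_add) \<Rightarrow> 'a \<Rightarrow> 'k list set" where
  "loops e z = {l. \<exists>k p. l = k # p \<and> exits e z (z + e k) p = [] \<and> endpoint e z l = z}"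

text \<open>Every piece after the first starts at a visit of \<open>z\<close> and stops at the next
  one. Since the word ends at \<open>z\<close>, the last piece is a return as well, and no
  unfinished excursion remains.\<close>

lemma cut_at_correct:
  assumes "endpoint e x w = z" "cut_at e z x w = (p, ls)"
  shows "w = p @ concat ls \<and> exits e z x p = [] \<and> endpoint e x p = z \<and> set ls \<subseteq> loops e z"
  using assms
proof (induction w arbitrary: x p ls)
  case (Cons k w)
  obtain q ms where q: "cut_at e z (x + e k) w = (q, ms)"
    by force
  show ?case
    using Cons.IH[OF _ q] Cons.prems q by (auto simp: loops_def split: if_splits)
qed auto

lemma exits_loops:
  assumes "set ls \<subseteq> loops e z"
  shows "exits e z z (concat ls) = map hd ls" "endpoint e z (concat ls) = z"
  using assms by (induction ls) (auto simp: loops_def simp del: endpoint_simps(2))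

text \<open>With \<open>cut_at_loops\<close> this is the converse of \<open>cut_at_correct\<close>:
  a first passage followed by loops is recovered from the concatenated word, so the decomposition is
  unique.\<close>

lemma cut_at_first:
  assumes "exits e z x p = []" "endpoint e x p = z"
  shows "cut_at e z x (p @ v) = (p @ fst (cut_at e z z v), snd (cut_at e z z v))"
  using assms by (induction p arbitrary: x) (auto split: if_splits prod.splits)

lemma cut_at_loops:
  assumes "set ls \<subseteq> loops e z"
  shows "cut_at e z z (concat ls) = ([], ls)"
  using assms
proof (induction ls)
  case (Cons l ls)
  then obtain k p where l: "l = k # p" "exits e z (z + e k) p = []" "endpoint e (z + e k) p = z"
    by (auto simp: loops_def)
  have "cut_at e z z (concat ls) = ([], ls)"
    using Cons by simp
  then show ?case
    by (simp add: l(1) cut_at_first[OF l(2,3)])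
qed simp

section \<open>Rotation of the loops at a site\<close>

definition rotate_loops :: "('k \<Rightarrow> 'a::ab_group_add) \<Rightarrow> 'a \<Rightarrow> 'a \<Rightarrow> 'k list \<Rightarrow> 'k list" where
  "rotate_loops e z x w = (case cut_at e z x w of (p, ls) \<Rightarrow> p @ concat (rotate1 ls))"

lemma edges_concat_loops:
  assumes "set ls \<subseteq> loops e z"
  shows "edges e z (concat ls) = (\<Sum>l\<leftarrow>ls. edges e z l)"
  using assms by (induction ls) (auto simp: loops_def simp del: endpoint_simps(2))

text \<open>Loops at \<open>z\<close> can be glued in any order because each starts and ends at
  \<open>z\<close>. The multiset of edges does not see the order, and each loop contributes only its
  first letter to the exits, so these are rotated in the same way.\<close>

lemma rotate_loops:
  assumes w: "endpoint e x w = z"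
  shows "cut_at e z x (rotate_loops e z x w) = (fst (cut_at e z x w), rotate1 (snd (cut_at e z x w)))"
    and "endpoint e x (rotate_loops e z x w) = z"
    and "exits e z x (rotate_loops e z x w) = rotate1 (exits e z x w)"
    and "edges e x (rotate_loops e z x w) = edges e x w"
    and "length (rotate_loops e z x w) = length w"
proof -
  obtain p ls where s: "cut_at e z x w = (p, ls)"
    by force
  note c = cut_at_correct[OF w s]
  have r: "rotate_loops e z x w = p @ concat (rotate1 ls)"
    by (simp add: rotate_loops_def s)
  have ls: "set ls \<subseteq> loops e z" "set (rotate1 ls) \<subseteq> loops e z"
    using c by auto
  show "cut_at e z x (rotate_loops e z x w) = (fst (cut_at e z x w), rotate1 (snd (cut_at e z x w)))"
    unfolding r s using cut_at_first[of e z x p] cut_at_loops[OF ls(2)] c by simp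
  show "endpoint e x (rotate_loops e z x w) = z"
    unfolding r using c exits_loops[OF ls(2)] by simp
  show "exits e z x (rotate_loops e z x w) = rotate1 (exits e z x w)"
    unfolding r using c exits_loops[OF ls(2)] exits_loops[OF ls(1)] by (simp add: rotate1_map)
  have "(\<Sum>l\<leftarrow>rotate1 ls. edges e z l) = (\<Sum>l\<leftarrow>ls. edges e z l)"
    by (cases ls) auto
  then show *: "edges e x (rotate_loops e z x w) = edges e x w"
    unfolding r using c edges_concat_loops[OF ls(1)] edges_concat_loops[OF ls(2)] by simp
  show "length (rotate_loops e z x w) = length w"
    using arg_cong[OF *, of size] by simp
qed

text \<open>The cut of the rotated word is the rotated cut, and a cut determines its word.\<close>

lemma inj_on_rotate_loops: "inj_on (rotate_loops e z x) {w. endpoint e x w = z}"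
proof (rule inj_onI)
  fix w w' assume w: "w \<in> {w. endpoint e x w = z}" "w' \<in> {w. endpoint e x w = z}"
    and eq: "rotate_loops e z x w = rotate_loops e z x w'"
  obtain p ls where s: "cut_at e z x w = (p, ls)"
    by force
  obtain p' ls' where s': "cut_at e z x w' = (p', ls')"
    by force
  have "w = p @ concat ls" "w' = p' @ concat ls'"
    using cut_at_correct[OF _ s] cut_at_correct[OF _ s'] w by blast+
  moreover have "(p, rotate1 ls) = (p', rotate1 ls')"
    using rotate_loops(1)[of e x w z] rotate_loops(1)[of e x w' z] w eq s s' by simp
  then have "p = p' \<and> ls = ls'"
    by (cases ls; cases ls') auto
  ultimately show "w = w'"
    by simp
qed

text \<open>Among the cyclic rotations of \<open>xs\<close>, every position comes last exactly
  once.\<close>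

lemma count_list_eq_rotate:
  "count_list xs k = (\<Sum>i<length xs. if last (rotate i xs) = k then 1 else 0)"
proof -
  define n where "n = length xs"
  have "count_list xs k = (\<Sum>i<n. if xs ! i = k then 1 else 0)"
    unfolding n_def
  proof (induction xs)
    case (Cons x xs)
    then show ?case
      unfolding length_Cons by (subst sum.lessThan_Suc_shift) simp
  qed simp
  \<comment> \<open>Rotation by \<open>i\<close> brings the letter with index
    \<open>n - 1 + i\<close> modulo \<open>n\<close> to the end, so the summation index is shifted
    accordingly.\<close>
  also have "\<dots> = (\<Sum>i<n. if xs ! ((n - 1 + i) mod n) = k then 1 else 0)"
  proof (cases n)
    case (Suc m)
    have "(m + Suc i) mod Suc m = i" if "i < m" for i
      using that by (metis add_Suc_shift less_SucI mod_add_self1 mod_less)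
    then show ?thesis
      unfolding Suc by (subst sum.lessThan_Suc_shift) (simp add: add.commute)
  qed simp
  also have "\<dots> = (\<Sum>i<n. if last (rotate i xs) = k then 1 else 0)"
  proof (rule sum.cong[OF refl])
    fix i assume i: "i \<in> {..<n}"
    then have ne: "rotate i xs \<noteq> []"
      by (auto simp: n_def)
    have "last (rotate i xs) = xs ! ((i + (n - 1)) mod n)"
      unfolding last_conv_nth[OF ne] using i by (subst nth_rotate) (auto simp: n_def)
    then show "(if xs ! ((n - 1 + i) mod n) = k then 1 else 0) = (if last (rotate i xs) = k then 1 else 0)"
      by (simp only: add.commute)
  qed
  finally show ?thesis
    by (simp add: n_def)
qed

text \<open>\<open>F\<close> sees only the edges and is therefore constant under rotation, while the
  exits along \<open>k\<close> are counted by the rotations that end with \<open>k\<close>. For a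
  word without exits, the unspecified \<open>last []\<close> is multiplied by 0.\<close>

lemma sum_rotate_loops:
  fixes F :: "('a::ab_group_add \<times> 'k::finite) multiset \<Rightarrow> real"
  shows "(\<Sum>w | length w = t \<and> endpoint e x w = z. real (count (edges e x w) (z, k)) * F (edges e x w)) =
    (\<Sum>w | length w = t \<and> endpoint e x w = z.
       real (length (exits e z x w)) * of_bool (last (exits e z x w) = k) * F (edges e x w))"
proof -
  \<comment> \<open>The number of exits is the number of loops, hence the number of rotations to
    average over; words are grouped by it.\<close>
  define W where "W n = {w. length w = t \<and> endpoint e x w = z \<and> length (exits e z x w) = n}" for n
  have fin: "finite {w :: 'k list. length w = t \<and> P w}" for P
    by (rule finite_subset[OF _ finite_lists_length_eq[of UNIV t]]) auto
  have bij: "bij_betw (rotate_loops e z x ^^ i) (W n) (W n)" for i n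
  proof -
    have "bij_betw (rotate_loops e z x) (W n) (W n)"
    proof (intro bij_betw_imageI endo_inj_surj)
      show "inj_on (rotate_loops e z x) (W n)" "inj_on (rotate_loops e z x) (W n)"
        by (rule inj_on_subset[OF inj_on_rotate_loops], auto simp: W_def)+
    qed (auto simp: W_def fin rotate_loops)
    then show ?thesis
      by (rule bij_betw_funpow)
  qed
  have it: "exits e z x ((rotate_loops e z x ^^ i) w) = rotate i (exits e z x w) \<and>
      edges e x ((rotate_loops e z x ^^ i) w) = edges e x w" if "w \<in> W n" for i w n
  proof (induction i)
    case (Suc i)
    have "(rotate_loops e z x ^^ i) w \<in> W n"
      using bij[of i n] that by (auto simp: bij_betw_def)
    then show ?case
      using Suc by (auto simp: W_def rotate_loops)
  qed simp
  have *: "(\<Sum>w\<in>W n. real (count (edges e x w) (z, k)) * F (edges e x w)) =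
      (\<Sum>w\<in>W n. real (length (exits e z x w)) * of_bool (last (exits e z x w) = k) * F (edges e x w))" for n
  proof -
    have "(\<Sum>w\<in>W n. real (count (edges e x w) (z, k)) * F (edges e x w)) =
        (\<Sum>w\<in>W n. \<Sum>i<n. of_bool (last (rotate i (exits e z x w)) = k) * F (edges e x w))"
    proof (rule sum.cong[OF refl])
      fix w assume "w \<in> W n"
      then have n: "length (exits e z x w) = n"
        by (simp add: W_def)
      have "real (count (edges e x w) (z, k)) = (\<Sum>i<n. of_bool (last (rotate i (exits e z x w)) = k))"
        unfolding count_edges count_list_eq_rotate n of_nat_sum by (rule sum.cong) auto
      then show "real (count (edges e x w) (z, k)) * F (edges e x w) =
          (\<Sum>i<n. of_bool (last (rotate i (exits e z x w)) = k) * F (edges e x w))"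
        by (simp only: sum_distrib_right)
    qed
    also have "\<dots> = (\<Sum>i<n. \<Sum>w\<in>W n. of_bool (last (exits e z x ((rotate_loops e z x ^^ i) w)) = k) *
        F (edges e x ((rotate_loops e z x ^^ i) w)))"
      by (subst sum.swap) (intro sum.cong refl, simp add: it)
    also have "\<dots> = (\<Sum>i<n. \<Sum>w\<in>W n. of_bool (last (exits e z x w) = k) * F (edges e x w))"
      by (intro sum.cong refl sum.reindex_bij_betw[OF bij])
    also have "\<dots> = (\<Sum>w\<in>W n. real n * of_bool (last (exits e z x w) = k) * F (edges e x w))"
      by (simp add: sum_distrib_left mult.assoc)
    also have "\<dots> = (\<Sum>w\<in>W n. real (length (exits e z x w)) * of_bool (last (exits e z x w) = k) * F (edges e x w))"
      by (rule sum.cong) (auto simp: W_def)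
    finally show ?thesis .
  qed
  have le: "length (exits e z x w) \<le> length w" for w
  proof (induction w arbitrary: x)
    case (Cons k w)
    from Cons[of "x + e k"] show ?case
      by auto
  qed simp
  have split: "(\<Sum>w | length w = t \<and> endpoint e x w = z. f w) = (\<Sum>n\<le>t. \<Sum>w\<in>W n. f w)"
    for f :: "'k list \<Rightarrow> real"
  proof -
    have "{w. length w = t \<and> endpoint e x w = z} = (\<Union>n\<le>t. W n)"
      using le by (auto simp: W_def)
    then show ?thesis
      by (simp only:) (rule sum.UNION_disjoint, auto simp: W_def fin)
  qed
  show ?thesis
    unfolding split by (rule sum.cong[OF refl *])
qed

section \<open>Urn weights\<close>

text \<open>The probability that a Polya urn with initial weights \<open>\<alpha>\<close> produces a
  given sequence of draws with counts \<open>N\<close>. It is also the mixed moment of the Dirichlet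
  law, see \<open>nn_integral_dirichlet_monomial\<close>.\<close>

definition urn_weight :: "('k::finite \<Rightarrow> real) \<Rightarrow> ('k \<Rightarrow> nat) \<Rightarrow> real" where
  "urn_weight \<alpha> N =
    (\<Prod>k\<in>UNIV. pochhammer (\<alpha> k) (N k)) / pochhammer (\<Sum>k\<in>UNIV. \<alpha> k) (\<Sum>k\<in>UNIV. N k)"

lemma urn_weight_0 [simp]: "urn_weight \<alpha> (\<lambda>k. 0) = 1"
  by (simp add: urn_weight_def)

lemma urn_weight_upd:
  "urn_weight \<alpha> (N(k := Suc (N k))) =
    urn_weight \<alpha> N * (\<alpha> k + N k) / ((\<Sum>j\<in>UNIV. \<alpha> j) + (\<Sum>j\<in>UNIV. real (N j)))"
proof -
  have "(\<Prod>j\<in>UNIV. pochhammer (\<alpha> j) ((N(k := Suc (N k))) j)) =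
      (\<Prod>j\<in>UNIV. pochhammer (\<alpha> j) (N j) * (if j = k then \<alpha> k + N k else 1))"
    by (rule prod.cong) (auto simp: pochhammer_Suc)
  also have "\<dots> = (\<Prod>j\<in>UNIV. pochhammer (\<alpha> j) (N j)) * (\<alpha> k + N k)"
    by (simp add: prod.distrib)
  finally have 1: "(\<Prod>j\<in>UNIV. pochhammer (\<alpha> j) ((N(k := Suc (N k))) j)) = \<dots>" .
  have "(\<Sum>j\<in>UNIV. (N(k := Suc (N k))) j) = (\<Sum>j\<in>UNIV. N j + (if j = k then 1 else 0))"
    by (rule sum.cong) auto
  also have "\<dots> = Suc (\<Sum>j\<in>UNIV. N j)"
    by (simp add: sum.distrib)
  finally have 2: "(\<Sum>j\<in>UNIV. (N(k := Suc (N k))) j) = \<dots>" .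
  show ?thesis
    unfolding urn_weight_def 1 2 by (simp add: pochhammer_Suc)
qed

lemma urn_weight_nonneg: "(\<And>k. 0 < \<alpha> k) \<Longrightarrow> 0 \<le> urn_weight \<alpha> N"
  unfolding urn_weight_def
  by (intro divide_nonneg_nonneg prod_nonneg pochhammer_nonneg sum_nonneg ballI sum_pos) auto

definition edge_weight :: "('k::finite \<Rightarrow> real) \<Rightarrow> ('a \<times> 'k) multiset \<Rightarrow> real" where
  "edge_weight \<alpha> M = (\<Prod>x\<in>fst ` set_mset M. urn_weight \<alpha> (\<lambda>k. count M (x, k)))"

text \<open>Sites that are never left contribute the factor 1, so the weights of two multisets can
  be compared over a common set of sites.\<close>

lemma edge_weight_superset:
  assumes "finite S" "fst ` set_mset M \<subseteq> S"
  shows "edge_weight \<alpha> M = (\<Prod>x\<in>S. urn_weight \<alpha> (\<lambda>k. count M (x, k)))"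
  unfolding edge_weight_def
proof (rule prod.mono_neutral_left[OF assms], intro ballI)
  fix x assume "x \<in> S - fst ` set_mset M"
  then have "count M (x, k) = 0" for k
    by (force simp: count_eq_zero_iff)
  then show "urn_weight \<alpha> (\<lambda>k. count M (x, k)) = 1"
    by simp
qed

lemma edge_weight_empty [simp]: "edge_weight \<alpha> {#} = 1"
  by (simp add: edge_weight_def)

lemma edge_weight_nonneg: "(\<And>k. 0 < \<alpha> k) \<Longrightarrow> 0 \<le> edge_weight \<alpha> M"
  unfolding edge_weight_def by (intro prod_nonneg ballI urn_weight_nonneg)

text \<open>The factor gained is the transition probability of the annealed walk: the urn at
  \<open>x\<close> has already received \<open>count M (x, k)\<close> balls of colour
  \<open>k\<close>.\<close>

lemma edge_weight_add_mset:
  fixes M :: "('a \<times> 'k::finite) multiset"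
  shows "edge_weight \<alpha> (add_mset (x, k) M) = edge_weight \<alpha> M * (\<alpha> k + count M (x, k)) /
    ((\<Sum>j\<in>UNIV. \<alpha> j) + (\<Sum>j\<in>UNIV. real (count M (x, j))))"
proof -
  define S where "S = insert x (fst ` set_mset M)"
  have S: "finite S" "x \<in> S" "fst ` set_mset M \<subseteq> S" "fst ` set_mset (add_mset (x, k) M) \<subseteq> S"
    by (auto simp: S_def)
  define f where "f M y = urn_weight \<alpha> (\<lambda>k. count M (y, k))" for y :: 'a and M
  have 1: "f (add_mset (x, k) M) x = f M x * (\<alpha> k + count M (x, k)) /
      ((\<Sum>j\<in>UNIV. \<alpha> j) + (\<Sum>j\<in>UNIV. real (count M (x, j))))"
  proof -
    have "(\<lambda>j. count (add_mset (x, k) M) (x, j)) = (\<lambda>j. count M (x, j))(k := Suc (count M (x, k)))"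
      by auto
    then show ?thesis
      using urn_weight_upd[of \<alpha> "\<lambda>j. count M (x, j)" k] by (simp only: f_def)
  qed
  have 2: "f (add_mset (x, k) M) y = f M y" if "y \<in> S - {x}" for y
    using that by (auto simp: f_def)
  have "edge_weight \<alpha> (add_mset (x, k) M) = (\<Prod>y\<in>S. f (add_mset (x, k) M) y)"
    unfolding f_def by (rule edge_weight_superset[OF S(1,4)])
  also have "\<dots> = f (add_mset (x, k) M) x * (\<Prod>y\<in>S - {x}. f M y)"
    using S by (subst prod.remove[of _ x]) (auto simp: 2)
  also have "\<dots> = (\<Prod>y\<in>S. f M y) * (\<alpha> k + count M (x, k)) /
      ((\<Sum>j\<in>UNIV. \<alpha> j) + (\<Sum>j\<in>UNIV. real (count M (x, j))))"
    using S by (subst prod.remove[of S x]) (auto simp: 1)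
  also have "(\<Prod>y\<in>S. f M y) = edge_weight \<alpha> M"
    unfolding f_def by (rule edge_weight_superset[OF S(1,3), symmetric])
  finally show ?thesis .
qed

lemma sum_edge_weight_add_mset:
  fixes \<alpha> :: "'k::finite \<Rightarrow> real"
  assumes "\<And>k. 0 < \<alpha> k"
  shows "(\<Sum>k\<in>UNIV. edge_weight \<alpha> (add_mset (x, k) M)) = edge_weight \<alpha> M"
proof -
  have "0 < (\<Sum>j\<in>UNIV. \<alpha> j) + (\<Sum>j\<in>UNIV. real (count M (x, j)))"
    using assms by (intro add_pos_nonneg sum_pos sum_nonneg) auto
  then show ?thesis
    unfolding edge_weight_add_mset
    by (simp add: sum_divide_distrib[symmetric] sum_distrib_left[symmetric] sum.distrib)
qed

lemma edge_weight_add_disjoint: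
  assumes "fst ` set_mset M \<inter> fst ` set_mset N = {}"
  shows "edge_weight \<alpha> (M + N) = edge_weight \<alpha> M * edge_weight \<alpha> N"
proof -
  have M: "count N (x, k) = 0" if "x \<in> fst ` set_mset M" for x k
    using that assms by (force simp: count_eq_zero_iff)
  have N: "count M (x, k) = 0" if "x \<in> fst ` set_mset N" for x k
    using that assms by (force simp: count_eq_zero_iff)
  show ?thesis
    unfolding edge_weight_def set_mset_union image_Un
    by (subst prod.union_disjoint) (use assms in \<open>auto simp: M N intro!: arg_cong2[where f = "(*)"] prod.cong\<close>)
qed

lemma edges_translate:
  "edges e (x + c) w = image_mset (\<lambda>(y, k). (y + c, k)) (edges e x w)"
proof (induction w arbitrary: x)
  case (Cons k w)
  have "x + c + e k = x + e k + c"
    by (simp add: ac_simps)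
  then show ?case
    using Cons[of "x + e k"] by (simp only: edges.simps image_mset_add_mset split)
qed simp

lemma edge_weight_translate:
  fixes c :: "'a::ab_group_add"
  shows "edge_weight \<alpha> (image_mset (\<lambda>(y, k). (y + c, k)) M) = edge_weight \<alpha> M"
proof -
  have "count (image_mset (\<lambda>(y, k). (y + c, k)) M) (x + c, k) = count M (x, k)" for x k
    by (induction M) auto
  moreover have "fst ` set_mset (image_mset (\<lambda>(y, k). (y + c, k)) M) = (\<lambda>y. y + c) ` fst ` set_mset M"
    by (force simp: image_iff)
  moreover have "inj_on (\<lambda>y. y + c) S" for S
    by (auto simp: inj_on_def)
  ultimately show ?thesis
    unfolding edge_weight_def by (simp add: prod.reindex)
qed

lemma edge_weight_edges_translate: "edge_weight \<alpha> (edges e x w) = edge_weight \<alpha> (edges e 0 w)"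
  using edges_translate[of e 0 x w] by (simp add: edge_weight_translate)

section \<open>Occupation times before leaving a set\<close>

definition pre :: "nat \<Rightarrow> (nat \<Rightarrow> 'k) \<Rightarrow> 'k list" where
  "pre t \<omega> = map \<omega> [0..<t]"

definition shift :: "nat \<Rightarrow> (nat \<Rightarrow> 'k) \<Rightarrow> nat \<Rightarrow> 'k" where
  "shift n \<omega> = (\<lambda>i. \<omega> (n + i))"

abbreviation path_space :: "(nat \<Rightarrow> 'k) measure" where
  "path_space \<equiv> \<Pi>\<^sub>M i\<in>UNIV. count_space UNIV"

lemma pre_0 [simp]: "pre 0 \<omega> = []"
  and pre_Suc: "pre (Suc t) \<omega> = pre t \<omega> @ [\<omega> t]"
  and length_pre [simp]: "length (pre t \<omega>) = t"
  by (simp_all add: pre_def)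

lemma nth_pre [simp]: "i < t \<Longrightarrow> pre t \<omega> ! i = \<omega> i"
  by (simp add: pre_def)

lemma pre_add: "pre (s + t) \<omega> = pre s \<omega> @ pre t (shift s \<omega>)"
  by (induction t) (simp_all add: pre_Suc shift_def)

lemma take_pre: "i \<le> t \<Longrightarrow> take i (pre t \<omega>) = pre i \<omega>"
  by (simp add: pre_def take_map)

lemma pre_eq_iff: "pre t \<omega> = w \<longleftrightarrow> length w = t \<and> (\<forall>i<t. \<omega> i = w ! i)"
  by (auto simp: pre_def list_eq_iff_nth_eq)

lemma measurable_pre: "pre t \<in> measurable path_space (count_space (UNIV :: 'k::countable list set))"
proof (subst measurable_count_space_eq_countable, safe)
  fix w :: "'k list"
  have "{\<omega> \<in> space path_space. length w = t \<and> (\<forall>i\<in>{..<t}. \<omega> i = w ! i)} \<in> sets path_space"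
    by measurable
  also have "{\<omega> \<in> space path_space. length w = t \<and> (\<forall>i\<in>{..<t}. \<omega> i = w ! i)} =
      pre t -` {w} \<inter> space path_space"
    by (auto simp: pre_eq_iff)
  finally show "pre t -` {w} \<inter> space path_space \<in> sets path_space" .
qed auto

lemma measurable_pre_fun [measurable]:
  "(\<lambda>\<omega>. f (pre t \<omega>)) \<in> measurable path_space (count_space (UNIV :: 'b set))"
  for f :: "'k::countable list \<Rightarrow> 'b"
  by (rule measurable_compose[OF measurable_pre]) simp

lemma measurable_pre_fun_borel [measurable]:
  "(\<lambda>\<omega>. f (pre t \<omega>)) \<in> borel_measurable path_space"
  for f :: "'k::countable list \<Rightarrow> 'b::topological_space"
  by (rule measurable_compose[OF measurable_pre]) simp

lemma measurable_shift [measurable]: "shift n \<in> measurable path_space path_space"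
  unfolding shift_def by (rule measurable_PiM_single') auto

lemma finite_words [simp]: "finite {w :: 'k::finite list. length w = t \<and> P w}"
  "finite {w :: 'k::finite list. length w = t}"
  using finite_lists_length_eq[of "UNIV :: 'k set" t] by (auto elim: finite_subset[rotated])

lemma sum_words_Suc:
  "(\<Sum>w | length w = Suc t. f w) = (\<Sum>w | length w = t. \<Sum>k\<in>UNIV. f (w @ [k]))"
  for f :: "'k::finite list \<Rightarrow> real"
proof -
  have "(\<Sum>w | length w = t. \<Sum>k\<in>UNIV. f (w @ [k])) =
      (\<Sum>(w, k)\<in>{w. length w = t} \<times> UNIV. f (w @ [k]))"
    by (simp add: sum.cartesian_product)
  also have "\<dots> = (\<Sum>w | length w = Suc t. f w)"
    by (rule sum.reindex_bij_witness[of _ "\<lambda>w. (butlast w, last w)" "\<lambda>(w, k). w @ [k]"])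
      (auto simp: length_Suc_conv_rev)
  finally show ?thesis ..
qed

lemma sum_count_list_UNIV: "(\<Sum>k\<in>UNIV. count_list xs k) = length xs"
  for xs :: "'k::finite list"
proof (induction xs)
  case (Cons x xs)
  have "(\<Sum>k\<in>UNIV. count_list (x # xs) k) = (\<Sum>k\<in>UNIV. count_list xs k + (if k = x then 1 else 0))"
    by (rule sum.cong) auto
  then show ?case
    using Cons by (simp add: sum.distrib)
qed simp

text \<open>The law of the steps after the environment has been integrated out: the Dirichlet
  weights enter only through \<open>cylinder\<close>. Sites may lie in any abelian group.\<close>

locale polya_walk = prob_space Q
  for Q :: "(nat \<Rightarrow> 'k::finite) measure" +
  fixes e :: "'k \<Rightarrow> 'a::ab_group_add" and \<alpha> :: "'k \<Rightarrow> real"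
  assumes sets_Q [measurable_cong]: "sets Q = sets path_space"
    and \<alpha>_pos: "0 < \<alpha> k"
    and cylinder: "prob {\<omega>. pre (length w) \<omega> = w} = edge_weight \<alpha> (edges e 0 w)"
begin

abbreviation wt :: "'k list \<Rightarrow> real" where
  "wt w \<equiv> edge_weight \<alpha> (edges e 0 w)"

lemma space_Q [simp]: "space Q = UNIV"
  using sets_eq_imp_space_eq[OF sets_Q] by (simp add: space_PiM)

lemma wt_nonneg: "0 \<le> wt w"
  by (intro edge_weight_nonneg \<alpha>_pos)

lemma sum_\<alpha>_pos: "0 < (\<Sum>k\<in>UNIV. \<alpha> k)"
  by (intro sum_pos) (auto simp: \<alpha>_pos)

lemma integral_pre:
  fixes f :: "'k list \<Rightarrow> real"
  shows "integrable Q (\<lambda>\<omega>. f (pre t \<omega>))"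
    and "(\<integral>\<omega>. f (pre t \<omega>) \<partial>Q) = (\<Sum>w | length w = t. f w * wt w)"
proof -
  have eq: "f (pre t \<omega>) = (\<Sum>w | length w = t. f w * indicator {\<omega>. pre (length w) \<omega> = w} \<omega>)" for \<omega>
  proof -
    have "(\<Sum>w | length w = t. f w * indicator {\<omega>. pre (length w) \<omega> = w} \<omega>) =
        (\<Sum>w | length w = t. if w = pre t \<omega> then f w else 0)"
      by (rule sum.cong) (auto simp: indicator_def)
    then show ?thesis
      by simp
  qed
  have [measurable]: "{\<omega>. pre (length w) \<omega> = w} \<in> sets Q" for w
    using measurable_sets[OF measurable_pre_fun[of "\<lambda>u. u = w"], of "{True}" "length w"]
    by (simp add: sets_Q vimage_def space_PiM)
  show "integrable Q (\<lambda>\<omega>. f (pre t \<omega>))"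
    unfolding eq
    by (intro Bochner_Integration.integrable_sum integrable_mult_right integrable_real_indicator)
      (auto simp: less_top[symmetric])
  show "(\<integral>\<omega>. f (pre t \<omega>) \<partial>Q) = (\<Sum>w | length w = t. f w * wt w)"
    unfolding eq
  proof (subst Bochner_Integration.integral_sum)
    show "integrable Q (\<lambda>\<omega>. f w * indicator {\<omega>. pre (length w) \<omega> = w} \<omega>)" for w
      by (intro integrable_mult_right integrable_real_indicator) (auto simp: less_top[symmetric])
  qed (auto simp: cylinder[symmetric] intro!: sum.cong)
qed

lemma integral_pre_step:
  fixes f :: "'k list \<Rightarrow> real"
  shows "integrable Q (\<lambda>\<omega>. f (pre t \<omega>) * of_bool (\<omega> t = k))"
    and "(\<integral>\<omega>. f (pre t \<omega>) * of_bool (\<omega> t = k) \<partial>Q) = (\<Sum>w | length w = t. f w * wt (w @ [k]))"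
proof -
  define g where "g w = f (butlast w) * of_bool (last w = k)" for w
  have eq: "f (pre t \<omega>) * of_bool (\<omega> t = k) = g (pre (Suc t) \<omega>)" for \<omega>
    by (simp add: g_def pre_Suc)
  show "integrable Q (\<lambda>\<omega>. f (pre t \<omega>) * of_bool (\<omega> t = k))"
    unfolding eq by (rule integral_pre)
  have "(\<integral>\<omega>. f (pre t \<omega>) * of_bool (\<omega> t = k) \<partial>Q) =
      (\<Sum>w | length w = t. \<Sum>j\<in>UNIV. g (w @ [j]) * wt (w @ [j]))"
    unfolding eq integral_pre sum_words_Suc ..
  also have "\<dots> = (\<Sum>w | length w = t. \<Sum>j\<in>UNIV. if j = k then f w * wt (w @ [j]) else 0)"
    by (intro sum.cong refl) (simp add: g_def)
  finally show "(\<integral>\<omega>. f (pre t \<omega>) * of_bool (\<omega> t = k) \<partial>Q) =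
      (\<Sum>w | length w = t. f w * wt (w @ [k]))"
    by simp
qed

definition pos :: "nat \<Rightarrow> (nat \<Rightarrow> 'k) \<Rightarrow> 'a" where
  "pos t \<omega> = endpoint e 0 (pre t \<omega>)"

text \<open>Stated through the edge multiset and the endpoint, both of which are preserved by
  rotating loops.\<close>

definition alive :: "'a set \<Rightarrow> 'k list \<Rightarrow> bool" where
  "alive U w \<longleftrightarrow> fst ` set_mset (edges e 0 w) \<subseteq> U \<and> endpoint e 0 w \<in> U"

lemma pos_simps [simp]: "pos 0 \<omega> = 0" "pos (Suc t) \<omega> = pos t \<omega> + e (\<omega> t)"
  by (simp_all add: pos_def pre_Suc)

text \<open>
  The sum of \<open>(n + 1) [\<omega>\<^sub>t = k] - last_exit z k\<close> over the visits of \<open>z\<close> telescopes, where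
  \<open>n\<close> is the number of previous visits.
\<close>

definition last_exit :: "'a \<Rightarrow> 'k \<Rightarrow> 'k list \<Rightarrow> real" where
  "last_exit z k w = real (length (exits e z 0 w)) * of_bool (last (exits e z 0 w) = k)"

text \<open>Until \<open>U\<close> is left, the sum equals the current \<open>last_exit\<close>,
  which lies between 0 and the number of exits; afterwards both sums are frozen.\<close>

lemma telescope_last_exit:
  fixes \<omega> :: "nat \<Rightarrow> 'k" and U z k
  defines "B t \<equiv> alive U (pre t \<omega>) \<and> pos t \<omega> = z"
  defines "S t \<equiv> (\<Sum>s<t. of_bool (B s) *
      ((real (length (exits e z 0 (pre s \<omega>))) + 1) * of_bool (\<omega> s = k) - last_exit z k (pre s \<omega>)))"
  defines "V t \<equiv> (\<Sum>s<t. of_bool (B s) :: real)"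
  shows "0 \<le> S t \<and> S t \<le> V t"
proof -
  \<comment> \<open>The invariant only asks that the sites already left lie in \<open>U\<close>: the
    very step that leaves \<open>U\<close> still updates the sums.\<close>
  have "(fst ` set_mset (edges e 0 (pre t \<omega>)) \<subseteq> U \<longrightarrow>
      S t = last_exit z k (pre t \<omega>) \<and> V t = real (length (exits e z 0 (pre t \<omega>)))) \<and>
      0 \<le> S t \<and> S t \<le> V t"
  proof (induction t)
    case 0
    then show ?case
      by (simp add: S_def V_def last_exit_def)
  next
    case (Suc t)
    have src: "fst ` set_mset (edges e 0 (pre (Suc t) \<omega>)) =
        insert (pos t \<omega>) (fst ` set_mset (edges e 0 (pre t \<omega>)))"
      by (simp add: pre_Suc pos_def)
    have S: "S (Suc t) = S t + of_bool (B t) *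
        ((real (length (exits e z 0 (pre t \<omega>))) + 1) * of_bool (\<omega> t = k) - last_exit z k (pre t \<omega>))"
      and V: "V (Suc t) = V t + of_bool (B t)"
      by (simp_all add: S_def V_def)
    show ?case
    proof (cases "B t")
      case True
      then have "fst ` set_mset (edges e 0 (pre t \<omega>)) \<subseteq> U" "pos t \<omega> = z"
        by (auto simp: B_def alive_def)
      then have IH: "S t = last_exit z k (pre t \<omega>)" "V t = real (length (exits e z 0 (pre t \<omega>)))"
        using Suc by auto
      have ex: "exits e z 0 (pre (Suc t) \<omega>) = exits e z 0 (pre t \<omega>) @ [\<omega> t]"
        using \<open>pos t \<omega> = z\<close> by (simp add: pre_Suc pos_def)
      have "S (Suc t) = last_exit z k (pre (Suc t) \<omega>)" "V (Suc t) = real (length (exits e z 0 (pre (Suc t) \<omega>)))"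
        using True unfolding S V IH by (simp_all add: last_exit_def ex)
      then show ?thesis
        by (auto simp: last_exit_def)
    next
      case False
      have ex: "exits e z 0 (pre (Suc t) \<omega>) = exits e z 0 (pre t \<omega>)" if "pos t \<omega> \<noteq> z"
        using that by (simp add: pre_Suc pos_def)
      show ?thesis
        using False Suc ex unfolding S V src
        by (auto simp: B_def alive_def pos_def last_exit_def)
    qed
  qed
  then show ?thesis
    by blast
qed

text \<open>The urn recursion turns the probability of the step \<open>k\<close> into
  \<open>\<alpha> k\<close> plus the number of earlier exits along \<open>k\<close>, and rotating
  the loops at \<open>z\<close> replaces that number by \<open>last_exit\<close>.\<close>

lemma kalikow_step:
  fixes U z k t
  defines "B \<omega> \<equiv> of_bool (alive U (pre t \<omega>) \<and> pos t \<omega> = z) :: real"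
  defines "n \<omega> \<equiv> real (length (exits e z 0 (pre t \<omega>)))"
  shows "(\<integral>\<omega>. B \<omega> * ((sum \<alpha> UNIV + n \<omega>) * of_bool (\<omega> t = k) - \<alpha> k - last_exit z k (pre t \<omega>)) \<partial>Q) = 0"
proof -
  define b where "b w = (of_bool (alive U w \<and> endpoint e 0 w = z) :: real)" for w
  define c where "c w = b w * (sum \<alpha> UNIV + real (length (exits e z 0 w)))" for w
  define d where "d w = b w * (\<alpha> k + last_exit z k w)" for w
  \<comment> \<open>Survival in \<open>U\<close> is a condition on the edges once the endpoint is
    \<open>z\<close>, so it can be absorbed into the function to which the rotation identity is
    applied.\<close>
  define F where "F M = (of_bool (z \<in> U \<and> fst ` set_mset M \<subseteq> U) * edge_weight \<alpha> M :: real)" for M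
  have sum_b: "(\<Sum>w | length w = t. b w * f w * wt w) =
      (\<Sum>w | length w = t \<and> endpoint e 0 w = z. f w * F (edges e 0 w))" for f
    by (rule sum.mono_neutral_cong_right) (auto simp: b_def F_def alive_def)
  have "(\<integral>\<omega>. B \<omega> * ((sum \<alpha> UNIV + n \<omega>) * of_bool (\<omega> t = k) - \<alpha> k - last_exit z k (pre t \<omega>)) \<partial>Q) =
      (\<integral>\<omega>. c (pre t \<omega>) * of_bool (\<omega> t = k) - d (pre t \<omega>) \<partial>Q)"
    by (rule Bochner_Integration.integral_cong)
      (auto simp: B_def n_def c_def d_def b_def pos_def algebra_simps)
  also have "\<dots> = (\<Sum>w | length w = t. c w * wt (w @ [k])) - (\<Sum>w | length w = t. d w * wt w)"
    by (simp add: integral_pre integral_pre_step)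
  also have "(\<Sum>w | length w = t. c w * wt (w @ [k])) =
      (\<Sum>w | length w = t. b w * (\<alpha> k + count (edges e 0 w) (z, k)) * wt w)"
  proof (rule sum.cong[OF refl])
    fix w
    have n: "(\<Sum>j\<in>UNIV. real (count (edges e 0 w) (z, j))) = real (length (exits e z 0 w))"
      unfolding count_edges of_nat_sum[symmetric] by (simp add: sum_count_list_UNIV)
    have "0 < sum \<alpha> UNIV + real (length (exits e z 0 w))"
      using sum_\<alpha>_pos by simp
    then show "c w * wt (w @ [k]) = b w * (\<alpha> k + count (edges e 0 w) (z, k)) * wt w"
      by (auto simp: c_def b_def edge_weight_add_mset n)
  qed
  also have "\<dots> - (\<Sum>w | length w = t. d w * wt w) =
      (\<Sum>w | length w = t. b w * real (count (edges e 0 w) (z, k)) * wt w) -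
      (\<Sum>w | length w = t. b w * last_exit z k w * wt w)"
    by (simp add: d_def algebra_simps sum.distrib sum_subtractf)
  also have "\<dots> = 0"
    unfolding sum_b last_exit_def using sum_rotate_loops[where e = e and x = 0 and t = t and z = z and k = k and F = F] by simp
  finally show ?thesis .
qed

text \<open>In \<open>kalikow_step\<close>, the integrand (A + n) I - \<alpha> k - L, with I the
  indicator of the step \<open>k\<close> and L the value of \<open>last_exit\<close>, equals (A - 1)
  I - \<alpha> k + ((n + 1) I - L). The last bracket is the telescoping term; its sum over the
  visits lies between 0 and their number, which gives one estimate each.\<close>

lemma kalikow:
  fixes U z k N
  defines "G \<equiv> (\<Sum>t<N. \<integral>\<omega>. of_bool (alive U (pre t \<omega>) \<and> pos t \<omega> = z) \<partial>Q) :: real"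
  defines "Gk \<equiv> (\<Sum>t<N. \<integral>\<omega>. of_bool (alive U (pre t \<omega>) \<and> pos t \<omega> = z) * of_bool (\<omega> t = k) \<partial>Q) :: real"
  shows "(\<alpha> k - 1) * G \<le> (sum \<alpha> UNIV - 1) * Gk" "(sum \<alpha> UNIV - 1) * Gk \<le> \<alpha> k * G"
proof -
  define B where "B t \<omega> = (of_bool (alive U (pre t \<omega>) \<and> pos t \<omega> = z) :: real)" for t \<omega>
  define n where "n t \<omega> = real (length (exits e z 0 (pre t \<omega>)))" for t \<omega>
  define L where "L t \<omega> = last_exit z k (pre t \<omega>)" for t \<omega>
  define I where "I t \<omega> = (of_bool (\<omega> t = k) :: real)" for t and \<omega> :: "nat \<Rightarrow> 'k"
  have int [simp]: "integrable Q (\<lambda>\<omega>. B t \<omega>)" "integrable Q (\<lambda>\<omega>. B t \<omega> * I t \<omega>)"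
    "integrable Q (\<lambda>\<omega>. B t \<omega> * n t \<omega> * I t \<omega>)" "integrable Q (\<lambda>\<omega>. B t \<omega> * L t \<omega>)" for t
  proof -
    show "integrable Q (\<lambda>\<omega>. B t \<omega>)" "integrable Q (\<lambda>\<omega>. B t \<omega> * L t \<omega>)"
      unfolding B_def L_def pos_def
      using integral_pre(1)[of "\<lambda>w. of_bool (alive U w \<and> endpoint e 0 w = z)" t]
        integral_pre(1)[of "\<lambda>w. of_bool (alive U w \<and> endpoint e 0 w = z) * last_exit z k w" t] by simp_all
    show "integrable Q (\<lambda>\<omega>. B t \<omega> * I t \<omega>)" "integrable Q (\<lambda>\<omega>. B t \<omega> * n t \<omega> * I t \<omega>)"
      unfolding B_def n_def I_def pos_def
      using integral_pre_step(1)[of "\<lambda>w. of_bool (alive U w \<and> endpoint e 0 w = z)" t k]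
        integral_pre_step(1)[of "\<lambda>w. of_bool (alive U w \<and> endpoint e 0 w = z) * real (length (exits e z 0 w))" t k]
      by simp_all
  qed
  define S where "S t \<omega> = B t \<omega> * ((n t \<omega> + 1) * I t \<omega> - L t \<omega>)" for t \<omega>
  have S_eq: "S t = (\<lambda>\<omega>. B t \<omega> * n t \<omega> * I t \<omega> + B t \<omega> * I t \<omega> - B t \<omega> * L t \<omega>)" for t
    by (simp add: S_def fun_eq_iff algebra_simps)
  have int_S: "integrable Q (S t)" for t
    unfolding S_eq by simp
  have step: "(sum \<alpha> UNIV - 1) * (\<integral>\<omega>. B t \<omega> * I t \<omega> \<partial>Q) - \<alpha> k * (\<integral>\<omega>. B t \<omega> \<partial>Q) + (\<integral>\<omega>. S t \<omega> \<partial>Q) = 0" for t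
  proof -
    have "0 = (\<integral>\<omega>. B t \<omega> * ((sum \<alpha> UNIV + n t \<omega>) * I t \<omega> - \<alpha> k - L t \<omega>) \<partial>Q)"
      using kalikow_step[of U t z k] by (simp add: B_def n_def I_def L_def)
    also have "\<dots> = (\<integral>\<omega>. (sum \<alpha> UNIV - 1) * (B t \<omega> * I t \<omega>) - \<alpha> k * B t \<omega> + S t \<omega> \<partial>Q)"
      by (rule Bochner_Integration.integral_cong) (auto simp: S_def algebra_simps)
    also have "\<dots> = (sum \<alpha> UNIV - 1) * (\<integral>\<omega>. B t \<omega> * I t \<omega> \<partial>Q) - \<alpha> k * (\<integral>\<omega>. B t \<omega> \<partial>Q) + (\<integral>\<omega>. S t \<omega> \<partial>Q)"
      by (subst Bochner_Integration.integral_add) (auto simp: int_S)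
    finally show ?thesis ..
  qed
  have eq: "(sum \<alpha> UNIV - 1) * Gk - \<alpha> k * G + (\<Sum>t<N. \<integral>\<omega>. S t \<omega> \<partial>Q) = 0"
    using arg_cong[OF ext[OF step], of "\<lambda>f. sum f {..<N}"]
    by (simp add: G_def Gk_def B_def I_def sum.distrib sum_subtractf sum_distrib_left)
  have tele: "0 \<le> (\<Sum>t<N. S t \<omega>)" "(\<Sum>t<N. S t \<omega>) \<le> (\<Sum>t<N. B t \<omega>)" for \<omega>
    using telescope_last_exit[where U = U and z = z and k = k and \<omega> = \<omega> and t = N]
    by (simp_all add: S_def B_def n_def I_def L_def)
  have "(\<Sum>t<N. \<integral>\<omega>. S t \<omega> \<partial>Q) = (\<integral>\<omega>. (\<Sum>t<N. S t \<omega>) \<partial>Q)"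
    by (rule Bochner_Integration.integral_sum[symmetric]) (rule int_S)
  moreover have "0 \<le> (\<integral>\<omega>. (\<Sum>t<N. S t \<omega>) \<partial>Q)"
    by (rule Bochner_Integration.integral_nonneg) (rule tele)
  moreover have "(\<integral>\<omega>. (\<Sum>t<N. S t \<omega>) \<partial>Q) \<le> (\<integral>\<omega>. (\<Sum>t<N. B t \<omega>) \<partial>Q)"
    by (rule integral_mono) (auto intro: int_S tele)
  moreover have "(\<integral>\<omega>. (\<Sum>t<N. B t \<omega>) \<partial>Q) = G"
    unfolding G_def B_def[symmetric] by (rule Bochner_Integration.integral_sum) simp
  ultimately have "0 \<le> (\<Sum>t<N. \<integral>\<omega>. S t \<omega> \<partial>Q)" "(\<Sum>t<N. \<integral>\<omega>. S t \<omega> \<partial>Q) \<le> G"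
    by simp_all
  then show "(\<alpha> k - 1) * G \<le> (sum \<alpha> UNIV - 1) * Gk" "(sum \<alpha> UNIV - 1) * Gk \<le> \<alpha> k * G"
    using eq by (simp_all add: algebra_simps)
qed

text \<open>Only finitely many sites can be reached within \<open>N\<close> steps, so the estimates
  for single sites can be summed with weights. Constant weights give hitting times and
  displacements, exponential ones the probability of never going below the start.\<close>

lemma kalikow_weighted:
  fixes U k N and c :: "'a \<Rightarrow> real"
  assumes c: "\<And>z. 0 \<le> c z"
  defines "G \<equiv> \<Sum>t<N. \<integral>\<omega>. of_bool (alive U (pre t \<omega>)) * c (pos t \<omega>) \<partial>Q"
  defines "Gk \<equiv> \<Sum>t<N. \<integral>\<omega>. of_bool (alive U (pre t \<omega>)) * c (pos t \<omega>) * of_bool (\<omega> t = k) \<partial>Q"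
  shows "(\<alpha> k - 1) * G \<le> (sum \<alpha> UNIV - 1) * Gk" "(sum \<alpha> UNIV - 1) * Gk \<le> \<alpha> k * G"
proof -
  define Z where "Z = (\<Union>t<N. endpoint e 0 ` {w. length w = t})"
  have Z: "finite Z" "t < N \<Longrightarrow> pos t \<omega> \<in> Z" for t \<omega>
    by (auto simp: Z_def pos_def)
  define g :: "'a \<Rightarrow> real" where "g z = (\<Sum>t<N. \<integral>\<omega>. of_bool (alive U (pre t \<omega>) \<and> pos t \<omega> = z) \<partial>Q)" for z
  define h :: "'a \<Rightarrow> real" where "h z = (\<Sum>t<N. \<integral>\<omega>. of_bool (alive U (pre t \<omega>) \<and> pos t \<omega> = z) * of_bool (\<omega> t = k) \<partial>Q)" for z
  have split: "of_bool (alive U (pre t \<omega>)) * c (pos t \<omega>) =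
      (\<Sum>z\<in>Z. c z * of_bool (alive U (pre t \<omega>) \<and> pos t \<omega> = z))" if "t < N" for t \<omega>
  proof -
    have "(\<Sum>z\<in>Z. c z * of_bool (alive U (pre t \<omega>) \<and> pos t \<omega> = z)) =
        (\<Sum>z\<in>Z. if z = pos t \<omega> then c z * of_bool (alive U (pre t \<omega>)) else 0)"
      by (rule sum.cong) auto
    then show ?thesis
      using Z that by simp
  qed
  have int: "integrable Q (\<lambda>\<omega>. of_bool (alive U (pre t \<omega>) \<and> pos t \<omega> = z) :: real)"
    "integrable Q (\<lambda>\<omega>. of_bool (alive U (pre t \<omega>) \<and> pos t \<omega> = z) * of_bool (\<omega> t = k) :: real)" for t z
    using integral_pre(1)[of "\<lambda>w. of_bool (alive U w \<and> endpoint e 0 w = z)" t]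
      integral_pre_step(1)[of "\<lambda>w. of_bool (alive U w \<and> endpoint e 0 w = z)" t k]
    by (simp_all add: pos_def)
  have G: "G = (\<Sum>z\<in>Z. c z * g z)"
  proof -
    have "G = (\<Sum>t<N. \<Sum>z\<in>Z. c z * (\<integral>\<omega>. of_bool (alive U (pre t \<omega>) \<and> pos t \<omega> = z) \<partial>Q))"
      unfolding G_def
    proof (intro sum.cong refl)
      fix t assume "t \<in> {..<N}"
      then have "(\<integral>\<omega>. of_bool (alive U (pre t \<omega>)) * c (pos t \<omega>) \<partial>Q) =
          (\<integral>\<omega>. (\<Sum>z\<in>Z. c z * of_bool (alive U (pre t \<omega>) \<and> pos t \<omega> = z)) \<partial>Q)"
        by (intro Bochner_Integration.integral_cong) (auto simp: split)
      then show "(\<integral>\<omega>. of_bool (alive U (pre t \<omega>)) * c (pos t \<omega>) \<partial>Q) =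
          (\<Sum>z\<in>Z. c z * (\<integral>\<omega>. of_bool (alive U (pre t \<omega>) \<and> pos t \<omega> = z) \<partial>Q))"
        by (simp add: int)
    qed
    then show ?thesis
      by (subst (asm) sum.swap) (simp add: g_def sum_distrib_left)
  qed
  have Gk: "Gk = (\<Sum>z\<in>Z. c z * h z)"
  proof -
    have "Gk = (\<Sum>t<N. \<Sum>z\<in>Z. c z * (\<integral>\<omega>. of_bool (alive U (pre t \<omega>) \<and> pos t \<omega> = z) * of_bool (\<omega> t = k) \<partial>Q))"
      unfolding Gk_def
    proof (intro sum.cong refl)
      fix t assume "t \<in> {..<N}"
      then have "(\<integral>\<omega>. of_bool (alive U (pre t \<omega>)) * c (pos t \<omega>) * of_bool (\<omega> t = k) \<partial>Q) =
          (\<integral>\<omega>. (\<Sum>z\<in>Z. c z * (of_bool (alive U (pre t \<omega>) \<and> pos t \<omega> = z) * of_bool (\<omega> t = k))) \<partial>Q)"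
        by (intro Bochner_Integration.integral_cong) (auto simp: split sum_distrib_right mult.assoc)
      then show "(\<integral>\<omega>. of_bool (alive U (pre t \<omega>)) * c (pos t \<omega>) * of_bool (\<omega> t = k) \<partial>Q) =
          (\<Sum>z\<in>Z. c z * (\<integral>\<omega>. of_bool (alive U (pre t \<omega>) \<and> pos t \<omega> = z) * of_bool (\<omega> t = k) \<partial>Q))"
        by (simp add: int)
    qed
    then show ?thesis
      by (subst (asm) sum.swap) (simp add: h_def sum_distrib_left)
  qed
  have k: "(\<alpha> k - 1) * g z \<le> (sum \<alpha> UNIV - 1) * h z" "(sum \<alpha> UNIV - 1) * h z \<le> \<alpha> k * g z" for z
    unfolding g_def h_def by (rule kalikow)+
  show "(\<alpha> k - 1) * G \<le> (sum \<alpha> UNIV - 1) * Gk" "(sum \<alpha> UNIV - 1) * Gk \<le> \<alpha> k * G"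
    unfolding G Gk sum_distrib_left
    using mult_left_mono[OF k(1) c] mult_left_mono[OF k(2) c]
    by (auto intro!: sum_mono simp: ac_simps)
qed

end

section \<open>Events and finite words\<close>

context polya_walk
begin

abbreviation cyl :: "'k list \<Rightarrow> (nat \<Rightarrow> 'k) set" where
  "cyl w \<equiv> {\<omega>. pre (length w) \<omega> = w}"

lemma sets_pre [measurable]: "{\<omega>. P (pre t \<omega>)} \<in> sets Q"
  using measurable_sets[OF measurable_pre_fun[of P t], of "{True}"]
  by (simp add: sets_Q vimage_def space_PiM)

lemma sets_shift: "A \<in> sets Q \<Longrightarrow> {\<omega>. shift n \<omega> \<in> A} \<in> sets Q"
  using measurable_sets[OF measurable_shift[of n], of A]
  by (simp add: sets_Q vimage_def space_PiM)

lemma prob_pre: "prob {\<omega>. P (pre t \<omega>)} = (\<Sum>w | length w = t \<and> P w. wt w)"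
proof -
  have "prob {\<omega>. P (pre t \<omega>)} = (\<integral>\<omega>. of_bool (P (pre t \<omega>)) \<partial>Q)"
  proof -
    have "(\<lambda>\<omega>. of_bool (P (pre t \<omega>)) :: real) = indicator {\<omega>. P (pre t \<omega>)}"
      by (auto simp: indicator_def)
    then show ?thesis
      by simp
  qed
  also have "\<dots> = (\<Sum>w | length w = t. of_bool (P w) * wt w)"
    by (rule integral_pre)
  also have "\<dots> = (\<Sum>w | length w = t \<and> P w. wt w)"
    by (rule sum.mono_neutral_cong_right) auto
  finally show ?thesis .
qed

text \<open>Two cylinders are nested or disjoint, so together with the empty set they form a
  generator stable under intersection.\<close>

lemma measure_eqI_cyl:
  assumes fin: "finite_measure M" and sets: "sets M = sets path_space" "sets N = sets path_space"
    and eq: "\<And>w. emeasure M (cyl w) = emeasure N (cyl w)"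
  shows "M = N"
proof -
  interpret M: finite_measure M
    by fact
  let ?E = "insert {} (range (\<lambda>w. cyl w))"
  have gen: "sets path_space = sigma_sets UNIV ?E"
  proof
    show "sigma_sets UNIV ?E \<subseteq> sets path_space"
      using sets.sigma_sets_subset[of ?E path_space] sets_pre unfolding sets_Q
      by (force simp: space_PiM)
    have "{X. \<forall>i\<le>n. X i = p i} \<in> range cyl" for n and p :: "nat \<Rightarrow> 'k"
      by (rule image_eqI[of _ _ "pre (Suc n) p"]) (auto simp: pre_eq_iff less_Suc_eq_le)
    then show "sets path_space \<subseteq> sigma_sets UNIV ?E"
      unfolding sets_path_space_eq_cylinders by (intro sigma_sets_mono') auto
  qed
  show ?thesis
  proof (rule measure_eqI_generator_eq[where E = ?E and \<Omega> = UNIV and A = "\<lambda>_. cyl []"])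
    show "Int_stable ?E"
    proof (rule Int_stableI)
      have le: "cyl v \<inter> cyl w \<in> ?E" if "length v \<le> length w" for v w
      proof (cases "take (length v) w = v")
        case True
        then have "cyl w \<subseteq> cyl v"
          using take_pre[OF that] by (metis (mono_tags, lifting) Collect_mono)
        then have "cyl v \<inter> cyl w = cyl w"
          by (rule inf_absorb2)
        then show ?thesis
          by simp
      next
        case False
        have "take (length v) w = v" if "\<omega> \<in> cyl v \<inter> cyl w" for \<omega>
          using that take_pre[OF \<open>length v \<le> length w\<close>, of \<omega>]
          by (metis (mono_tags, lifting) IntE mem_Collect_eq)
        then have "cyl v \<inter> cyl w = {}"
          using False by blast
        then show ?thesis
          by (simp only: insertI1)
      qed
      have *: "cyl v \<inter> cyl w \<in> ?E" for v w
        using le[of v w] le[of w v] Int_commute[of "cyl v" "cyl w"]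
        by (cases "length v \<le> length w") simp_all
      show "A \<inter> B \<in> ?E" if "A \<in> ?E" "B \<in> ?E" for A B
      proof (cases "A = {} \<or> B = {}")
        case False
        then have "A \<in> range cyl" "B \<in> range cyl"
          using that by blast+
        then obtain v w where "A = cyl v" "B = cyl w"
          by (elim rangeE)
        then show ?thesis
          by (simp only: *)
      qed auto
    qed
    show "emeasure M X = emeasure N X" if "X \<in> ?E" for X
      using that eq by (elim insertE imageE) (simp_all only: emeasure_empty)
    show "sets M = sigma_sets UNIV ?E" "sets N = sigma_sets UNIV ?E"
      unfolding gen[symmetric] sets by simp_all
  qed (auto simp: M.emeasure_finite intro!: image_eqI[of _ _ "[]"])
qed

text \<open>The events that can be approximated by conditions on a finite prefix contain the
  cylinders and are closed under complements and countable unions.\<close>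

lemma approx_pre:
  assumes "B \<in> sets Q" "0 < \<epsilon>"
  shows "\<exists>t P. prob ({\<omega>. P (pre t \<omega>)} - B \<union> (B - {\<omega>. P (pre t \<omega>)})) < \<epsilon>"
proof -
  have "B \<in> sigma_sets UNIV (insert {} {{X. \<forall>i\<le>n. X i = p i} |n p. True})"
    using assms(1) by (simp add: sets_Q sets_path_space_eq_cylinders)
  then show ?thesis
    using assms(2)
  proof (induction arbitrary: \<epsilon>)
    case (Basic B)
    then consider "B = {}" | n p where "B = {X. \<forall>i\<le>n. X i = p i}"
      by auto
    then have "\<exists>t P. {\<omega>. P (pre t \<omega>)} = B"
    proof cases
      case 1
      then show ?thesis
        by auto
    next
      case (2 n p)
      then have "{\<omega>. pre (Suc n) \<omega> = pre (Suc n) p} = B"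
        by (auto simp: pre_eq_iff less_Suc_eq_le)
      then show ?thesis
        by (intro exI[of _ "Suc n"] exI[of _ "\<lambda>w. w = pre (Suc n) p"])
    qed
    then obtain t P where "{\<omega>. P (pre t \<omega>)} = B"
      by blast
    then show ?case
      using Basic by (intro exI[of _ t] exI[of _ P]) simp
  next
    case Empty
    then show ?case
      by (intro exI[of _ 0] exI[of _ "\<lambda>_. False"]) simp
  next
    case (Compl B)
    then obtain t P where P: "prob ({\<omega>. P (pre t \<omega>)} - B \<union> (B - {\<omega>. P (pre t \<omega>)})) < \<epsilon>"
      by blast
    moreover have "{\<omega>. \<not> P (pre t \<omega>)} - (UNIV - B) \<union> ((UNIV - B) - {\<omega>. \<not> P (pre t \<omega>)}) =
        {\<omega>. P (pre t \<omega>)} - B \<union> (B - {\<omega>. P (pre t \<omega>)})"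
      by auto
    ultimately show ?case
      by (intro exI[of _ t] exI[of _ "\<lambda>w. \<not> P w"]) simp
  next
    case (Union A)
    have A: "A i \<in> sets Q" for i
      using Union(1)[of i] by (simp add: sets_Q sets_path_space_eq_cylinders)
    define B where "B n = (\<Union>i<n. A i)" for n
    have B: "B n \<in> sets Q" for n
      unfolding B_def using A by blast
    have UN: "(\<Union>n. B n) = (\<Union>i. A i)"
      by (auto simp: B_def)
    have "(\<lambda>n. prob (B n)) \<longlonglongrightarrow> prob (\<Union>n. B n)"
    proof (rule finite_Lim_measure_incseq)
      show "incseq B"
        unfolding B_def incseq_def by (intro allI impI UN_mono) auto
    qed (use B in auto)
    then have "\<forall>\<^sub>F n in sequentially. dist (prob (B n)) (prob (\<Union>i. A i)) < \<epsilon> / 2"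
      using Union(3) unfolding UN by (intro tendstoD) auto
    then obtain n where n: "dist (prob (B n)) (prob (\<Union>i. A i)) < \<epsilon> / 2"
      by (auto simp: eventually_sequentially)
    \<comment> \<open>The \<open>n\<close> approximations together may use half of
      \<open>\<epsilon>\<close>; the added 1 covers the case \<open>n = 0\<close>.\<close>
    define \<epsilon>' where "\<epsilon>' = \<epsilon> / (2 * (n + 1))"
    have \<epsilon>': "0 < \<epsilon>'"
      using Union(3) by (simp add: \<epsilon>'_def)
    obtain t P where P: "prob ({\<omega>. P i (pre (t i) \<omega>)} - A i \<union> (A i - {\<omega>. P i (pre (t i) \<omega>)})) < \<epsilon>'" for i
      using Union(2)[OF \<epsilon>'] by metis
    define \<Delta> where "\<Delta> i = {\<omega>. P i (pre (t i) \<omega>)} - A i \<union> (A i - {\<omega>. P i (pre (t i) \<omega>)})" for i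
    have \<Delta> [measurable]: "\<Delta> i \<in> sets Q" for i
      unfolding \<Delta>_def using A sets_pre by (intro sets.Un sets.Diff) auto
    \<comment> \<open>A common prefix length that decides all \<open>n\<close> conditions at
      once.\<close>
    define s where "s = (\<Sum>i<n. t i)"
    have s: "t i \<le> s" if "i < n" for i
      unfolding s_def using that by (intro member_le_sum) auto
    define R where "R w = (\<exists>i<n. P i (take (t i) w))" for w
    have R: "R (pre s \<omega>) \<longleftrightarrow> (\<exists>i<n. P i (pre (t i) \<omega>))" for \<omega>
      using s by (auto simp: R_def take_pre)
    have "prob ({\<omega>. R (pre s \<omega>)} - (\<Union>i. A i) \<union> ((\<Union>i. A i) - {\<omega>. R (pre s \<omega>)})) \<le>
        prob (((\<Union>i. A i) - B n) \<union> (\<Union>i<n. \<Delta> i))"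
      by (rule finite_measure_mono) (use A B \<Delta> R in \<open>auto simp: \<Delta>_def B_def\<close>)
    also have "\<dots> \<le> prob ((\<Union>i. A i) - B n) + prob (\<Union>i<n. \<Delta> i)"
      by (rule measure_Un_le) (use A B \<Delta> in auto)
    also have "prob ((\<Union>i. A i) - B n) = prob (\<Union>i. A i) - prob (B n)"
      by (rule finite_measure_Diff) (use A B in \<open>auto simp: B_def\<close>)
    also have "\<dots> < \<epsilon> / 2"
      using n unfolding dist_real_def abs_diff_less_iff by linarith
    also have "prob (\<Union>i<n. \<Delta> i) \<le> (\<Sum>i<n. prob (\<Delta> i))"
      by (rule finite_measure_subadditive_finite) (use \<Delta> in auto)
    also have "\<dots> \<le> (\<Sum>i<n. \<epsilon>')"
      using P by (intro sum_mono) (auto simp: \<Delta>_def less_imp_le)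
    also have "\<dots> \<le> \<epsilon> / 2"
      using Union(3) by (simp add: \<epsilon>'_def field_simps)
    finally show ?case
      by (intro exI[of _ s] exI[of _ R]) simp
  qed
qed

text \<open>A zero-one law. Approximate the complement of \<open>B\<close> by a prefix event:
  \<open>B\<close> fills at least the proportion \<open>c\<close> of it, but this part lies in the
  error of the approximation, so the prefix event, and with it the complement, has arbitrarily small
  probability.\<close>

lemma prob_eq_1_by_cyl:
  assumes B: "B \<in> sets Q" and c: "0 < c" "\<And>w. c * wt w \<le> prob (cyl w \<inter> B)"
  shows "prob B = 1"
proof -
  have *: "prob (UNIV - B) \<le> \<epsilon> / c + \<epsilon>" if "0 < \<epsilon>" for \<epsilon>
  proof -
    obtain t P where P: "prob ({\<omega>. P (pre t \<omega>)} - (UNIV - B) \<union> ((UNIV - B) - {\<omega>. P (pre t \<omega>)})) < \<epsilon>"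
      using approx_pre[of "UNIV - B" \<epsilon>] \<open>0 < \<epsilon>\<close> sets.compl_sets[OF B] unfolding space_Q by blast
    let ?D = "{\<omega>. P (pre t \<omega>)} - (UNIV - B) \<union> ((UNIV - B) - {\<omega>. P (pre t \<omega>)})"
    have C: "UNIV - B \<in> sets Q"
      using sets.compl_sets[OF B] by simp
    have D: "?D \<in> sets Q"
      by (intro sets.Un sets.Diff[OF sets_pre C] sets.Diff[OF C sets_pre])
    have "c * prob {\<omega>. P (pre t \<omega>)} = (\<Sum>w | length w = t \<and> P w. c * wt w)"
      by (simp add: prob_pre sum_distrib_left)
    also have "\<dots> \<le> (\<Sum>w | length w = t \<and> P w. prob (cyl w \<inter> B))"
      by (intro sum_mono c)
    also have "\<dots> = prob (\<Union>w\<in>{w. length w = t \<and> P w}. cyl w \<inter> B)"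
      using B sets_pre by (intro finite_measure_finite_Union[symmetric]) (auto simp: disjoint_family_on_def)
    also have "\<dots> \<le> prob ?D"
      by (rule finite_measure_mono[OF _ D]) auto
    finally have "prob {\<omega>. P (pre t \<omega>)} \<le> \<epsilon> / c"
      using P c by (simp add: field_simps)
    moreover have "prob (UNIV - B) \<le> prob ({\<omega>. P (pre t \<omega>)} \<union> ?D)"
      by (rule finite_measure_mono) (use D sets_pre in auto)
    moreover have "prob ({\<omega>. P (pre t \<omega>)} \<union> ?D) \<le> prob {\<omega>. P (pre t \<omega>)} + prob ?D"
      by (rule measure_Un_le) (use D sets_pre in auto)
    ultimately show ?thesis
      using P by linarith
  qed
  then have "prob (UNIV - B) \<le> 0 + \<epsilon>" if "0 < \<epsilon>" for \<epsilon>
  proof -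
    \<comment> \<open>The scaling is chosen so that the two error terms add up to the prescribed
      bound.\<close>
    have "prob (UNIV - B) \<le> \<epsilon> * c / (1 + c) / c + \<epsilon> * c / (1 + c)"
      using that c(1) by (intro *) simp
    also have "\<dots> = \<epsilon>"
      using c(1) by (simp add: divide_simps) (simp add: algebra_simps)
    finally show ?thesis
      by simp
  qed
  then have "prob (UNIV - B) \<le> 0"
    by (rule field_le_epsilon)
  then show ?thesis
    using prob_compl[OF B] measure_nonneg[of Q "UNIV - B"] by simp
qed

end

section \<open>Directional transience\<close>

lemma fst_edges_cases:
  assumes "y \<in> fst ` set_mset (edges e x w)"
  obtains i where "i < length w" "y = endpoint e x (take i w)"
proof -
  have "\<exists>i<length w. y = endpoint e x (take i w)"
    using assms
  proof (induction w arbitrary: x)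
    case (Cons k w)
    show ?case
    proof (cases "y = x")
      case False
      then have "y \<in> fst ` set_mset (edges e (x + e k) w)"
        using Cons.prems by auto
      from Cons.IH[OF this] obtain i where "i < length w" "y = endpoint e (x + e k) (take i w)"
        by blast
      then show ?thesis
        by (intro exI[of _ "Suc i"]) simp
    qed (auto intro!: exI[of _ 0])
  qed simp
  then show ?thesis
    using that by blast
qed

context polya_walk
begin

lemma pos_add: "pos (n + t) \<omega> = pos n \<omega> + pos t (shift n \<omega>)"
  by (simp add: pos_def pre_add endpoint_def)

lemma alive_iff: "alive U (pre t \<omega>) \<longleftrightarrow> (\<forall>i\<le>t. pos i \<omega> \<in> U)"
proof (induction t)
  case (Suc t)
  have "alive U (pre (Suc t) \<omega>) \<longleftrightarrow> alive U (pre t \<omega>) \<and> pos (Suc t) \<omega> \<in> U"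
    by (auto simp: alive_def pre_Suc pos_def)
  then show ?case
    unfolding Suc by (auto simp del: pos_simps simp: le_Suc_eq)
qed (simp add: alive_def)

text \<open>Optional stopping, path by path: \<open>m\<close> is the first exit time from
  \<open>U\<close>, capped at \<open>N\<close>, and the increments collected while alive telescope
  up to it.\<close>

lemma stopped_sum:
  fixes f :: "'a \<Rightarrow> real"
  shows "\<exists>m\<le>N. (\<forall>i<m. pos i \<omega> \<in> U) \<and> (m = N \<or> pos m \<omega> \<notin> U) \<and>
    (\<Sum>t<N. of_bool (alive U (pre t \<omega>)) * (f (pos (Suc t) \<omega>) - f (pos t \<omega>))) = f (pos m \<omega>) - f 0"
    (is "\<exists>m\<le>N. ?P m N")
  proof (induction N)
    case (Suc N)
    then obtain m where m: "m \<le> N" "?P m N"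
      by blast
    show ?case
    proof (cases "alive U (pre N \<omega>)")
      case True
      then have "m = N"
        using m by (auto simp: alive_iff)
      then have "?P (Suc N) (Suc N)"
        using m(2) True \<open>m = N\<close>
        by (auto simp: alive_iff less_Suc_eq simp del: pos_simps sum_of_bool_mult_eq)
      then show ?thesis
        by blast
    next
      case False
      then have "pos m \<omega> \<notin> U"
        using m by (auto simp: alive_iff le_less)
      then show ?thesis
        using m False by (intro exI[of _ m]) auto
    qed
qed simp

end

text \<open>\<open>\<eta>\<close> is the height in the direction of the drift. Only the steps
  \<open>kp\<close> and \<open>km\<close> change it, by one unit, so no level can be jumped
  over.\<close>

locale drifted_walk = polya_walk Q e \<alpha>
  for Q :: "(nat \<Rightarrow> 'k::finite) measure" and e :: "'k \<Rightarrow> 'a::ab_group_add" and \<alpha> +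
  fixes \<eta> :: "'a \<Rightarrow> int" and kp km :: 'k
  assumes \<eta>_add: "\<eta> (x + y) = \<eta> x + \<eta> y"
    and \<eta>_e: "\<eta> (e k) = of_bool (k = kp) - of_bool (k = km)"
    and kp_km: "kp \<noteq> km"
    and drift: "\<alpha> km + 1 < \<alpha> kp"
begin

definition ht :: "nat \<Rightarrow> (nat \<Rightarrow> 'k) \<Rightarrow> int" where
  "ht t \<omega> = \<eta> (pos t \<omega>)"

lemma \<eta>_0 [simp]: "\<eta> 0 = 0"
  using \<eta>_add[of 0 0] by simp

lemma ht_0 [simp]: "ht 0 \<omega> = 0"
  by (simp add: ht_def)

lemma ht_add: "ht (n + t) \<omega> = ht n \<omega> + ht t (shift n \<omega>)"
  by (simp add: ht_def pos_add \<eta>_add)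

lemma ht_Suc: "ht (Suc t) \<omega> = ht t \<omega> + (of_bool (\<omega> t = kp) - of_bool (\<omega> t = km))"
  by (simp add: ht_def \<eta>_add \<eta>_e)

lemma ht_Suc_le: "ht (Suc t) \<omega> \<le> ht t \<omega> + 1" "ht t \<omega> - 1 \<le> ht (Suc t) \<omega>"
  by (auto simp: ht_Suc of_bool_def)

lemma ht_diff_le: "ht (n + t) \<omega> \<le> ht n \<omega> + int t"
  by (induction t) (auto intro: order_trans[OF ht_Suc_le(1)])

lemma sum_\<alpha>_gt_1: "1 < sum \<alpha> UNIV"
proof -
  have "\<alpha> kp \<le> sum \<alpha> UNIV"
    using \<alpha>_pos by (intro member_le_sum) (auto intro: less_imp_le)
  then show ?thesis
    using drift \<alpha>_pos[of km] by linarith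
qed

text \<open>The mean gain of height per step that the Kalikow estimates guarantee before leaving any
  set.\<close>

definition \<delta> :: real where
  "\<delta> = (\<alpha> kp - 1 - \<alpha> km) / (sum \<alpha> UNIV - 1)"

lemma \<delta>_pos: "0 < \<delta>"
  using drift sum_\<alpha>_gt_1 by (simp add: \<delta>_def)

lemma measurable_ht [measurable]: "ht t \<in> measurable Q (count_space UNIV)"
  unfolding ht_def[abs_def] pos_def measurable_cong_sets[OF sets_Q refl] by (rule measurable_pre_fun)

lemma pred_ht [measurable]: "Measurable.pred Q (\<lambda>\<omega>. P (ht t \<omega>))"
  by (rule measurable_compose[OF measurable_ht]) simp

lemma pred_ht2 [measurable]: "Measurable.pred Q (\<lambda>\<omega>. R (ht s \<omega>) (ht t \<omega>))"
proof -
  define F where "F w = R (\<eta> (endpoint e 0 (take s w))) (\<eta> (endpoint e 0 (take t w)))" for w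
  have "(\<lambda>\<omega>. R (ht s \<omega>) (ht t \<omega>)) = (\<lambda>\<omega>. F (pre (s + t) \<omega>))"
    by (simp add: F_def fun_eq_iff ht_def pos_def take_pre)
  then show ?thesis
    unfolding measurable_cong_sets[OF sets_Q refl] by (simp only: measurable_pre_fun)
qed

lemma sets_CollectI: "Measurable.pred Q P \<Longrightarrow> {\<omega>. P \<omega>} \<in> sets Q"
  by (simp add: pred_def)

lemma integrable_alive:
  fixes c :: "'a \<Rightarrow> real"
  shows "integrable Q (\<lambda>\<omega>. of_bool (alive U (pre t \<omega>)) * c (pos t \<omega>))"
    and "integrable Q (\<lambda>\<omega>. of_bool (alive U (pre t \<omega>)) * c (pos t \<omega>) * of_bool (\<omega> t = k))"
  using integral_pre(1)[of "\<lambda>w. of_bool (alive U w) * c (endpoint e 0 w)" t]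
    integral_pre_step(1)[of "\<lambda>w. of_bool (alive U w) * c (endpoint e 0 w)" t k]
  by (simp_all add: pos_def)

lemma prob_alive: "(\<integral>\<omega>. of_bool (alive U (pre t \<omega>)) \<partial>Q) = prob {\<omega>. \<forall>i\<le>t. pos i \<omega> \<in> U}"
proof -
  have "(\<lambda>\<omega>. of_bool (alive U (pre t \<omega>)) :: real) = indicator {\<omega>. \<forall>i\<le>t. pos i \<omega> \<in> U}"
    by (auto simp: alive_iff indicator_def)
  then show ?thesis
    by simp
qed

text \<open>The expected height gained below the level is at least \<open>\<delta>\<close> times the
  expected number of steps spent there, while the height at the exit is at most \<open>L\<close>
  because upward steps have size one.\<close>

lemma exit_time_bound:
  assumes "1 \<le> L"
  shows "\<delta> * (\<Sum>t<N. prob {\<omega>. \<forall>i\<le>t. ht i \<omega> < int L}) \<le> L"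
proof -
  define U where "U = {x. \<eta> x < int L}"
  define G :: real where "G = (\<Sum>t<N. \<integral>\<omega>. of_bool (alive U (pre t \<omega>)) * 1 \<partial>Q)"
  define Gk :: "'k \<Rightarrow> real" where "Gk k = (\<Sum>t<N. \<integral>\<omega>. of_bool (alive U (pre t \<omega>)) * 1 * of_bool (\<omega> t = k) \<partial>Q)" for k
  have "(\<alpha> kp - 1) * G \<le> (sum \<alpha> UNIV - 1) * Gk kp" "(sum \<alpha> UNIV - 1) * Gk km \<le> \<alpha> km * G"
    unfolding G_def Gk_def
    using kalikow_weighted(1)[where c = "\<lambda>_. 1" and k = kp and N = N and U = U] kalikow_weighted(2)[where c = "\<lambda>_. 1" and k = km and N = N and U = U] by simp_all
  then have "(\<alpha> kp - 1 - \<alpha> km) * G \<le> (sum \<alpha> UNIV - 1) * (Gk kp - Gk km)"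
    by (simp add: algebra_simps)
  then have "\<delta> * G \<le> Gk kp - Gk km"
    using sum_\<alpha>_gt_1 by (simp add: \<delta>_def field_simps)
  also have "Gk kp - Gk km = (\<Sum>t<N. \<integral>\<omega>. of_bool (alive U (pre t \<omega>)) *
      (real_of_int (\<eta> (pos (Suc t) \<omega>)) - \<eta> (pos t \<omega>)) \<partial>Q)"
  proof -
    have eq: "of_bool (alive U (pre t \<omega>)) * (real_of_int (\<eta> (pos (Suc t) \<omega>)) - \<eta> (pos t \<omega>)) =
        of_bool (alive U (pre t \<omega>)) * 1 * of_bool (\<omega> t = kp) - of_bool (alive U (pre t \<omega>)) * 1 * of_bool (\<omega> t = km)" for t \<omega>
      by (simp add: \<eta>_add \<eta>_e algebra_simps)
    show ?thesis
      unfolding eq Gk_def sum_subtractf[symmetric]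
      by (intro sum.cong refl Bochner_Integration.integral_diff[symmetric] integrable_alive)
  qed
  also have "\<dots> = (\<integral>\<omega>. (\<Sum>t<N. of_bool (alive U (pre t \<omega>)) *
      (real_of_int (\<eta> (pos (Suc t) \<omega>)) - \<eta> (pos t \<omega>))) \<partial>Q)"
  proof (rule Bochner_Integration.integral_sum[symmetric])
    show "integrable Q (\<lambda>\<omega>. of_bool (alive U (pre t \<omega>)) * (real_of_int (\<eta> (pos (Suc t) \<omega>)) - \<eta> (pos t \<omega>)))" for t
      using integrable_alive(2)[of U t "\<lambda>_. 1" kp] integrable_alive(2)[of U t "\<lambda>_. 1" km]
      by (simp add: \<eta>_add \<eta>_e algebra_simps)
  qed
  also have "\<dots> \<le> L"
  proof (rule integral_le_const)
    show "AE \<omega> in Q. (\<Sum>t<N. of_bool (alive U (pre t \<omega>)) * (real_of_int (\<eta> (pos (Suc t) \<omega>)) - \<eta> (pos t \<omega>))) \<le> L"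
    proof (rule AE_I2)
      fix \<omega>
      obtain m where m: "\<And>i. i < m \<Longrightarrow> pos i \<omega> \<in> U"
        "(\<Sum>t<N. of_bool (alive U (pre t \<omega>)) * (real_of_int (\<eta> (pos (Suc t) \<omega>)) - \<eta> (pos t \<omega>))) =
          real_of_int (\<eta> (pos m \<omega>)) - \<eta> 0"
        using stopped_sum[of N \<omega> U "\<lambda>x. real_of_int (\<eta> x)"] by blast
      have "ht m \<omega> \<le> int L"
      proof (cases m)
        case (Suc n)
        then show ?thesis
          using m(1)[of n] ht_Suc_le(1)[of n \<omega>] by (simp add: U_def ht_def)
      qed (use assms in simp)
      then show "(\<Sum>t<N. of_bool (alive U (pre t \<omega>)) * (real_of_int (\<eta> (pos (Suc t) \<omega>)) - \<eta> (pos t \<omega>))) \<le> L"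
        unfolding m(2) by (simp add: ht_def)
    qed
    show "integrable Q (\<lambda>\<omega>. \<Sum>t<N. of_bool (alive U (pre t \<omega>)) * (real_of_int (\<eta> (pos (Suc t) \<omega>)) - \<eta> (pos t \<omega>)))"
      using integrable_alive(2)[of U _ "\<lambda>_. 1" kp] integrable_alive(2)[of U _ "\<lambda>_. 1" km]
      by (intro Bochner_Integration.integrable_sum) (simp add: \<eta>_add \<eta>_e algebra_simps)
  qed
  finally show ?thesis
    by (simp add: G_def prob_alive U_def ht_def)
qed

text \<open>Never reaching the level contributes to every summand in \<open>exit_time_bound\<close>,
  which must stay bounded as \<open>N\<close> grows.\<close>

lemma prob_hit_level: "prob {\<omega>. \<exists>t. int L \<le> ht t \<omega>} = 1"
proof -
  define L' where "L' = max 1 L"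
  define B where "B = {\<omega>. \<forall>t. ht t \<omega> < int L'}"
  have [measurable]: "B \<in> sets Q"
    unfolding B_def by (rule sets_CollectI) measurable
  have "real N * (\<delta> * prob B) \<le> L'" for N
  proof -
    have "real N * prob B \<le> (\<Sum>t<N. prob {\<omega>. \<forall>i\<le>t. ht i \<omega> < int L'})"
      by (rule order_trans[OF _ sum_bounded_below[of "{..<N}" "prob B"]])
        (auto intro!: finite_measure_mono sets_CollectI simp: B_def)
    then have "\<delta> * (real N * prob B) \<le> \<delta> * (\<Sum>t<N. prob {\<omega>. \<forall>i\<le>t. ht i \<omega> < int L'})"
      using \<delta>_pos by (intro mult_left_mono) auto
    also have "\<dots> \<le> L'"
      by (rule exit_time_bound) (simp add: L'_def)
    finally show ?thesis
      by (simp add: ac_simps)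
  qed
  then have "\<delta> * prob B \<le> 0"
    using reals_Archimedean3[of "\<delta> * prob B"] by (meson not_le)
  then have "prob B = 0"
    using \<delta>_pos measure_nonneg[of Q B] by (simp add: mult_le_0_iff)
  then have "prob (UNIV - B) = 1"
    using prob_compl[of B] by simp
  moreover have "UNIV - B \<subseteq> {\<omega>. \<exists>t. int L \<le> ht t \<omega>}"
  proof
    fix \<omega> assume "\<omega> \<in> UNIV - B"
    then obtain t where "int L' \<le> ht t \<omega>"
      by (auto simp: B_def not_less)
    moreover have "int L \<le> int L'"
      by (simp add: L'_def)
    ultimately show "\<omega> \<in> {\<omega>. \<exists>t. int L \<le> ht t \<omega>}"
      using order_trans by blast
  qed
  moreover have "{\<omega>. \<exists>t. int L \<le> ht t \<omega>} \<in> sets Q"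
    by (rule sets_CollectI) measurable
  ultimately have "1 \<le> prob {\<omega>. \<exists>t. int L \<le> ht t \<omega>}"
    using finite_measure_mono[of "UNIV - B" "{\<omega>. \<exists>t. int L \<le> ht t \<omega>}"] by simp
  then show ?thesis
    using prob_le_1 by (rule antisym[rotated])
qed

section \<open>Never going below the starting level\<close>

definition D :: "(nat \<Rightarrow> 'k) set" where
  "D = {\<omega>. \<forall>t. 0 \<le> ht t \<omega>}"

lemma sets_D [measurable]: "D \<in> sets Q"
  unfolding D_def by (rule sets_CollectI) measurable

text \<open>A gambler's ruin estimate: the exponential function \<open>\<rho> powi \<eta> x\<close>,
  stopped when the height becomes negative, has expectation at most its initial value 1. Since it
  equals \<open>1 / \<rho>\<close> at the exit, the exit has probability at most
  \<open>\<rho>\<close>.\<close>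

lemma prob_D_pos: "0 < prob D"
proof -
  \<comment> \<open>The ratio of the Kalikow bounds for steps down and steps up; the drift condition
    makes it smaller than 1.\<close>
  define \<rho> where "\<rho> = \<alpha> km / (\<alpha> kp - 1)"
  have \<rho>: "0 < \<rho>" "\<rho> < 1"
    using drift \<alpha>_pos[of km] by (auto simp: \<rho>_def)
  define U where "U = {x. 0 \<le> \<eta> x}"
  define f where "f x = \<rho> powi \<eta> x" for x
  have f: "0 < f x" for x
    using \<rho> by (simp add: f_def)
  have f_add: "f (x + e k) - f x = f x * ((\<rho> - 1) * of_bool (k = kp) + (1 / \<rho> - 1) * of_bool (k = km))" for x k
  proof -
    have "f (x + e k) = f x * \<rho> powi (of_bool (k = kp) - of_bool (k = km))"
      using \<rho> by (simp add: f_def \<eta>_add \<eta>_e power_int_add)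
    then show ?thesis
      using \<rho> kp_km by (auto simp: power_int_minus field_simps)
  qed
  have sets_E [simp]: "{\<omega>. \<exists>i\<le>N. ht i \<omega> < 0} \<in> sets Q" for N
    by (rule sets_CollectI) measurable
  have bound: "prob {\<omega>. \<exists>i\<le>N. ht i \<omega> < 0} \<le> \<rho>" for N
  proof -
    define G :: real where "G = (\<Sum>t<N. \<integral>\<omega>. of_bool (alive U (pre t \<omega>)) * f (pos t \<omega>) \<partial>Q)"
    define Gk :: "'k \<Rightarrow> real" where "Gk k = (\<Sum>t<N. \<integral>\<omega>. of_bool (alive U (pre t \<omega>)) * f (pos t \<omega>) * of_bool (\<omega> t = k) \<partial>Q)" for k
    define S where "S \<omega> = (\<Sum>t<N. of_bool (alive U (pre t \<omega>)) * (f (pos (Suc t) \<omega>) - f (pos t \<omega>)))" for \<omega>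
    have S_eq: "S \<omega> = (\<Sum>t<N. (\<rho> - 1) * (of_bool (alive U (pre t \<omega>)) * f (pos t \<omega>) * of_bool (\<omega> t = kp)) +
        (1 / \<rho> - 1) * (of_bool (alive U (pre t \<omega>)) * f (pos t \<omega>) * of_bool (\<omega> t = km)))" for \<omega>
      unfolding S_def pos_simps f_add by (intro sum.cong refl) (simp only: algebra_simps)
    have int_S: "integrable Q S"
      unfolding S_eq[abs_def]
      by (intro Bochner_Integration.integrable_sum Bochner_Integration.integrable_add integrable_mult_right integrable_alive)
    have int_ind: "integrable Q (indicator {\<omega>. \<exists>i\<le>N. ht i \<omega> < 0} :: _ \<Rightarrow> real)"
      by (rule integrable_real_indicator[OF sets_E]) (simp add: less_top[symmetric])
    then have int_E: "integrable Q (\<lambda>\<omega>. indicator {\<omega>. \<exists>i\<le>N. ht i \<omega> < 0} \<omega> / \<rho> - 1)"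
      by (intro Bochner_Integration.integrable_diff integrable_divide_zero integrable_const)
    have "(\<alpha> kp - 1) * G \<le> (sum \<alpha> UNIV - 1) * Gk kp" "(sum \<alpha> UNIV - 1) * Gk km \<le> \<alpha> km * G"
      unfolding G_def Gk_def
      using kalikow_weighted(1)[where c = f and k = kp and N = N and U = U] kalikow_weighted(2)[where c = f and k = km and N = N and U = U] f by (simp_all add: less_imp_le)
    then have "G \<le> (sum \<alpha> UNIV - 1) * Gk kp / (\<alpha> kp - 1)" "(sum \<alpha> UNIV - 1) * Gk km \<le> \<alpha> km * G"
      using drift \<alpha>_pos[of km] by (simp_all add: pos_le_divide_eq mult.commute)
    then have "(sum \<alpha> UNIV - 1) * Gk km \<le> \<alpha> km * ((sum \<alpha> UNIV - 1) * Gk kp / (\<alpha> kp - 1))"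
      using \<alpha>_pos[of km] by (meson mult_left_mono less_imp_le order_trans)
    then have "(sum \<alpha> UNIV - 1) * Gk km \<le> (sum \<alpha> UNIV - 1) * (\<rho> * Gk kp)"
      by (simp add: \<rho>_def ac_simps)
    then have "Gk km \<le> \<rho> * Gk kp"
      using sum_\<alpha>_gt_1 by simp
    then have "(1 / \<rho> - 1) * Gk km \<le> (1 / \<rho> - 1) * (\<rho> * Gk kp)"
      using \<rho> by (intro mult_left_mono) (auto simp: field_simps)
    \<comment> \<open>The base \<open>\<rho>\<close> is chosen for the identity (1 / \<rho> - 1) *
      \<rho> = 1 - \<rho>: the gain from steps down is then at most the loss from steps up.\<close>
    then have le0: "(\<rho> - 1) * Gk kp + (1 / \<rho> - 1) * Gk km \<le> 0"
    proof -
      have "(1 / \<rho> - 1) * (\<rho> * Gk kp) = (1 - \<rho>) * Gk kp"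
        using \<rho> by (simp add: left_diff_distrib)
      moreover have "(\<rho> - 1) * Gk kp = - ((1 - \<rho>) * Gk kp)"
        by (simp add: algebra_simps)
      ultimately show ?thesis
        using \<open>(1 / \<rho> - 1) * Gk km \<le> _\<close> by linarith
    qed
    have "(\<integral>\<omega>. S \<omega> \<partial>Q) = (\<rho> - 1) * Gk kp + (1 / \<rho> - 1) * Gk km"
      unfolding S_eq Gk_def
      by (subst Bochner_Integration.integral_sum)
        (auto simp: integrable_alive sum.distrib sum_distrib_left simp del: sum_divide_distrib
          intro!: Bochner_Integration.integrable_add integrable_mult_right)
    then have "(\<integral>\<omega>. S \<omega> \<partial>Q) \<le> 0"
      using le0 by simp
    moreover have "(\<integral>\<omega>. (indicator {\<omega>. \<exists>i\<le>N. ht i \<omega> < 0} \<omega> / \<rho> - 1) \<partial>Q) \<le> (\<integral>\<omega>. S \<omega> \<partial>Q)"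
    proof (rule integral_mono[OF _ int_S])
      show "integrable Q (\<lambda>\<omega>. indicator {\<omega>. \<exists>i\<le>N. ht i \<omega> < 0} \<omega> / \<rho> - 1)"
        by (rule int_E)
      fix \<omega>
      obtain m where m: "m \<le> N" "\<And>i. i < m \<Longrightarrow> pos i \<omega> \<in> U" "m = N \<or> pos m \<omega> \<notin> U"
        "S \<omega> = f (pos m \<omega>) - f 0"
        using stopped_sum[of N \<omega> U f] unfolding S_def by blast
      have f0: "f 0 = 1"
        by (simp add: f_def)
      show "indicator {\<omega>. \<exists>i\<le>N. ht i \<omega> < 0} \<omega> / \<rho> - 1 \<le> S \<omega>"
      proof (cases "\<exists>i\<le>N. ht i \<omega> < 0")
        case True
        then have "pos m \<omega> \<notin> U"
          using m by (metis (no_types, lifting) U_def ht_def le_neq_implies_less linorder_not_less mem_Collect_eq)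
        then have "ht m \<omega> < 0"
          by (simp add: U_def ht_def)
        then obtain n where n: "m = Suc n"
          by (cases m) auto
        \<comment> \<open>The previous height is nonnegative and a step lowers it by at most
          one.\<close>
        have "ht m \<omega> = - 1"
          using m(2)[of n] ht_Suc_le(2)[of n \<omega>] \<open>ht m \<omega> < 0\<close> by (simp add: n U_def ht_def)
        then have "f (pos m \<omega>) = 1 / \<rho>"
          by (simp add: f_def ht_def[symmetric] power_int_minus field_simps)
        then show ?thesis
          using True by (simp add: m f0)
      next
        case False
        then show ?thesis
          using f[of "pos m \<omega>"] by (simp add: m(4) f0)
      qed
    qed
    moreover have "(\<integral>\<omega>. (indicator {\<omega>. \<exists>i\<le>N. ht i \<omega> < 0} \<omega> / \<rho> - 1) \<partial>Q) = prob {\<omega>. \<exists>i\<le>N. ht i \<omega> < 0} / \<rho> - 1"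
      using int_ind prob_space by simp
    ultimately have "prob {\<omega>. \<exists>i\<le>N. ht i \<omega> < 0} / \<rho> - 1 \<le> 0"
      by linarith
    then show ?thesis
      using \<rho> by (simp add: pos_divide_le_eq)
  qed
  define E where "E N = {\<omega>. \<exists>i\<le>N. ht i \<omega> < 0}" for N
  have "(\<lambda>N. prob (E N)) \<longlonglongrightarrow> prob (\<Union>N. E N)"
  proof (rule finite_Lim_measure_incseq)
    show "incseq E"
      unfolding incseq_def E_def by (intro allI impI Collect_mono) (meson le_trans)
    show "range E \<subseteq> sets Q"
      using sets_E by (auto simp: E_def)
  qed
  then have "prob (\<Union>N. E N) \<le> \<rho>"
    by (rule LIMSEQ_le_const2) (use bound in \<open>auto simp: E_def\<close>)
  also have "(\<Union>N. E N) = UNIV - D"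
    by (force simp: E_def D_def not_le[symmetric])
  finally show ?thesis
    using prob_compl[OF sets_D] \<rho> by simp
qed

end

section \<open>Independence at new maxima\<close>

lemma endpoint_shift: "endpoint e x w = x + endpoint e 0 w"
  by (simp add: endpoint_def)

context polya_walk
begin

lemma prob_append:
  "prob {\<omega>. pre (length w) \<omega> = w \<and> P (pre n (shift (length w) \<omega>))} =
    (\<Sum>v | length v = n \<and> P v. wt (w @ v))"
proof -
  have "{\<omega>. pre (length w) \<omega> = w \<and> P (pre n (shift (length w) \<omega>))} =
      {\<omega>. take (length w) (pre (length w + n) \<omega>) = w \<and> P (drop (length w) (pre (length w + n) \<omega>))}"
    by (simp add: pre_add)
  also have "prob \<dots> = (\<Sum>u | length u = length w + n \<and> take (length w) u = w \<and> P (drop (length w) u). wt u)"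
    by (rule prob_pre)
  also have "\<dots> = (\<Sum>v | length v = n \<and> P v. wt (w @ v))"
  proof -
    have "{u. length u = length w + n \<and> take (length w) u = w \<and> P (drop (length w) u)} =
        (@) w ` {v. length v = n \<and> P v}"
    proof (intro set_eqI iffI)
      fix u assume "u \<in> {u. length u = length w + n \<and> take (length w) u = w \<and> P (drop (length w) u)}"
      then show "u \<in> (@) w ` {v. length v = n \<and> P v}"
        using append_take_drop_id[of "length w" u] by (intro image_eqI[of _ _ "drop (length w) u"]) auto
    qed auto
    then show ?thesis
      by (simp add: sum.reindex inj_on_def del: edges_append)
  qed
  finally show ?thesis .
qed

end

context drifted_walk
begin

definition new_max :: "'k list \<Rightarrow> bool" where
  "new_max w \<longleftrightarrow> (\<forall>i<length w. \<eta> (endpoint e 0 (take i w)) < \<eta> (endpoint e 0 w))"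

lemma new_max_pre: "new_max (pre n \<omega>) \<longleftrightarrow> (\<forall>i<n. ht i \<omega> < ht n \<omega>)"
  by (auto simp: new_max_def ht_def pos_def take_pre)

text \<open>The two pieces visit disjoint sets of sites, so their urns are independent.\<close>

lemma wt_append:
  assumes "new_max w" and v: "\<And>i. i \<le> length v \<Longrightarrow> 0 \<le> \<eta> (endpoint e 0 (take i v))"
  shows "wt (w @ v) = wt w * wt v"
proof -
  have "y \<notin> fst ` set_mset (edges e (endpoint e 0 w) v)" if y: "y \<in> fst ` set_mset (edges e 0 w)" for y
  proof
    assume "y \<in> fst ` set_mset (edges e (endpoint e 0 w) v)"
    then obtain j where j: "j < length v" "y = endpoint e (endpoint e 0 w) (take j v)"
      by (rule fst_edges_cases)
    obtain i where i: "i < length w" "y = endpoint e 0 (take i w)"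
      by (rule fst_edges_cases[OF y])
    have "\<eta> y < \<eta> (endpoint e 0 w)"
      using assms(1) i by (simp add: new_max_def)
    moreover have "\<eta> y = \<eta> (endpoint e 0 w) + \<eta> (endpoint e 0 (take j v))"
      unfolding j(2) by (subst endpoint_shift) (rule \<eta>_add)
    ultimately show False
      using v[of j] j by simp
  qed
  then have "fst ` set_mset (edges e 0 w) \<inter> fst ` set_mset (edges e (endpoint e 0 w) v) = {}"
    by blast
  then show ?thesis
    by (simp only: edges_append edge_weight_add_disjoint edge_weight_edges_translate[of _ _ "endpoint e 0 w"])
qed

text \<open>\<open>D\<close> involves the whole future, so it is approached from above by events
  \<open>E n\<close> that look at finitely many steps, for which \<open>wt_append\<close> applies to
  each word.\<close>

lemma regeneration_cyl:
  assumes w: "new_max w"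
  shows "prob {\<omega>. pre (length w) \<omega> = w \<and> shift (length w) \<omega> \<in> cyl v \<inter> D} = wt w * prob (cyl v \<inter> D)"
proof -
  define s where "s = length w"
  define P where "P n u \<longleftrightarrow> take (length v) u = v \<and> (\<forall>i\<le>n. 0 \<le> \<eta> (endpoint e 0 (take i u)))" for n u
  define E where "E n = {\<omega>. P (length v + n) (pre (length v + n) \<omega>)}" for n
  have P: "P (length v + n) (pre (length v + n) \<omega>) \<longleftrightarrow> \<omega> \<in> cyl v \<and> (\<forall>i\<le>length v + n. 0 \<le> ht i \<omega>)" for n \<omega>
    by (auto simp: P_def take_pre ht_def pos_def)
  have E: "E n = cyl v \<inter> {\<omega>. \<forall>i\<le>length v + n. 0 \<le> ht i \<omega>}" for n
    by (auto simp: E_def P)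
  have E_dec: "decseq E"
    unfolding decseq_def E by auto
  have E_Int: "(\<Inter>n. E n) = cyl v \<inter> D"
    unfolding E D_def by (auto simp: le_add2) (meson le_add2)
  have sets_E [measurable]: "E n \<in> sets Q" for n
    unfolding E_def by (rule sets_pre)
  have step: "prob {\<omega>. pre s \<omega> = w \<and> shift s \<omega> \<in> E n} = wt w * prob (E n)" for n
  proof -
    have "prob {\<omega>. pre s \<omega> = w \<and> shift s \<omega> \<in> E n} =
        (\<Sum>u | length u = length v + n \<and> P (length v + n) u. wt (w @ u))"
      using prob_append[of w "P (length v + n)" "length v + n"] by (simp add: E_def s_def)
    also have "\<dots> = (\<Sum>u | length u = length v + n \<and> P (length v + n) u. wt w * wt u)"
      by (intro sum.cong refl wt_append w) (auto simp: P_def)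
    also have "\<dots> = wt w * prob (E n)"
      by (simp add: E_def prob_pre sum_distrib_left)
    finally show ?thesis .
  qed
  define F where "F n = {\<omega>. pre s \<omega> = w \<and> shift s \<omega> \<in> E n}" for n
  have "(\<lambda>n. prob (F n)) \<longlonglongrightarrow> prob (\<Inter>n. F n)"
  proof (rule finite_Lim_measure_decseq)
    have "F n = {\<omega>. pre s \<omega> = w} \<inter> {\<omega>. shift s \<omega> \<in> E n}" for n
      by (auto simp: F_def)
    then show "range F \<subseteq> sets Q"
      using sets_shift[OF sets_E] sets_pre by auto
    show "decseq F"
      using E_dec by (auto simp: decseq_def F_def)
  qed
  moreover have "(\<lambda>n. wt w * prob (E n)) \<longlonglongrightarrow> wt w * prob (\<Inter>n. E n)"
    by (intro tendsto_mult tendsto_const finite_Lim_measure_decseq E_dec) auto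
  ultimately have "prob (\<Inter>n. F n) = wt w * prob (\<Inter>n. E n)"
    unfolding F_def step by (rule LIMSEQ_unique)
  moreover have "(\<Inter>n. F n) = {\<omega>. pre s \<omega> = w \<and> shift s \<omega> \<in> (\<Inter>n. E n)}"
    by (auto simp: F_def)
  ultimately show ?thesis
    by (simp only: E_Int s_def)
qed

text \<open>Both sides are finite measures in \<open>A\<close>, and \<open>regeneration_cyl\<close>
  compares them on cylinders.\<close>

lemma regeneration:
  assumes w: "new_max w" and A: "A \<in> sets Q"
  shows "prob {\<omega>. pre (length w) \<omega> = w \<and> shift (length w) \<omega> \<in> A \<inter> D} = wt w * prob (A \<inter> D)"
proof -
  define s where "s = length w"
  define S where "S = {\<omega>. pre s \<omega> = w \<and> shift s \<omega> \<in> D}"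
  have [measurable]: "S \<in> sets Q"
  proof -
    have "S = {\<omega>. pre s \<omega> = w} \<inter> {\<omega>. shift s \<omega> \<in> D}"
      by (auto simp: S_def)
    then show ?thesis
      using sets_pre sets_shift[OF sets_D] by auto
  qed
  define M where "M = distr (density Q (indicator S)) path_space (shift s)"
  define N where "N = density Q (\<lambda>\<omega>. ennreal (wt w) * indicator D \<omega>)"
  have [measurable]: "shift s \<in> measurable Q path_space"
    unfolding measurable_cong_sets[OF sets_Q refl] by (rule measurable_shift)
  have M: "emeasure M B = prob {\<omega>. pre s \<omega> = w \<and> shift s \<omega> \<in> B \<inter> D}" if B: "B \<in> sets Q" for B
  proof -
    have "emeasure M B = emeasure (density Q (indicator S)) {\<omega>. shift s \<omega> \<in> B}"
      using B unfolding M_def by (subst emeasure_distr) (auto simp: sets_Q vimage_def)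
    also have "\<dots> = (\<integral>\<^sup>+\<omega>. indicator S \<omega> * indicator {\<omega>. shift s \<omega> \<in> B} \<omega> \<partial>Q)"
      by (rule emeasure_density) (use sets_shift[OF B] in auto)
    also have "\<dots> = (\<integral>\<^sup>+\<omega>. indicator (S \<inter> {\<omega>. shift s \<omega> \<in> B}) \<omega> \<partial>Q)"
      by (simp add: indicator_inter_arith)
    also have "\<dots> = emeasure Q (S \<inter> {\<omega>. shift s \<omega> \<in> B})"
      using sets_shift[OF B] by (intro nn_integral_indicator sets.Int) auto
    also have "S \<inter> {\<omega>. shift s \<omega> \<in> B} = {\<omega>. pre s \<omega> = w \<and> shift s \<omega> \<in> B \<inter> D}"
      by (auto simp: S_def)
    finally show ?thesis
      by (simp add: emeasure_eq_measure)
  qed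
  have N: "emeasure N B = wt w * prob (B \<inter> D)" if B: "B \<in> sets Q" for B
  proof -
    have "emeasure N B = (\<integral>\<^sup>+\<omega>. ennreal (wt w) * indicator D \<omega> * indicator B \<omega> \<partial>Q)"
      unfolding N_def by (rule emeasure_density) (use B in auto)
    also have "\<dots> = (\<integral>\<^sup>+\<omega>. ennreal (wt w) * indicator (B \<inter> D) \<omega> \<partial>Q)"
      by (intro nn_integral_cong) (auto simp: indicator_def)
    also have "\<dots> = ennreal (wt w) * emeasure Q (B \<inter> D)"
      using B by (intro nn_integral_cmult_indicator) auto
    finally show ?thesis
      by (simp add: emeasure_eq_measure ennreal_mult wt_nonneg)
  qed
  have sets: "sets M = sets path_space" "sets N = sets path_space"
    by (simp_all add: M_def N_def sets_Q)
  have "M = N"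
  proof (rule measure_eqI_cyl)
    show "finite_measure M"
      using M[of UNIV] sets.top[of Q] sets_eq_imp_space_eq[OF sets(1)]
      by (intro finite_measureI) (simp add: space_PiM)
    show "emeasure M (cyl v) = emeasure N (cyl v)" for v
      using regeneration_cyl[OF w, of v] by (simp add: M N sets_pre s_def)
  qed (rule sets)+
  then show ?thesis
    using M[OF A] N[OF A] wt_nonneg[of w] by (simp add: s_def)
qed

text \<open>By \<open>disj\<close> every path admits at most one cutting time, so the event is a
  disjoint union over the lengths of the prefix, and the future factor can be pulled out of each
  term.\<close>

lemma regeneration_sums:
  assumes G: "\<And>w. w \<in> G \<Longrightarrow> new_max w" and A: "A \<in> sets Q"
    and disj: "\<And>\<omega> m n. pre m \<omega> \<in> G \<Longrightarrow> shift m \<omega> \<in> A \<inter> D \<Longrightarrow> pre n \<omega> \<in> G \<Longrightarrow> shift n \<omega> \<in> A \<inter> D \<Longrightarrow> m = n"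
  shows "(\<lambda>n. prob {\<omega>. pre n \<omega> \<in> G} * prob (A \<inter> D)) sums
    prob {\<omega>. \<exists>n. pre n \<omega> \<in> G \<and> shift n \<omega> \<in> A \<inter> D}"
proof -
  define E where "E n = {\<omega>. pre n \<omega> \<in> G \<and> shift n \<omega> \<in> A \<inter> D}" for n
  have AD: "A \<inter> D \<in> sets Q"
    using A by auto
  have E_sets: "E n \<in> sets Q" for n
  proof -
    have "E n = {\<omega>. pre n \<omega> \<in> G} \<inter> {\<omega>. shift n \<omega> \<in> A \<inter> D}"
      by (auto simp: E_def)
    then show ?thesis
      using sets_pre sets_shift[OF AD] by auto
  qed
  have E: "prob (E n) = prob {\<omega>. pre n \<omega> \<in> G} * prob (A \<inter> D)" for n
  proof -
    have sets: "{\<omega>. pre (length w) \<omega> = w \<and> shift (length w) \<omega> \<in> A \<inter> D} \<in> sets Q" for w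
    proof -
      have "{\<omega>. pre (length w) \<omega> = w \<and> shift (length w) \<omega> \<in> A \<inter> D} = cyl w \<inter> {\<omega>. shift (length w) \<omega> \<in> A \<inter> D}"
        by auto
      then show ?thesis
        using sets_pre sets_shift[OF AD] by auto
    qed
    have "E n = (\<Union>w\<in>{w. length w = n \<and> w \<in> G}. {\<omega>. pre (length w) \<omega> = w \<and> shift (length w) \<omega> \<in> A \<inter> D})"
      by (auto simp: E_def)
    also have "prob \<dots> = (\<Sum>w | length w = n \<and> w \<in> G. prob {\<omega>. pre (length w) \<omega> = w \<and> shift (length w) \<omega> \<in> A \<inter> D})"
      by (rule finite_measure_finite_Union) (use sets in \<open>auto simp: disjoint_family_on_def\<close>)
    also have "\<dots> = (\<Sum>w | length w = n \<and> w \<in> G. wt w * prob (A \<inter> D))"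
      by (intro sum.cong refl regeneration A G) auto
    also have "\<dots> = prob {\<omega>. pre n \<omega> \<in> G} * prob (A \<inter> D)"
      using prob_pre[of "\<lambda>w. w \<in> G" n] by (simp only: sum_distrib_right)
    finally show ?thesis .
  qed
  have "(\<lambda>n. prob (E n)) sums prob (\<Union>n. E n)"
    by (rule finite_measure_UNION) (use E_sets disj in \<open>auto simp: disjoint_family_on_def E_def\<close>)
  moreover have "(\<Union>n. E n) = {\<omega>. \<exists>n. pre n \<omega> \<in> G \<and> shift n \<omega> \<in> A \<inter> D}"
    by (auto simp: E_def)
  ultimately show ?thesis
    by (simp only: E)
qed

text \<open>The height rises by at most one per step, so the first time at or above the level is
  exactly on it and is a new maximum.\<close>

lemma first_hit:
  assumes "int l \<le> ht t \<omega>"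
  obtains n where "new_max (pre n \<omega>)" "ht n \<omega> = int l"
proof -
  define n where "n = (LEAST n. int l \<le> ht n \<omega>)"
  have n: "int l \<le> ht n \<omega>"
    unfolding n_def using assms by (rule LeastI)
  have less: "ht i \<omega> < int l" if "i < n" for i
    using not_less_Least[OF that[unfolded n_def]] by simp
  have "ht n \<omega> \<le> int l"
  proof (cases n)
    case (Suc m)
    then show ?thesis
      using less[of m] ht_Suc_le(1)[of m \<omega>] by simp
  qed simp
  then have "ht n \<omega> = int l"
    using n by simp
  then show ?thesis
    using less by (intro that[of n]) (auto simp: new_max_pre)
qed

lemma new_max_level_unique:
  "new_max (pre m \<omega>) \<Longrightarrow> new_max (pre n \<omega>) \<Longrightarrow> ht m \<omega> = ht n \<omega> \<Longrightarrow> m = n"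
  by (metis linorder_neqE_nat new_max_pre order_less_irrefl)

lemma sets_hit: "{\<omega>. \<exists>t. int l \<le> ht t \<omega>} \<in> sets Q"
  by (rule sets_CollectI) measurable

lemma AE_hit_level: "AE \<omega> in Q. \<exists>t. int l \<le> ht t \<omega>"
  using prob_hit_level[of l] sets_hit by (subst (asm) prob_eq_1) auto

text \<open>A level carries at most one new maximum, so the prefix probabilities for different
  lengths add up: the past up to the hitting time and the future above it are independent.\<close>

lemma regeneration_level:
  fixes l P
  assumes A: "A \<in> sets Q"
  defines "G \<equiv> {w. new_max w \<and> \<eta> (endpoint e 0 w) = int l \<and> P w}"
  shows "prob {\<omega>. \<exists>n. pre n \<omega> \<in> G \<and> shift n \<omega> \<in> A \<inter> D} = prob {\<omega>. \<exists>n. pre n \<omega> \<in> G} * prob (A \<inter> D)"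
proof -
  have uniq: "m = n" if "pre m \<omega> \<in> G" "pre n \<omega> \<in> G" for m n \<omega>
    using that by (intro new_max_level_unique[of m \<omega> n]) (auto simp: G_def ht_def pos_def)
  have "(\<lambda>n. prob {\<omega>. pre n \<omega> \<in> G}) sums prob (\<Union>n. {\<omega>. pre n \<omega> \<in> G})"
    by (rule finite_measure_UNION) (use sets_pre uniq in \<open>auto simp: disjoint_family_on_def\<close>)
  moreover have "(\<Union>n. {\<omega>. pre n \<omega> \<in> G}) = {\<omega>. \<exists>n. pre n \<omega> \<in> G}"
    by auto
  ultimately have "(\<lambda>n. prob {\<omega>. pre n \<omega> \<in> G} * prob (A \<inter> D)) sums (prob {\<omega>. \<exists>n. pre n \<omega> \<in> G} * prob (A \<inter> D))"
    by (intro sums_mult2) simp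
  moreover have "(\<lambda>n. prob {\<omega>. pre n \<omega> \<in> G} * prob (A \<inter> D)) sums
      prob {\<omega>. \<exists>n. pre n \<omega> \<in> G \<and> shift n \<omega> \<in> A \<inter> D}"
    by (rule regeneration_sums) (use A uniq in \<open>auto simp: G_def\<close>)
  ultimately show ?thesis
    by (rule sums_unique2[symmetric])
qed

text \<open>Whatever the prefix, a higher level is reached almost surely, and from there
  \<open>A \<inter> D\<close> occurs with a probability unaffected by the past. This probability
  serves as the constant in \<open>prob_eq_1_by_cyl\<close>.\<close>

lemma prob_eq_1_regeneration:
  assumes A: "A \<in> sets Q" "0 < prob (A \<inter> D)" and B: "B \<in> sets Q"
    and imp: "\<And>\<omega> n. m \<le> n \<Longrightarrow> new_max (pre n \<omega>) \<Longrightarrow> shift n \<omega> \<in> A \<inter> D \<Longrightarrow> \<omega> \<in> B"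
  shows "prob B = 1"
proof (rule prob_eq_1_by_cyl[OF B A(2)])
  fix w :: "'k list"
  define s where "s = length w"
  \<comment> \<open>Height \<open>l\<close> takes at least \<open>l\<close> steps, so the new
    maximum at this level comes after the prefix \<open>w\<close> and after time
    \<open>m\<close>.\<close>
  define l where "l = max s m + 1"
  define G where "G = {u. new_max u \<and> \<eta> (endpoint e 0 u) = int l \<and> take s u = w}"
  have large: "l \<le> n" if "ht n \<omega> = int l" for n \<omega>
    using ht_diff_le[of 0 n \<omega>] that by simp
  have mem: "pre n \<omega> \<in> G \<longleftrightarrow> new_max (pre n \<omega>) \<and> ht n \<omega> = int l \<and> pre s \<omega> = w" for n \<omega>
    using large[of n \<omega>] by (auto simp: G_def ht_def pos_def take_pre l_def)
  have "wt w = prob (cyl w)"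
    by (simp add: cylinder)
  also have "\<dots> = prob (cyl w \<inter> {\<omega>. \<exists>t. int l \<le> ht t \<omega>})"
    using sets_pre sets_hit AE_hit_level[of l] by (intro finite_measure_eq_AE) auto
  also have "\<dots> \<le> prob {\<omega>. \<exists>n. pre n \<omega> \<in> G}"
  proof (rule finite_measure_mono)
    show "cyl w \<inter> {\<omega>. \<exists>t. int l \<le> ht t \<omega>} \<subseteq> {\<omega>. \<exists>n. pre n \<omega> \<in> G}"
      unfolding mem s_def by (auto elim!: first_hit)
    have "{\<omega>. \<exists>n. pre n \<omega> \<in> G} = (\<Union>n. {\<omega>. pre n \<omega> \<in> G})"
      by auto
    then show "{\<omega>. \<exists>n. pre n \<omega> \<in> G} \<in> sets Q"
      using sets_pre by auto
  qed
  finally have "prob (A \<inter> D) * wt w \<le> prob {\<omega>. \<exists>n. pre n \<omega> \<in> G} * prob (A \<inter> D)"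
    by (subst mult.commute) (intro mult_right_mono measure_nonneg)
  also have "\<dots> = prob {\<omega>. \<exists>n. pre n \<omega> \<in> G \<and> shift n \<omega> \<in> A \<inter> D}"
    unfolding G_def by (rule regeneration_level[OF A(1), symmetric])
  also have "\<dots> \<le> prob (cyl w \<inter> B)"
  proof (rule finite_measure_mono)
    show "{\<omega>. \<exists>n. pre n \<omega> \<in> G \<and> shift n \<omega> \<in> A \<inter> D} \<subseteq> cyl w \<inter> B"
    proof clarify
      fix \<omega> n assume n: "pre n \<omega> \<in> G" "shift n \<omega> \<in> A" "shift n \<omega> \<in> D"
      then have "m \<le> n"
        using large[of n \<omega>] by (simp add: mem l_def)
      then show "\<omega> \<in> cyl w \<inter> B"
        using n imp[of n \<omega>] by (simp add: mem s_def)
    qed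
    show "cyl w \<inter> B \<in> sets Q"
      using B sets_pre by auto
  qed
  finally show "prob (A \<inter> D) * wt w \<le> prob (cyl w \<inter> B)" .
qed

end

section \<open>Regeneration times\<close>

context drifted_walk
begin

definition regen :: "(nat \<Rightarrow> 'k) \<Rightarrow> nat \<Rightarrow> bool" where
  "regen \<omega> n \<longleftrightarrow> (\<forall>i<n. ht i \<omega> < ht n \<omega>) \<and> (\<forall>j\<ge>n. ht n \<omega> \<le> ht j \<omega>)"

text \<open>The value is unspecified for paths without a positive regeneration time; hence the
  explicit condition \<open>\<exists>n>0. regen \<omega> n\<close> in the statements below, which
  holds almost surely by \<open>AE_regen\<close>.\<close>

definition \<tau> :: "(nat \<Rightarrow> 'k) \<Rightarrow> nat" where
  "\<tau> \<omega> = (LEAST n. 0 < n \<and> regen \<omega> n)"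

lemma shift_in_D: "shift n \<omega> \<in> D \<longleftrightarrow> (\<forall>j\<ge>n. ht n \<omega> \<le> ht j \<omega>)"
proof -
  have "shift n \<omega> \<in> D \<longleftrightarrow> (\<forall>i. ht n \<omega> \<le> ht (n + i) \<omega>)"
    by (simp add: D_def ht_add)
  also have "\<dots> \<longleftrightarrow> (\<forall>j\<ge>n. ht n \<omega> \<le> ht j \<omega>)"
    by (metis le_add1 le_Suc_ex)
  finally show ?thesis .
qed

lemma regen_iff: "regen \<omega> n \<longleftrightarrow> new_max (pre n \<omega>) \<and> shift n \<omega> \<in> D"
  by (simp add: regen_def new_max_pre shift_in_D)

lemma regen_shift:
  assumes "regen \<omega> (n + m)"
  shows "regen (shift n \<omega>) m"
proof -
  have "ht i (shift n \<omega>) = ht (n + i) \<omega> - ht n \<omega>" for i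
    by (simp add: ht_add)
  then show ?thesis
    using assms by (auto simp: regen_def)
qed

lemma measurable_regen [measurable]: "Measurable.pred Q (\<lambda>\<omega>. regen \<omega> n)"
  unfolding regen_def by measurable

lemma measurable_\<tau> [measurable]: "\<tau> \<in> measurable Q (count_space UNIV)"
  unfolding \<tau>_def[abs_def] by measurable

lemma AE_regen: "AE \<omega> in Q. \<exists>n>0. regen \<omega> n"
proof -
  have "prob {\<omega>. \<exists>n>0. regen \<omega> n} = 1"
  proof (rule prob_eq_1_regeneration[where m = 1])
    show "UNIV \<in> sets Q"
      using sets.top[of Q] by simp
    show "0 < prob (UNIV \<inter> D)"
      using prob_D_pos by simp
    show "{\<omega>. \<exists>n>0. regen \<omega> n} \<in> sets Q"
      by (rule sets_CollectI) measurable
    show "\<omega> \<in> {\<omega>. \<exists>n>0. regen \<omega> n}" if "1 \<le> n" "new_max (pre n \<omega>)" "shift n \<omega> \<in> UNIV \<inter> D" for \<omega> n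
      using that by (auto simp: regen_iff intro!: exI[of _ n])
  qed
  moreover have "{\<omega>. \<exists>n>0. regen \<omega> n} \<in> sets Q"
    by (rule sets_CollectI) measurable
  ultimately show ?thesis
    by (subst (asm) prob_eq_1) auto
qed

lemma \<tau>:
  assumes "\<exists>n>0. regen \<omega> n"
  shows "0 < \<tau> \<omega>" "regen \<omega> (\<tau> \<omega>)"
  using LeastI_ex[of "\<lambda>n. 0 < n \<and> regen \<omega> n"] assms by (auto simp: \<tau>_def)

lemma less_\<tau>: "0 < n \<Longrightarrow> n < \<tau> \<omega> \<Longrightarrow> \<not> regen \<omega> n"
  using not_less_Least[of n "\<lambda>n. 0 < n \<and> regen \<omega> n"] by (auto simp: \<tau>_def)

text \<open>The words that can be the trajectory between two consecutive regenerations.\<close>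

definition blocks :: "'k list set" where
  "blocks = {w. 0 < length w \<and> new_max w \<and> (\<forall>i\<le>length w. 0 \<le> \<eta> (endpoint e 0 (take i w))) \<and>
    (\<forall>m. 0 < m \<and> m < length w \<longrightarrow> \<not> (new_max (take m w) \<and>
      (\<forall>j. m \<le> j \<and> j \<le> length w \<longrightarrow> \<eta> (endpoint e 0 (take m w)) \<le> \<eta> (endpoint e 0 (take j w)))))}"

text \<open>A word can test for regenerations only up to its own end. If the future stays above that
  end, a time that passes the test up to \<open>n\<close> passes it forever, since its height is at
  most the height at \<open>n\<close>.\<close>

lemma pre_in_blocks:
  assumes D: "shift n \<omega> \<in> D"
  shows "pre n \<omega> \<in> blocks \<longleftrightarrow> \<omega> \<in> D \<and> 0 < n \<and> regen \<omega> n \<and> \<tau> \<omega> = n"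
proof -
  have ge: "ht n \<omega> \<le> ht j \<omega>" if "n \<le> j" for j
    using D that by (simp add: shift_in_D)
  have ht: "\<eta> (endpoint e 0 (pre i \<omega>)) = ht i \<omega>" for i
    by (simp add: ht_def pos_def)
  have Nil: "pre n \<omega> \<noteq> [] \<longleftrightarrow> 0 < n"
    by (cases n) (auto simp: pre_Suc)
  have bl: "pre n \<omega> \<in> blocks \<longleftrightarrow> 0 < n \<and> new_max (pre n \<omega>) \<and> (\<forall>i\<le>n. 0 \<le> ht i \<omega>) \<and>
    (\<forall>m. 0 < m \<and> m < n \<longrightarrow> \<not> (new_max (pre m \<omega>) \<and> (\<forall>j. m \<le> j \<and> j \<le> n \<longrightarrow> ht m \<omega> \<le> ht j \<omega>)))"
    by (simp add: blocks_def ht take_pre Nil cong: conj_cong imp_cong)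
  have D_iff: "(\<forall>i\<le>n. 0 \<le> ht i \<omega>) \<longleftrightarrow> \<omega> \<in> D"
    unfolding D_def using ge by (auto simp: D_def) (meson nle_le order_trans)
  have regen_m: "new_max (pre m \<omega>) \<and> (\<forall>j. m \<le> j \<and> j \<le> n \<longrightarrow> ht m \<omega> \<le> ht j \<omega>) \<longleftrightarrow> regen \<omega> m"
    if "m < n" for m
  proof
    assume m: "new_max (pre m \<omega>) \<and> (\<forall>j. m \<le> j \<and> j \<le> n \<longrightarrow> ht m \<omega> \<le> ht j \<omega>)"
    then have "ht m \<omega> \<le> ht n \<omega>"
      using \<open>m < n\<close> by simp
    then have "ht m \<omega> \<le> ht j \<omega>" if "m \<le> j" for j
      using m that ge[of j] by (cases "j \<le> n") auto
    then show "regen \<omega> m"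
      using m by (simp add: regen_def new_max_pre)
  qed (auto simp: regen_def new_max_pre)
  have "pre n \<omega> \<in> blocks \<longleftrightarrow> 0 < n \<and> regen \<omega> n \<and> \<omega> \<in> D \<and> (\<forall>m. 0 < m \<and> m < n \<longrightarrow> \<not> regen \<omega> m)"
    unfolding bl D_iff using regen_m D by (auto simp: regen_iff[of \<omega> n])
  also have "\<dots> \<longleftrightarrow> \<omega> \<in> D \<and> 0 < n \<and> regen \<omega> n \<and> \<tau> \<omega> = n"
  proof safe
    assume "0 < n" "regen \<omega> n" "\<forall>m. 0 < m \<and> m < n \<longrightarrow> \<not> regen \<omega> m"
    then show "\<tau> \<omega> = n"
      unfolding \<tau>_def by (intro Least_equality) (auto simp: not_less[symmetric])
  next
    fix m assume "0 < m" "m < \<tau> \<omega>" "regen \<omega> m"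
    then show False
      using less_\<tau> by blast
  qed
  finally show ?thesis .
qed

text \<open>Summing over all blocks gives \<open>prob (A \<inter> D)\<close> times a constant that
  does not depend on \<open>A\<close>. For the whole space both sides are \<open>prob D\<close>,
  because regenerations exist almost surely, so the constant is 1.\<close>

lemma block_shift_invariant:
  assumes A: "A \<in> sets Q"
  shows "prob {\<omega>. \<omega> \<in> D \<and> (\<exists>n>0. regen \<omega> n) \<and> shift (\<tau> \<omega>) \<omega> \<in> A} = prob (A \<inter> D)"
proof -
  have eq: "(\<exists>n. pre n \<omega> \<in> blocks \<and> shift n \<omega> \<in> B \<inter> D) \<longleftrightarrow>
      \<omega> \<in> D \<and> (\<exists>n>0. regen \<omega> n) \<and> shift (\<tau> \<omega>) \<omega> \<in> B" for \<omega> B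
  proof
    assume "\<exists>n. pre n \<omega> \<in> blocks \<and> shift n \<omega> \<in> B \<inter> D"
    then obtain n where "pre n \<omega> \<in> blocks" "shift n \<omega> \<in> B" "shift n \<omega> \<in> D"
      by blast
    then show "\<omega> \<in> D \<and> (\<exists>n>0. regen \<omega> n) \<and> shift (\<tau> \<omega>) \<omega> \<in> B"
      using pre_in_blocks[of n \<omega>] by auto
  next
    assume "\<omega> \<in> D \<and> (\<exists>n>0. regen \<omega> n) \<and> shift (\<tau> \<omega>) \<omega> \<in> B"
    then show "\<exists>n. pre n \<omega> \<in> blocks \<and> shift n \<omega> \<in> B \<inter> D"
      using \<tau>[of \<omega>] pre_in_blocks[of "\<tau> \<omega>" \<omega>] by (intro exI[of _ "\<tau> \<omega>"]) (auto simp: regen_iff)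
  qed
  have sums: "(\<lambda>n. prob {\<omega>. pre n \<omega> \<in> blocks} * prob (B \<inter> D)) sums
      prob {\<omega>. \<omega> \<in> D \<and> (\<exists>n>0. regen \<omega> n) \<and> shift (\<tau> \<omega>) \<omega> \<in> B}" if "B \<in> sets Q" for B
    unfolding eq[symmetric]
    by (rule regeneration_sums) (use that pre_in_blocks in \<open>auto simp: blocks_def\<close>)
  have UNIV: "UNIV \<in> sets Q"
    using sets.top[of Q] by simp
  have "prob {\<omega>. \<omega> \<in> D \<and> (\<exists>n>0. regen \<omega> n) \<and> shift (\<tau> \<omega>) \<omega> \<in> UNIV} = prob D"
  proof (rule finite_measure_eq_AE)
    show "AE \<omega> in Q. (\<omega> \<in> {\<omega>. \<omega> \<in> D \<and> (\<exists>n>0. regen \<omega> n) \<and> shift (\<tau> \<omega>) \<omega> \<in> UNIV}) = (\<omega> \<in> D)"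
      using AE_regen by eventually_elim auto
    have "{\<omega>. \<omega> \<in> D \<and> (\<exists>n>0. regen \<omega> n)} \<in> sets Q"
      by (rule sets_CollectI) measurable
    then show "{\<omega>. \<omega> \<in> D \<and> (\<exists>n>0. regen \<omega> n) \<and> shift (\<tau> \<omega>) \<omega> \<in> UNIV} \<in> sets Q"
      by simp
  qed (rule sets_D)
  then have "(\<lambda>n. prob {\<omega>. pre n \<omega> \<in> blocks} * prob D) sums prob D"
    using sums[OF UNIV] by simp
  then have "(\<lambda>n. prob {\<omega>. pre n \<omega> \<in> blocks} * prob D / prob D) sums (prob D / prob D)"
    by (rule sums_divide)
  then have "(\<lambda>n. prob {\<omega>. pre n \<omega> \<in> blocks}) sums 1"
    using prob_D_pos by simp
  then have "(\<lambda>n. prob {\<omega>. pre n \<omega> \<in> blocks} * prob (A \<inter> D)) sums (1 * prob (A \<inter> D))"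
    by (rule sums_mult2)
  then show ?thesis
    using sums[OF A] sums_unique2 by simp
qed

section \<open>Integrability of the regeneration time\<close>

definition no_regen :: "nat \<Rightarrow> (nat \<Rightarrow> 'k) set" where
  "no_regen k = {\<omega> \<in> D. \<forall>n. 0 < n \<and> n \<le> k \<longrightarrow> \<not> regen \<omega> n}"

lemma sets_no_regen [measurable]: "no_regen k \<in> sets Q"
  unfolding no_regen_def by (rule sets_CollectI) measurable

text \<open>
  Every time belongs to at most one pair of a regeneration below level \<open>K\<close> and a delay
  \<open>k < K\<close> before the next regeneration, and these times precede the exit from level \<open>2 K\<close>.
\<close>

lemma sum_prob_no_regen: "(\<Sum>k<K. prob (no_regen k)) \<le> 2 / \<delta>"
proof (cases "K = 0")
  case False
  define G where "G l = {w. new_max w \<and> \<eta> (endpoint e 0 w) = int l \<and> True}" for l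
  define E where "E l k = {\<omega>. \<exists>n. pre n \<omega> \<in> G l \<and> shift n \<omega> \<in> no_regen k \<inter> D}" for l k
  define B where "B t = {\<omega>. \<forall>i\<le>t. ht i \<omega> < int (2 * K)}" for t
  have G: "pre n \<omega> \<in> G l \<longleftrightarrow> new_max (pre n \<omega>) \<and> ht n \<omega> = int l" for n \<omega> l
    by (simp add: G_def ht_def pos_def)
  have no_regen_D: "no_regen k \<inter> D = no_regen k" for k
    by (auto simp: no_regen_def)
  have sets_E [measurable]: "E l k \<in> sets Q" for l k
  proof -
    have "E l k = (\<Union>n. {\<omega>. pre n \<omega> \<in> G l} \<inter> {\<omega>. shift n \<omega> \<in> no_regen k})"
      by (auto simp: E_def no_regen_D)
    also have "\<dots> \<in> sets Q"
      by (intro sets.countable_UN image_subsetI sets.Int sets_pre sets_shift sets_no_regen)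
    finally show ?thesis .
  qed
  have sets_B [measurable]: "B t \<in> sets Q" for t
    unfolding B_def by (rule sets_CollectI) measurable
  \<comment> \<open>Level \<open>l\<close> is reached almost surely, and the event asks for its new
    maximum to be followed by a future in \<open>no_regen k\<close>.\<close>
  have E: "prob (E l k) = prob (no_regen k)" for l k
  proof -
    have "prob {\<omega>. \<exists>n. pre n \<omega> \<in> G l} = prob {\<omega>. \<exists>t. int l \<le> ht t \<omega>}"
      unfolding G
      by (rule arg_cong[of _ _ prob], intro Collect_cong iffI)
        (metis order_refl, metis first_hit)
    then show ?thesis
      using regeneration_level[OF sets_no_regen, of l "\<lambda>_. True" k]
      by (simp add: E_def G_def prob_hit_level no_regen_D)
  qed
  have count: "(\<Sum>(l, k)\<in>{..<K} \<times> {..<K}. indicator (E l k) \<omega>) \<le> (\<Sum>t. indicator (B t) \<omega> :: ennreal)" for \<omega>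
  proof -
    \<comment> \<open>The unique new maximum at level \<open>l\<close>; the choice is used only on
      the events \<open>E l k\<close>, where one exists.\<close>
    define T where "T l = (SOME n. new_max (pre n \<omega>) \<and> ht n \<omega> = int l)" for l
    define P where "P = {(l, k) \<in> {..<K} \<times> {..<K}. \<omega> \<in> E l k}"
    have T: "new_max (pre (T l) \<omega>)" "ht (T l) \<omega> = int l" "shift (T l) \<omega> \<in> no_regen k" if E: "\<omega> \<in> E l k" for l k
    proof -
      obtain n where n: "new_max (pre n \<omega>)" "ht n \<omega> = int l" "shift n \<omega> \<in> no_regen k"
        using E by (auto simp: E_def G)
      have *: "new_max (pre (T l) \<omega>) \<and> ht (T l) \<omega> = int l"
        unfolding T_def by (rule someI[of _ n]) (use n in auto)
      moreover have "T l = n"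
        by (rule new_max_level_unique[of _ \<omega>]) (use * n in auto)
      ultimately show "new_max (pre (T l) \<omega>)" "ht (T l) \<omega> = int l" "shift (T l) \<omega> \<in> no_regen k"
        using n by auto
    qed
    \<comment> \<open>If two pairs gave the same time, the later regeneration would fall within the
      delay of the earlier one, during which there is none.\<close>
    have not_less: False
      if lk: "\<omega> \<in> E l k" "\<omega> \<in> E l' k'" "T l + k = T l' + k'" "T l < T l'" for l k l' k'
    proof -
      have "regen \<omega> (T l')"
        using T[OF lk(2)] by (simp add: regen_iff no_regen_def)
      then have "regen (shift (T l) \<omega>) (T l' - T l)"
        using regen_shift[of \<omega> "T l" "T l' - T l"] lk(4) by simp
      moreover have "0 < T l' - T l" "T l' - T l \<le> k"
        using lk by auto
      ultimately show False
        using T(3)[OF lk(1)] by (auto simp: no_regen_def)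
    qed
    have inj: "inj_on (\<lambda>(l, k). T l + k) P"
    proof (rule inj_onI, clarify)
      fix l k l' k' assume lk: "(l, k) \<in> P" "(l', k') \<in> P" "T l + k = T l' + k'"
      then have "\<omega> \<in> E l k" "\<omega> \<in> E l' k'"
        by (auto simp: P_def)
      then have eq: "T l = T l'"
        using not_less[of l k l' k'] not_less[of l' k' l k] lk(3) by (metis linorder_neqE_nat)
      have "int l = ht (T l) \<omega>"
        by (rule T(2)[OF \<open>\<omega> \<in> E l k\<close>, symmetric])
      also have "\<dots> = int l'"
        unfolding eq by (rule T(2)[OF \<open>\<omega> \<in> E l' k'\<close>])
      finally have "l = l'"
        by (simp only: of_nat_eq_iff)
      then show "l = l' \<and> k = k'"
        using lk(3) by simp
    qed
    \<comment> \<open>Before time \<open>T l\<close> the path is below level \<open>l\<close>, and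
      \<open>k\<close> further steps raise it by at most \<open>k\<close>, so it stays below
      \<open>2 * K\<close>.\<close>
    have sub: "\<omega> \<in> B (T l + k)" if "(l, k) \<in> P" for l k
    proof -
      have lk: "\<omega> \<in> E l k" "l < K" "k < K"
        using that by (auto simp: P_def)
      have "ht i \<omega> < int (2 * K)" if "i \<le> T l + k" for i
      proof (cases "i < T l")
        case True
        then show ?thesis
          using T[OF lk(1)] lk by (fastforce simp: new_max_pre)
      next
        case False
        then have "ht i \<omega> \<le> ht (T l) \<omega> + int (i - T l)"
          using ht_diff_le[of "T l" "i - T l" \<omega>] by simp
        then show ?thesis
          using T(2)[OF lk(1)] lk that False by linarith
      qed
      then show ?thesis
        by (simp add: B_def)
    qed
    have fin: "finite P"
      by (rule finite_subset[of _ "{..<K} \<times> {..<K}"]) (auto simp: P_def)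
    have "(\<Sum>(l, k)\<in>{..<K} \<times> {..<K}. indicator (E l k) \<omega> :: ennreal) = (\<Sum>(l, k)\<in>P. 1)"
      by (rule sum.mono_neutral_cong_right) (auto simp: P_def indicator_def split: if_splits)
    also have "\<dots> = (\<Sum>t\<in>(\<lambda>(l, k). T l + k) ` P. 1)"
      using inj by (simp add: card_image case_prod_unfold)
    also have "\<dots> = (\<Sum>t\<in>(\<lambda>(l, k). T l + k) ` P. indicator (B t) \<omega>)"
      by (rule sum.cong) (use sub in \<open>auto simp: indicator_def\<close>)
    also have "\<dots> \<le> (\<Sum>t. indicator (B t) \<omega>)"
      using fin by (intro sum_le_suminf) auto
    finally show ?thesis .
  qed
  have "ennreal (K * (\<Sum>k<K. prob (no_regen k))) = ennreal (\<Sum>(l, k)\<in>{..<K} \<times> {..<K}. prob (E l k))"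
    by (simp add: E sum.cartesian_product[symmetric])
  also have "\<dots> = (\<Sum>p\<in>{..<K} \<times> {..<K}. emeasure Q (case p of (l, k) \<Rightarrow> E l k))"
    by (simp add: emeasure_eq_measure case_prod_unfold)
  also have "\<dots> = (\<integral>\<^sup>+\<omega>. (\<Sum>p\<in>{..<K} \<times> {..<K}. indicator (case p of (l, k) \<Rightarrow> E l k) \<omega>) \<partial>Q)"
    by (simp add: nn_integral_sum case_prod_unfold)
  also have "\<dots> \<le> (\<integral>\<^sup>+\<omega>. (\<Sum>t. indicator (B t) \<omega>) \<partial>Q)"
    using count by (intro nn_integral_mono) (simp add: case_prod_unfold)
  also have "\<dots> = (\<Sum>t. emeasure Q (B t))"
    by (subst nn_integral_suminf) auto
  also have "\<dots> \<le> ennreal (2 * K / \<delta>)"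
  proof (rule suminf_le_const)
    show "summable (\<lambda>t. emeasure Q (B t))"
      by simp
    fix N
    have "\<delta> * (\<Sum>t<N. prob (B t)) \<le> real (2 * K)"
      unfolding B_def by (rule exit_time_bound) (use False in auto)
    then have "(\<Sum>t<N. prob (B t)) \<le> 2 * K / \<delta>"
      using \<delta>_pos by (simp add: field_simps)
    then show "(\<Sum>t<N. emeasure Q (B t)) \<le> ennreal (2 * K / \<delta>)"
      by (simp add: emeasure_eq_measure sum_ennreal ennreal_leI)
  qed
  finally have "K * (\<Sum>k<K. prob (no_regen k)) \<le> K * (2 / \<delta>)"
    using \<delta>_pos by (subst (asm) ennreal_le_iff) (auto simp: mult.commute)
  then show ?thesis
    by (rule mult_left_le_imp_le) (use False in simp)
qed (use \<delta>_pos in simp)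

text \<open>On \<open>D\<close>, almost surely, \<open>\<tau> \<omega>\<close> is the number of
  \<open>k\<close> with \<open>\<omega> \<in> no_regen k\<close>, so
  \<open>sum_prob_no_regen\<close> bounds its integral.\<close>

lemma integrable_\<tau>: "integrable Q (\<lambda>\<omega>. indicator D \<omega> * real (\<tau> \<omega>))"
proof (rule integrableI_bounded)
  show "(\<lambda>\<omega>. indicator D \<omega> * real (\<tau> \<omega>)) \<in> borel_measurable Q"
    by measurable
  have "(\<integral>\<^sup>+\<omega>. ennreal (norm (indicator D \<omega> * real (\<tau> \<omega>))) \<partial>Q) = (\<integral>\<^sup>+\<omega>. (\<Sum>k. indicator (no_regen k) \<omega>) \<partial>Q)"
  proof (rule nn_integral_cong_AE, use AE_regen in eventually_elim)
    fix \<omega> assume regen: "\<exists>n>0. regen \<omega> n"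
    show "ennreal (norm (indicator D \<omega> * real (\<tau> \<omega>))) = (\<Sum>k. indicator (no_regen k) \<omega>)"
    proof (cases "\<omega> \<in> D")
      case True
      have "\<omega> \<in> no_regen k \<longleftrightarrow> k < \<tau> \<omega>" for k
        using True \<tau>[OF regen] less_\<tau>[of _ \<omega>] by (auto simp: no_regen_def)
      then have "(\<Sum>k. indicator (no_regen k) \<omega> :: ennreal) = (\<Sum>k. if k \<in> {..<\<tau> \<omega>} then 1 else 0)"
        by (intro suminf_cong) (simp add: indicator_def)
      also have "\<dots> = (\<Sum>k<\<tau> \<omega>. 1)"
        by (subst suminf_finite[of "{..<\<tau> \<omega>}"]) auto
      finally show ?thesis
        using True by (simp add: ennreal_of_nat_eq_real_of_nat)
    qed (simp add: no_regen_def)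
  qed
  also have "\<dots> = (\<Sum>k. emeasure Q (no_regen k))"
    by (subst nn_integral_suminf) auto
  also have "\<dots> \<le> ennreal (2 / \<delta>)"
    by (rule suminf_le_const) (use sum_prob_no_regen in \<open>auto simp: emeasure_eq_measure sum_ennreal ennreal_leI\<close>)
  also have "\<dots> < \<infinity>"
    by simp
  finally show "(\<integral>\<^sup>+\<omega>. ennreal (norm (indicator D \<omega> * real (\<tau> \<omega>))) \<partial>Q) < \<infinity>" .
qed

end

section \<open>Law of large numbers\<close>

definition partial_sum :: "('k \<Rightarrow> real) \<Rightarrow> nat \<Rightarrow> (nat \<Rightarrow> 'k) \<Rightarrow> real" where
  "partial_sum u n \<omega> = (\<Sum>i<n. u (\<omega> i))"

lemma partial_sum_add: "partial_sum u (n + m) \<omega> = partial_sum u n \<omega> + partial_sum u m (shift n \<omega>)"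
  by (induction m) (simp_all add: partial_sum_def shift_def)

lemma partial_sum_pre: "partial_sum u n \<omega> = sum_list (map u (pre n \<omega>))"
  by (induction n) (simp_all add: partial_sum_def pre_Suc)

lemma abs_partial_sum_le:
  assumes "\<And>k. \<bar>u k\<bar> \<le> C"
  shows "\<bar>partial_sum u n \<omega>\<bar> \<le> C * real n"
proof -
  have "\<bar>partial_sum u n \<omega>\<bar> \<le> (\<Sum>i<n. \<bar>u (\<omega> i)\<bar>)"
    unfolding partial_sum_def by (rule sum_abs)
  also have "\<dots> \<le> (\<Sum>i<n. C)"
    by (intro sum_mono assms)
  finally show ?thesis
    by (simp add: mult.commute)
qed

section \<open>Running maxima and the maximal inequality\<close>

definition running_max :: "('k \<Rightarrow> real) \<Rightarrow> nat \<Rightarrow> (nat \<Rightarrow> 'k) \<Rightarrow> real" where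
  "running_max u N \<omega> = Max ((\<lambda>n. partial_sum u n \<omega>) ` {..N})"

lemma partial_sum_le_running_max: "n \<le> N \<Longrightarrow> partial_sum u n \<omega> \<le> running_max u N \<omega>"
  unfolding running_max_def by (intro Max_ge) auto

lemma running_max_nonneg: "0 \<le> running_max u N \<omega>"
  using partial_sum_le_running_max[of 0 N u \<omega>] by (simp add: partial_sum_def)

text \<open>A partial sum up to time \<open>n\<close> is at most \<open>C * real n\<close>, and a
  later one splits at time \<open>n\<close>. This is used with \<open>n\<close> the regeneration
  time.\<close>

lemma running_max_le:
  assumes C: "\<And>k. \<bar>u k\<bar> \<le> C" "0 \<le> C"
  shows "running_max u N \<omega> \<le> max (C * real n) (partial_sum u n \<omega> + running_max u N (shift n \<omega>))"
  unfolding running_max_def[of u N \<omega>]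
proof (intro Max.boundedI)
  fix x assume "x \<in> (\<lambda>m. partial_sum u m \<omega>) ` {..N}"
  then obtain m where m: "m \<le> N" "x = partial_sum u m \<omega>"
    by auto
  show "x \<le> max (C * real n) (partial_sum u n \<omega> + running_max u N (shift n \<omega>))"
  proof (cases "m \<le> n")
    case True
    have "x \<le> C * real m"
      using abs_partial_sum_le[where u = u and n = m and \<omega> = \<omega>, OF C(1)] m by simp
    also have "\<dots> \<le> C * real n"
      using True C(2) by (intro mult_left_mono) auto
    finally show ?thesis
      by simp
  next
    case False
    then have "x = partial_sum u n \<omega> + partial_sum u (m - n) (shift n \<omega>)"
      using partial_sum_add[of u n "m - n" \<omega>] m by simp
    also have "\<dots> \<le> partial_sum u n \<omega> + running_max u N (shift n \<omega>)"
      using m by (intro add_left_mono partial_sum_le_running_max) auto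
    finally show ?thesis
      by simp
  qed
qed auto

context drifted_walk
begin

lemma measurable_partial_sum [measurable]: "partial_sum u n \<in> borel_measurable Q"
  unfolding partial_sum_pre[abs_def] measurable_cong_sets[OF sets_Q refl] by (rule measurable_pre_fun_borel)

text \<open>Dependence on finitely many steps gives both measurability and access to
  \<open>integral_block_shift\<close>.\<close>

lemma running_max_pre: "\<exists>F. \<forall>\<omega>. running_max u N \<omega> = F (pre N \<omega>)"
proof -
  have "running_max u N \<omega> = Max ((\<lambda>n. sum_list (map u (take n (pre N \<omega>)))) ` {..N})" for \<omega>
    unfolding running_max_def partial_sum_pre
    by (intro arg_cong[of _ _ Max] image_cong) (auto simp: take_pre)
  then show ?thesis
    by (intro exI[of _ "\<lambda>w. Max ((\<lambda>n. sum_list (map u (take n w))) ` {..N})"]) blast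
qed

lemma measurable_running_max [measurable]: "running_max u N \<in> borel_measurable Q"
proof -
  obtain F where "\<forall>\<omega>. running_max u N \<omega> = F (pre N \<omega>)"
    using running_max_pre by blast
  then have "running_max u N = (\<lambda>\<omega>. F (pre N \<omega>))"
    by auto
  then show ?thesis
    unfolding measurable_cong_sets[OF sets_Q refl] by (simp only: measurable_pre_fun_borel)
qed

lemma measurable_shift_Q [measurable]: "shift n \<in> measurable Q Q"
  unfolding measurable_cong_sets[OF sets_Q sets_Q] by (rule measurable_shift)

lemma measurable_block_shift [measurable]: "(\<lambda>\<omega>. shift (\<tau> \<omega>) \<omega>) \<in> measurable Q Q"
  by (rule measurable_compose_countable[of shift]) measurable

lemma measurable_partial_sum_\<tau> [measurable]: "(\<lambda>\<omega>. partial_sum u (\<tau> \<omega>) \<omega>) \<in> borel_measurable Q"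
  by (rule measurable_compose_countable[of "partial_sum u"]) measurable

text \<open>A function of \<open>N\<close> steps takes finitely many values, so the invariance of
  probabilities under the block shift extends to it by linearity.\<close>

lemma integral_block_shift:
  "(\<integral>\<omega>. indicator D \<omega> * F (pre N (shift (\<tau> \<omega>) \<omega>)) \<partial>Q) = (\<integral>\<omega>. indicator D \<omega> * F (pre N \<omega>) \<partial>Q)"
  for F :: "'k list \<Rightarrow> real"
proof -
  define E where "E w = {\<omega> \<in> D. pre N (shift (\<tau> \<omega>) \<omega>) = w}" for w
  have sets_E: "E w \<in> sets Q" for w
  proof -
    have "E w = D \<inter> ((\<lambda>\<omega>. shift (\<tau> \<omega>) \<omega>) -` {\<omega>. pre N \<omega> = w} \<inter> space Q)"
      by (auto simp: E_def)
    also have "\<dots> \<in> sets Q"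
      using measurable_sets[OF measurable_block_shift sets_pre[of "\<lambda>u. u = w" N]]
      by (rule sets.Int[OF sets_D])
    finally show ?thesis .
  qed
  have E: "prob (E w) = prob ({\<omega>. pre N \<omega> = w} \<inter> D)" for w
  proof -
    have "prob (E w) = prob {\<omega>. \<omega> \<in> D \<and> (\<exists>n>0. regen \<omega> n) \<and> shift (\<tau> \<omega>) \<omega> \<in> {\<omega>. pre N \<omega> = w}}"
    proof (rule finite_measure_eq_AE)
      show "AE \<omega> in Q. (\<omega> \<in> E w) = (\<omega> \<in> {\<omega>. \<omega> \<in> D \<and> (\<exists>n>0. regen \<omega> n) \<and> shift (\<tau> \<omega>) \<omega> \<in> {\<omega>. pre N \<omega> = w}})"
        using AE_regen by eventually_elim (simp add: E_def)
      have "{\<omega>. \<exists>n>0. regen \<omega> n} \<in> sets Q"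
        by (rule sets_CollectI) measurable
      moreover have "{\<omega>. \<omega> \<in> D \<and> (\<exists>n>0. regen \<omega> n) \<and> shift (\<tau> \<omega>) \<omega> \<in> {\<omega>. pre N \<omega> = w}} =
          E w \<inter> {\<omega>. \<exists>n>0. regen \<omega> n}"
        by (auto simp: E_def)
      ultimately show "{\<omega>. \<omega> \<in> D \<and> (\<exists>n>0. regen \<omega> n) \<and> shift (\<tau> \<omega>) \<omega> \<in> {\<omega>. pre N \<omega> = w}} \<in> sets Q"
        using sets_E by simp
    qed (rule sets_E)
    also have "\<dots> = prob ({\<omega>. pre N \<omega> = w} \<inter> D)"
      by (rule block_shift_invariant[OF sets_pre[of "\<lambda>u. u = w" N]])
    finally show ?thesis .
  qed
  have split: "indicator D \<omega> * F w = (\<Sum>v | length v = N. F v * indicator {\<omega> \<in> D. w = v} \<omega>)"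
    if "length w = N" for w \<omega>
  proof -
    have "(\<Sum>v | length v = N. F v * indicator {\<omega> \<in> D. w = v} \<omega>) =
        (\<Sum>v | length v = N. if v = w then indicator D \<omega> * F w else 0)"
      by (rule sum.cong) (auto simp: indicator_def)
    then show ?thesis
      using that by simp
  qed
  have ind: "integrable Q (indicator A :: _ \<Rightarrow> real)" if "A \<in> sets Q" for A
    using that by (intro integrable_real_indicator) (auto simp: less_top[symmetric])
  have pre_D: "{\<omega>. pre N \<omega> = w} \<inter> D \<in> sets Q" for w
    by (rule sets.Int[OF sets_pre[of "\<lambda>u. u = w" N] sets_D])
  have "(\<integral>\<omega>. indicator D \<omega> * F (pre N (shift (\<tau> \<omega>) \<omega>)) \<partial>Q) =
      (\<integral>\<omega>. (\<Sum>v | length v = N. F v * indicator (E v) \<omega>) \<partial>Q)"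
    by (intro Bochner_Integration.integral_cong refl, subst split)
      (auto intro!: sum.cong simp: E_def indicator_def)
  also have "\<dots> = (\<Sum>v | length v = N. F v * prob (E v))"
    using ind[OF sets_E] by (subst Bochner_Integration.integral_sum) auto
  also have "\<dots> = (\<Sum>v | length v = N. F v * prob ({\<omega>. pre N \<omega> = v} \<inter> D))"
    by (simp only: E)
  also have "\<dots> = (\<integral>\<omega>. (\<Sum>v | length v = N. F v * indicator ({\<omega>. pre N \<omega> = v} \<inter> D) \<omega>) \<partial>Q)"
    using ind[OF pre_D] by (subst Bochner_Integration.integral_sum) auto
  also have "\<dots> = (\<integral>\<omega>. indicator D \<omega> * F (pre N \<omega>) \<partial>Q)"
    by (intro Bochner_Integration.integral_cong refl, subst split)
      (auto intro!: sum.cong simp: indicator_def)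
  finally show ?thesis .
qed

lemma integrable_partial_sum_\<tau>: "integrable Q (\<lambda>\<omega>. indicator D \<omega> * partial_sum u (\<tau> \<omega>) \<omega>)"
proof -
  define C where "C = (\<Sum>k\<in>UNIV. \<bar>u k\<bar>)"
  have C: "\<bar>u k\<bar> \<le> C" for k
    unfolding C_def by (intro member_le_sum) auto
  have "integrable Q (\<lambda>\<omega>. C * (indicator D \<omega> * real (\<tau> \<omega>)))"
    by (intro integrable_mult_right integrable_\<tau>)
  then show ?thesis
  proof (rule Bochner_Integration.integrable_bound)
    show "AE \<omega> in Q. norm (indicator D \<omega> * partial_sum u (\<tau> \<omega>) \<omega>) \<le> norm (C * (indicator D \<omega> * real (\<tau> \<omega>)))"
    proof (rule AE_I2)
      fix \<omega>
      show "norm (indicator D \<omega> * partial_sum u (\<tau> \<omega>) \<omega>) \<le> norm (C * (indicator D \<omega> * real (\<tau> \<omega>)))"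
        using abs_partial_sum_le[where u = u and n = "\<tau> \<omega>" and \<omega> = \<omega>, OF C] order_trans[OF _ abs_ge_self]
        by (auto simp: indicator_def)
    qed
  qed measurable
qed

text \<open>
  A maximal inequality in the style of Birkhoff's ergodic theorem: if the partial sums were
  unbounded above on \<open>D\<close>, then \<open>running_max u N \<omega> - running_max u N (shift (\<tau> \<omega>) \<omega>)\<close>, whose
  integral vanishes, would eventually be at most \<open>partial_sum u (\<tau> \<omega>) \<omega>\<close>.
\<close>

lemma AE_partial_sum_bounded:
  assumes neg: "(\<integral>\<omega>. indicator D \<omega> * partial_sum u (\<tau> \<omega>) \<omega> \<partial>Q) < 0"
  shows "AE \<omega> in Q. \<exists>K::nat. \<forall>n. partial_sum u n \<omega> \<le> real K"
proof -
  define C where "C = (\<Sum>k\<in>UNIV. \<bar>u k\<bar>)"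
  have C: "\<bar>u k\<bar> \<le> C" "0 \<le> C" for k
    unfolding C_def by (intro member_le_sum sum_nonneg; simp)+
  define B where "B = {\<omega>. \<exists>K::nat. \<forall>n. partial_sum u n \<omega> \<le> real K}"
  have sets_B: "B \<in> sets Q"
    unfolding B_def by (rule sets_CollectI) measurable
  \<comment> \<open>Finitely many initial steps change the partial sums by a bounded amount. This is
    used twice: to move unboundedness to the next regeneration, and to pass from positive
    probability on \<open>D\<close> to probability one.\<close>
  have B_shift: "\<omega> \<in> B" if shift: "shift n \<omega> \<in> B" for n \<omega>
  proof -
    obtain K :: nat where K: "\<And>m. partial_sum u m (shift n \<omega>) \<le> real K"
      using shift by (auto simp: B_def)
    have "partial_sum u m \<omega> \<le> real (nat \<lceil>C * real n\<rceil> + K)" for m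
    proof -
      have le: "C * real n \<le> real (nat \<lceil>C * real n\<rceil>)"
        by (rule real_nat_ceiling_ge)
      show ?thesis
      proof (cases "m \<le> n")
        case True
        have "partial_sum u m \<omega> \<le> C * real m"
          using abs_partial_sum_le[where u = u and n = m and \<omega> = \<omega>, OF C(1)] by simp
        also have "\<dots> \<le> C * real n"
          using True C(2) by (intro mult_left_mono) auto
        finally show ?thesis
          using le by simp
      next
        case False
        then have "partial_sum u m \<omega> = partial_sum u n \<omega> + partial_sum u (m - n) (shift n \<omega>)"
          using partial_sum_add[of u n "m - n" \<omega>] by simp
        also have "\<dots> \<le> C * real n + real K"
          using abs_partial_sum_le[where u = u and n = n and \<omega> = \<omega>, OF C(1)] K[of "m - n"] by linarith
        finally show ?thesis
          using le by simp
      qed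
    qed
    then show ?thesis
      unfolding B_def by blast
  qed
  have "0 < prob (B \<inter> D)"
  proof (rule ccontr)
    assume "\<not> 0 < prob (B \<inter> D)"
    then have "prob (B \<inter> D) = 0"
      using measure_nonneg[of Q "B \<inter> D"] by simp
    moreover have "B \<inter> D \<in> sets Q"
      by (rule sets.Int[OF sets_B sets_D])
    ultimately have AE_B: "AE \<omega> in Q. \<omega> \<notin> B \<inter> D"
      by (subst (asm) prob_eq_0)
    define S where "S \<omega> = partial_sum u (\<tau> \<omega>) \<omega>" for \<omega>
    define \<theta> where "\<theta> \<omega> = shift (\<tau> \<omega>) \<omega>" for \<omega>
    \<comment> \<open>By \<open>running_max_le\<close>, an upper bound for the decrease of the
      running maximum under the block shift. It is dominated by
      \<open>C * real (\<tau> \<omega>)\<close> and equals \<open>S \<omega>\<close> once the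
      shifted maximum reaches twice that amount, because \<open>S \<omega>\<close> is at least
      \<open>- (C * real (\<tau> \<omega>))\<close>.\<close>
    define g where "g N \<omega> = max (C * real (\<tau> \<omega>) - running_max u N (\<theta> \<omega>)) (S \<omega>)" for N \<omega>
    have [measurable]: "S \<in> borel_measurable Q" "\<theta> \<in> measurable Q Q"
      unfolding S_def[abs_def] \<theta>_def[abs_def] by measurable
    have S_le: "\<bar>S \<omega>\<bar> \<le> C * real (\<tau> \<omega>)" for \<omega>
      unfolding S_def by (rule abs_partial_sum_le[OF C(1)])
    have int_C: "integrable Q (\<lambda>\<omega>. C * (indicator D \<omega> * real (\<tau> \<omega>)))"
      by (intro integrable_mult_right integrable_\<tau>)
    have meas_g: "(\<lambda>\<omega>. indicator D \<omega> * g N \<omega>) \<in> borel_measurable Q" for N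
      unfolding g_def by measurable
    have g_bound: "norm (indicator D \<omega> * g N \<omega>) \<le> C * (indicator D \<omega> * real (\<tau> \<omega>))" for N \<omega>
      using S_le[of \<omega>] running_max_nonneg[of u N "\<theta> \<omega>"] C(2)
      by (auto simp: g_def indicator_def abs_le_iff max_def)
    have int_g: "integrable Q (\<lambda>\<omega>. indicator D \<omega> * g N \<omega>)" for N
      by (rule Bochner_Integration.integrable_bound[OF int_C meas_g])
        (use g_bound in \<open>auto intro: order_trans[OF _ abs_ge_self]\<close>)
    have g_nonneg: "0 \<le> (\<integral>\<omega>. indicator D \<omega> * g N \<omega> \<partial>Q)" for N
    proof -
      obtain F where F: "\<And>\<omega>. running_max u N \<omega> = F (pre N \<omega>)"
        using running_max_pre by blast
      have bound: "\<bar>running_max u N \<omega>\<bar> \<le> C * real N" for \<omega>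
        using running_max_nonneg[of u N \<omega>] unfolding running_max_def
        by (auto intro!: Max.boundedI order_trans[OF order_trans[OF abs_ge_self abs_partial_sum_le[OF C(1)]]]
          mult_left_mono C(2))
      have int: "integrable Q (\<lambda>\<omega>. indicator D \<omega> * running_max u N (f \<omega>))" if [measurable]: "f \<in> measurable Q Q" for f
        by (rule integrable_const_bound[of _ "C * real N"])
          (use bound C(2) in \<open>auto simp: indicator_def\<close>)
      have int1: "integrable Q (\<lambda>\<omega>. indicator D \<omega> * running_max u N \<omega>)"
        using int[of "\<lambda>\<omega>. \<omega>"] by simp
      have int2: "integrable Q (\<lambda>\<omega>. indicator D \<omega> * running_max u N (\<theta> \<omega>))"
        by (rule int) measurable
      have "(\<integral>\<omega>. indicator D \<omega> * running_max u N (\<theta> \<omega>) \<partial>Q) = (\<integral>\<omega>. indicator D \<omega> * running_max u N \<omega> \<partial>Q)"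
        unfolding F \<theta>_def by (rule integral_block_shift)
      then have "0 = (\<integral>\<omega>. indicator D \<omega> * running_max u N \<omega> - indicator D \<omega> * running_max u N (\<theta> \<omega>) \<partial>Q)"
        using int1 int2 by simp
      also have "\<dots> \<le> (\<integral>\<omega>. indicator D \<omega> * g N \<omega> \<partial>Q)"
      proof (rule integral_mono)
        show "integrable Q (\<lambda>\<omega>. indicator D \<omega> * running_max u N \<omega> - indicator D \<omega> * running_max u N (\<theta> \<omega>))"
          using int1 int2 by simp
        show "indicator D \<omega> * running_max u N \<omega> - indicator D \<omega> * running_max u N (\<theta> \<omega>) \<le> indicator D \<omega> * g N \<omega>" for \<omega>
          using running_max_le[where u = u and n = "\<tau> \<omega>" and N = N and \<omega> = \<omega>, OF C]
          by (auto simp: g_def S_def \<theta>_def indicator_def max_def split: if_splits)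
      qed (rule int_g)
      finally show ?thesis .
    qed
    have "(\<lambda>N. \<integral>\<omega>. indicator D \<omega> * g N \<omega> \<partial>Q) \<longlonglongrightarrow> (\<integral>\<omega>. indicator D \<omega> * S \<omega> \<partial>Q)"
    proof (rule integral_dominated_convergence[OF _ _ int_C])
      show "AE \<omega> in Q. (\<lambda>N. indicator D \<omega> * g N \<omega>) \<longlonglongrightarrow> indicator D \<omega> * S \<omega>"
        using AE_B
      proof eventually_elim
        fix \<omega> assume \<omega>: "\<omega> \<notin> B \<inter> D"
        show "(\<lambda>N. indicator D \<omega> * g N \<omega>) \<longlonglongrightarrow> indicator D \<omega> * S \<omega>"
        proof (cases "\<omega> \<in> D")
          case True
          then have "\<theta> \<omega> \<notin> B"
            using \<omega> B_shift by (auto simp: \<theta>_def)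
          then obtain n where n: "real (nat \<lceil>2 * C * real (\<tau> \<omega>)\<rceil>) < partial_sum u n (\<theta> \<omega>)"
            by (auto simp: B_def not_le)
          have "g N \<omega> = S \<omega>" if "n \<le> N" for N
          proof -
            have "2 * C * real (\<tau> \<omega>) \<le> running_max u N (\<theta> \<omega>)"
              using n partial_sum_le_running_max[OF that, of u "\<theta> \<omega>"]
                real_nat_ceiling_ge[of "2 * C * real (\<tau> \<omega>)"] by linarith
            then show ?thesis
              using S_le[of \<omega>] by (simp add: g_def)
          qed
          then have "\<forall>\<^sub>F N in sequentially. indicator D \<omega> * g N \<omega> = indicator D \<omega> * S \<omega>"
            by (intro eventually_sequentiallyI[of n]) simp
          then show ?thesis
            by (rule tendsto_eventually)
        qed simp
      qed
      show "AE \<omega> in Q. norm (indicator D \<omega> * g N \<omega>) \<le> C * (indicator D \<omega> * real (\<tau> \<omega>))" for N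
        using g_bound by simp
    qed (use meas_g in measurable)
    then have "0 \<le> (\<integral>\<omega>. indicator D \<omega> * S \<omega> \<partial>Q)"
      by (rule LIMSEQ_le_const) (use g_nonneg in auto)
    then show False
      using neg by (simp add: S_def)
  qed
  then have "prob B = 1"
    by (rule prob_eq_1_regeneration[OF sets_B _ sets_B, of 0]) (use B_shift in auto)
  then show ?thesis
    using sets_B by (subst (asm) prob_eq_1) (auto simp: B_def)
qed

section \<open>The speed and its bounds\<close>

definition mean_\<tau> :: real where
  "mean_\<tau> = (\<integral>\<omega>. indicator D \<omega> * real (\<tau> \<omega>) \<partial>Q)"

lemma mean_\<tau>_pos: "0 < mean_\<tau>"
proof -
  have "prob D = (\<integral>\<omega>. indicator D \<omega> \<partial>Q)"
    by simp
  also have "\<dots> \<le> mean_\<tau>"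
    unfolding mean_\<tau>_def
  proof (rule integral_mono_AE)
    show "AE \<omega> in Q. indicator D \<omega> \<le> indicator D \<omega> * real (\<tau> \<omega>)"
      using AE_regen by eventually_elim (use \<tau>(1) in \<open>force simp: indicator_def\<close>)
    show "integrable Q (indicator D :: _ \<Rightarrow> real)"
      by (intro integrable_real_indicator) (auto simp: less_top[symmetric])
  qed (rule integrable_\<tau>)
  finally show ?thesis
    using prob_D_pos by simp
qed

text \<open>Mean gain over mean duration of a block, as for a renewal reward process. Both integrals
  are over \<open>D\<close> without normalisation, since the factor \<open>prob D\<close>
  cancels.\<close>

definition speed :: "('k \<Rightarrow> real) \<Rightarrow> real" where
  "speed u = (\<integral>\<omega>. indicator D \<omega> * partial_sum u (\<tau> \<omega>) \<omega> \<partial>Q) / mean_\<tau>"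

text \<open>Subtracting \<open>c\<close> from every step makes the mean over a block negative, so
  the maximal inequality bounds the centred sums.\<close>

lemma AE_limsup_le_speed:
  assumes "speed u < c"
  shows "AE \<omega> in Q. \<exists>K::nat. \<forall>n. partial_sum u n \<omega> \<le> c * real n + real K"
proof -
  have eq: "partial_sum (\<lambda>k. u k - c) n \<omega> = partial_sum u n \<omega> - c * real n" for n and \<omega> :: "nat \<Rightarrow> 'k"
    by (simp add: partial_sum_def sum_subtractf)
  have "(\<integral>\<omega>. indicator D \<omega> * partial_sum (\<lambda>k. u k - c) (\<tau> \<omega>) \<omega> \<partial>Q) =
      (\<integral>\<omega>. indicator D \<omega> * partial_sum u (\<tau> \<omega>) \<omega> - c * (indicator D \<omega> * real (\<tau> \<omega>)) \<partial>Q)"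
    unfolding eq by (intro Bochner_Integration.integral_cong) (auto simp: algebra_simps)
  also have "\<dots> = (\<integral>\<omega>. indicator D \<omega> * partial_sum u (\<tau> \<omega>) \<omega> \<partial>Q) - c * mean_\<tau>"
    using integrable_partial_sum_\<tau>[of u] integrable_\<tau> by (simp add: mean_\<tau>_def)
  also have "\<dots> < 0"
    using assms mean_\<tau>_pos by (simp add: speed_def field_simps)
  finally have "AE \<omega> in Q. \<exists>K::nat. \<forall>n. partial_sum (\<lambda>k. u k - c) n \<omega> \<le> real K"
    by (rule AE_partial_sum_bounded)
  then show ?thesis
    unfolding eq by (simp add: algebra_simps)
qed

lemma speed_uminus: "speed (\<lambda>k. - u k) = - speed u"
  by (simp add: speed_def partial_sum_def sum_negf)

theorem law_of_large_numbers: "AE \<omega> in Q. (\<lambda>n. partial_sum u n \<omega> / real n) \<longlonglongrightarrow> speed u"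
proof -
  have "AE \<omega> in Q. \<forall>j::nat. \<exists>K::nat. \<forall>n. partial_sum u n \<omega> \<le> (speed u + 1 / real (Suc j)) * real n + real K"
    unfolding AE_all_countable by (intro allI AE_limsup_le_speed) simp
  \<comment> \<open>The lower bound is the upper bound for the negated function, whose speed is the
    negative one.\<close>
  moreover have "AE \<omega> in Q. \<forall>j::nat. \<exists>K::nat. \<forall>n. partial_sum (\<lambda>k. - u k) n \<omega> \<le> (- speed u + 1 / real (Suc j)) * real n + real K"
    unfolding AE_all_countable by (intro allI AE_limsup_le_speed) (simp add: speed_uminus)
  ultimately show ?thesis
  proof eventually_elim
    fix \<omega>
    assume up: "\<forall>j::nat. \<exists>K::nat. \<forall>n. partial_sum u n \<omega> \<le> (speed u + 1 / real (Suc j)) * real n + real K"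
      and lo: "\<forall>j::nat. \<exists>K::nat. \<forall>n. partial_sum (\<lambda>k. - u k) n \<omega> \<le> (- speed u + 1 / real (Suc j)) * real n + real K"
    show "(\<lambda>n. partial_sum u n \<omega> / real n) \<longlonglongrightarrow> speed u"
    proof (rule LIMSEQ_I)
      fix \<epsilon> :: real assume \<epsilon>: "0 < \<epsilon>"
      obtain j where j: "1 / real (Suc j) < \<epsilon> / 2"
        using nat_approx_posE[of "\<epsilon> / 2"] \<epsilon> by auto
      obtain K1 :: nat where K1: "\<And>n. partial_sum u n \<omega> \<le> (speed u + 1 / real (Suc j)) * real n + real K1"
        using up by blast
      obtain K2 :: nat where K2: "\<And>n. - partial_sum u n \<omega> \<le> (- speed u + 1 / real (Suc j)) * real n + real K2"
        using lo by (auto simp: partial_sum_def sum_negf)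
      define K where "K = max (real K1) (real K2)"
      obtain N :: nat where N: "K / (\<epsilon> / 2) < real N"
        using reals_Archimedean2 by blast
      show "\<exists>no. \<forall>n\<ge>no. norm (partial_sum u n \<omega> / real n - speed u) < \<epsilon>"
      proof (intro exI allI impI)
        fix n assume n: "Suc N \<le> n"
        have "\<bar>partial_sum u n \<omega> - speed u * real n\<bar> \<le> 1 / real (Suc j) * real n + K"
        proof -
          have "real K1 \<le> K" "real K2 \<le> K"
            by (simp_all add: K_def)
          then show ?thesis
            using K1[of n] K2[of n] by (simp add: abs_le_iff algebra_simps)
        qed
        also have "\<dots> < \<epsilon> / 2 * real n + \<epsilon> / 2 * real n"
        proof (rule add_strict_mono)
          show "1 / real (Suc j) * real n < \<epsilon> / 2 * real n"
            using j n by (intro mult_strict_right_mono) auto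
          have "K < \<epsilon> / 2 * real N"
            using N \<epsilon> by (simp add: field_simps)
          also have "\<dots> \<le> \<epsilon> / 2 * real n"
            using n \<epsilon> by (intro mult_left_mono) auto
          finally show "K < \<epsilon> / 2 * real n" .
        qed
        also have "\<dots> = \<epsilon> * real n"
          by simp
        finally have "\<bar>partial_sum u n \<omega> - speed u * real n\<bar> / real n < \<epsilon>"
          using n by (simp add: divide_less_eq)
        moreover have "norm (partial_sum u n \<omega> / real n - speed u) = \<bar>partial_sum u n \<omega> - speed u * real n\<bar> / real n"
          using n by (simp add: field_simps)
        ultimately show "norm (partial_sum u n \<omega> / real n - speed u) < \<epsilon>"
          by simp
      qed
    qed
  qed
qed

text \<open>The Kalikow estimate on the whole space: nothing is ever left, so the occupation time up
  to \<open>N\<close> is \<open>N\<close>.\<close>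

lemma expectation_steps:
  "(\<alpha> k - 1) * real N \<le> (sum \<alpha> UNIV - 1) * (\<Sum>t<N. prob {\<omega>. \<omega> t = k})"
  "(sum \<alpha> UNIV - 1) * (\<Sum>t<N. prob {\<omega>. \<omega> t = k}) \<le> \<alpha> k * real N"
proof -
  have ind: "(\<lambda>\<omega>. of_bool (\<omega> t = k) :: real) = indicator {\<omega>. \<omega> t = k}" for t
    by (auto simp: indicator_def)
  have 1: "(\<Sum>t<N. \<integral>\<omega>. of_bool (alive UNIV (pre t \<omega>)) * 1 \<partial>Q) = real N"
    by (simp add: alive_def prob_space[simplified])
  have 2: "(\<Sum>t<N. \<integral>\<omega>. of_bool (alive UNIV (pre t \<omega>)) * 1 * of_bool (\<omega> t = k) \<partial>Q) = (\<Sum>t<N. prob {\<omega>. \<omega> t = k})"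
    by (simp add: alive_def ind)
  show "(\<alpha> k - 1) * real N \<le> (sum \<alpha> UNIV - 1) * (\<Sum>t<N. prob {\<omega>. \<omega> t = k})"
    "(sum \<alpha> UNIV - 1) * (\<Sum>t<N. prob {\<omega>. \<omega> t = k}) \<le> \<alpha> k * real N"
    using kalikow_weighted[where c = "\<lambda>_. 1" and k = k and N = N and U = UNIV] unfolding 1 2 by simp_all
qed

text \<open>Dominated convergence identifies the speed with the limit of the mean displacement per
  step, and \<open>expectation_steps\<close> controls these means for every \<open>N\<close>. The
  steps \<open>a\<close> and \<open>b\<close> can be any two, so every axis is covered.\<close>

lemma speed_bounds:
  assumes ab: "a \<noteq> b"
  defines "u \<equiv> \<lambda>k. of_bool (k = a) - of_bool (k = b)"
  shows "(\<alpha> a - \<alpha> b - 1) / (sum \<alpha> UNIV - 1) \<le> speed u" "speed u \<le> (\<alpha> a - \<alpha> b + 1) / (sum \<alpha> UNIV - 1)"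
proof -
  have A: "0 < sum \<alpha> UNIV - 1"
    using sum_\<alpha>_gt_1 by simp
  have sets_step: "{\<omega>. \<omega> t = k} \<in> sets Q" for t k
    using sets_pre[of "\<lambda>w. w ! t = k" "Suc t"] by simp
  have u: "\<bar>u k\<bar> \<le> 1" for k
    by (auto simp: u_def)
  define m where "m N = (\<Sum>t<N. prob {\<omega>. \<omega> t = a}) - (\<Sum>t<N. prob {\<omega>. \<omega> t = b})" for N
  have m: "(\<integral>\<omega>. partial_sum u N \<omega> / real N \<partial>Q) = m N / real N" for N
  proof -
    have ind: "integrable Q (indicator {\<omega>. \<omega> t = k} :: _ \<Rightarrow> real)" for t k
      using sets_step by (intro integrable_real_indicator) (auto simp: less_top[symmetric])
    have "(\<integral>\<omega>. partial_sum u N \<omega> \<partial>Q) =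
        (\<integral>\<omega>. (\<Sum>t<N. indicator {\<omega>. \<omega> t = a} \<omega> - indicator {\<omega>. \<omega> t = b} \<omega>) \<partial>Q)"
      by (intro Bochner_Integration.integral_cong refl)
        (auto simp: partial_sum_def u_def indicator_def intro!: sum.cong)
    also have "\<dots> = m N"
      using ind by (subst Bochner_Integration.integral_sum) (auto simp: m_def sum_subtractf)
    finally show ?thesis
      by simp
  qed
  have "(\<lambda>N. \<integral>\<omega>. partial_sum u N \<omega> / real N \<partial>Q) \<longlonglongrightarrow> (\<integral>\<omega>. speed u \<partial>Q)"
  proof (rule integral_dominated_convergence[where w = "\<lambda>_. 1"])
    show "AE \<omega> in Q. norm (partial_sum u N \<omega> / real N) \<le> 1" for N
    proof (rule AE_I2)
      fix \<omega>
      show "norm (partial_sum u N \<omega> / real N) \<le> 1"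
        using abs_partial_sum_le[where u = u and n = N and \<omega> = \<omega>, OF u] by (cases "N = 0") (auto simp: divide_le_eq)
    qed
  qed (use law_of_large_numbers in simp_all)
  then have lim: "(\<lambda>N. m N / real N) \<longlonglongrightarrow> speed u"
    using prob_space by (simp only: m) simp
  have le: "(\<alpha> a - \<alpha> b - 1) * real N \<le> (sum \<alpha> UNIV - 1) * m N"
    "(sum \<alpha> UNIV - 1) * m N \<le> (\<alpha> a - \<alpha> b + 1) * real N" for N
    using expectation_steps[of a N] expectation_steps[of b N] by (simp_all add: m_def algebra_simps)
  show "(\<alpha> a - \<alpha> b - 1) / (sum \<alpha> UNIV - 1) \<le> speed u"
  proof (rule LIMSEQ_le_const[OF lim], intro exI allI impI)
    fix N :: nat assume "1 \<le> N"
    then show "(\<alpha> a - \<alpha> b - 1) / (sum \<alpha> UNIV - 1) \<le> m N / real N"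
      using le(1)[of N] A by (simp add: divide_simps mult.commute)
  qed
  show "speed u \<le> (\<alpha> a - \<alpha> b + 1) / (sum \<alpha> UNIV - 1)"
  proof (rule LIMSEQ_le_const2[OF lim], intro exI allI impI)
    fix N :: nat assume "1 \<le> N"
    then show "m N / real N \<le> (\<alpha> a - \<alpha> b + 1) / (sum \<alpha> UNIV - 1)"
      using le(2)[of N] A by (simp add: divide_simps mult.commute)
  qed
qed

end

section \<open>Dirichlet integrals\<close>

lemma Beta_real_nonneg: "0 < a \<Longrightarrow> 0 < b \<Longrightarrow> 0 \<le> Beta a (b :: real)"
  unfolding Beta_def by (intro divide_nonneg_nonneg mult_nonneg_nonneg Gamma_real_nonneg) auto

lemma nn_integral_Beta_scaled:
  fixes a b s :: real
  assumes "0 < a" "0 < b" "0 < s"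
  shows "(\<integral>\<^sup>+y. ennreal (indicator {0<..<s} y * (y powr (a - 1) * (s - y) powr (b - 1))) \<partial>lborel) =
    ennreal (Beta a b * s powr (a + b - 1))"
proof -
  define f where "f y = indicator {0<..<1} y * (y powr (a - 1) * (1 - y) powr (b - 1))" for y :: real
  have f [measurable]: "f \<in> borel_measurable borel"
    unfolding f_def by measurable
  have f_nonneg: "0 \<le> f y" for y
    by (simp add: f_def)
  have "(\<integral>\<^sup>+y. ennreal (f y) \<partial>lborel) =
      (\<integral>\<^sup>+y. ennreal (indicator {0..1} y * (y powr (a - 1) * (1 - y) powr (b - 1))) \<partial>lborel)"
    by (intro nn_integral_cong) (auto simp: f_def indicator_def)
  also have "\<dots> = ennreal (Beta a b)"
    by (rule nn_integral_has_integral_lebesgue[OF _ has_integral_Beta_real]) (use assms in auto)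
  finally have 1: "(\<integral>\<^sup>+y. ennreal (f y) \<partial>lborel) = ennreal (Beta a b)" .
  have "(\<integral>\<^sup>+y. ennreal (indicator {0<..<s} y * (y powr (a - 1) * (s - y) powr (b - 1))) \<partial>lborel) =
      ennreal \<bar>s\<bar> * (\<integral>\<^sup>+y. ennreal (indicator {0<..<s} (0 + s * y) *
        ((0 + s * y) powr (a - 1) * (s - (0 + s * y)) powr (b - 1))) \<partial>lborel)"
    using assms by (intro nn_integral_real_affine) auto
  also have "(\<integral>\<^sup>+y. ennreal (indicator {0<..<s} (0 + s * y) *
        ((0 + s * y) powr (a - 1) * (s - (0 + s * y)) powr (b - 1))) \<partial>lborel) =
      (\<integral>\<^sup>+y. ennreal (s powr (a + b - 2)) * ennreal (f y) \<partial>lborel)"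
  proof (intro nn_integral_cong)
    fix y :: real
    show "ennreal (indicator {0<..<s} (0 + s * y) * ((0 + s * y) powr (a - 1) * (s - (0 + s * y)) powr (b - 1))) =
        ennreal (s powr (a + b - 2)) * ennreal (f y)"
    proof (cases "0 < y \<and> y < 1")
      case True
      have "s - s * y = s * (1 - y)"
        by (simp add: algebra_simps)
      then have "(s * y) powr (a - 1) * (s - s * y) powr (b - 1) =
          (s powr (a - 1) * s powr (b - 1)) * (y powr (a - 1) * (1 - y) powr (b - 1))"
        using True assms by (simp add: powr_mult)
      also have "s powr (a - 1) * s powr (b - 1) = s powr (a + b - 2)"
        by (simp add: powr_add[symmetric])
      finally show ?thesis
        using True assms by (simp add: f_def ennreal_mult[symmetric])
    next
      case False
      then have "\<not> (0 < s * y \<and> s * y < s)"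
        using assms by (auto simp: zero_less_mult_iff)
      then show ?thesis
        using False by (auto simp: f_def indicator_def)
    qed
  qed
  also have "\<dots> = ennreal (s powr (a + b - 2)) * ennreal (Beta a b)"
    by (subst nn_integral_cmult) (auto simp: 1)
  also have "ennreal \<bar>s\<bar> * \<dots> = ennreal (Beta a b * (s * s powr (a + b - 2)))"
    using assms by (simp add: ennreal_mult[symmetric] Beta_real_nonneg ac_simps)
  also have "s * s powr (a + b - 2) = s powr (a + b - 1)"
    using assms powr_add[of s 1 "a + b - 2"] by simp
  finally show ?thesis .
qed

text \<open>Coordinates are integrated out one at a time. With the others fixed, the new one ranges
  over an interval whose length is the remaining mass, and the Beta integral replaces the parameter
  \<open>b\<close> of that mass by \<open>a i + b\<close>; this is why \<open>b\<close> is general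
  in the induction. The Gamma factors telescope.\<close>

lemma dirichlet_integral:
  fixes a :: "'i \<Rightarrow> real"
  assumes "finite J" "\<And>i. i \<in> J \<Longrightarrow> 0 < a i" "0 < b"
  shows "(\<integral>\<^sup>+x. ennreal (of_bool ((\<forall>i\<in>J. 0 < x i) \<and> (\<Sum>i\<in>J. x i) < 1) *
      ((\<Prod>i\<in>J. x i powr (a i - 1)) * (1 - (\<Sum>i\<in>J. x i)) powr (b - 1))) \<partial>(\<Pi>\<^sub>M i\<in>J. lborel)) =
    ennreal ((\<Prod>i\<in>J. Gamma (a i)) * Gamma b / Gamma ((\<Sum>i\<in>J. a i) + b))"
  using assms
proof (induction J arbitrary: b rule: finite_induct)
  case empty
  then have "Gamma b \<noteq> 0"
    using Gamma_real_pos[of b] by (metis less_irrefl)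
  then show ?case
    by (simp add: nn_integral_count_space_finite PiM_empty)
next
  case (insert i J)
  interpret product_sigma_finite "\<lambda>_::'i. lborel :: real measure"
    by standard
  define F where "F = (\<lambda>I b (x :: 'i \<Rightarrow> real). of_bool ((\<forall>i\<in>I. 0 < x i) \<and> (\<Sum>i\<in>I. x i) < 1) *
      ((\<Prod>i\<in>I. x i powr (a i - 1)) * (1 - (\<Sum>i\<in>I. x i)) powr (b - 1)))"
  have F_nonneg: "0 \<le> F I b x" for I b x
    by (auto simp: F_def intro!: mult_nonneg_nonneg prod_nonneg)
  have meas: "(\<lambda>x. ennreal (F I b x)) \<in> borel_measurable (\<Pi>\<^sub>M i\<in>I. lborel)" if "finite I" for I b
  proof -
    have [measurable]: "Measurable.pred (\<Pi>\<^sub>M i\<in>I. lborel) (\<lambda>x. (\<forall>i\<in>I. 0 < x i) \<and> (\<Sum>i\<in>I. x i) < (1::real))"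
      using that by measurable
    show ?thesis
      unfolding F_def by measurable
  qed
  have ai: "0 < a i" and b: "0 < b"
    using insert.prems by auto
  have inner: "(\<integral>\<^sup>+y. ennreal (F (insert i J) b (x(i := y))) \<partial>lborel) =
      ennreal (Beta (a i) b) * ennreal (F J (a i + b) x)" for x
  proof -
    define s where "s = 1 - (\<Sum>j\<in>J. x j)"
    define P where "P = (\<Prod>j\<in>J. x j powr (a j - 1))"
    have upd: "(\<Sum>j\<in>J. (x(i := y)) j) = 1 - s" "(\<Prod>j\<in>J. (x(i := y)) j powr (a j - 1)) = P"
      "(\<forall>j\<in>J. 0 < (x(i := y)) j) \<longleftrightarrow> (\<forall>j\<in>J. 0 < x j)" for y
      using insert.hyps by (auto simp: s_def P_def intro!: sum.cong prod.cong)
    have Fi: "F (insert i J) b (x(i := y)) =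
        of_bool (\<forall>j\<in>J. 0 < x j) * P * (of_bool (0 < y \<and> y < s) * (y powr (a i - 1) * (s - y) powr (b - 1)))" for y
      using insert.hyps unfolding F_def
      by (simp add: upd del: fun_upd_apply) (auto simp: algebra_simps)
    have FJ: "F J (a i + b) x = of_bool (\<forall>j\<in>J. 0 < x j) * P * (of_bool (0 < s) * s powr (a i + b - 1))"
      by (auto simp: F_def s_def P_def)
    have P: "0 \<le> of_bool (\<forall>j\<in>J. 0 < x j) * P"
      by (auto simp: P_def intro!: prod_nonneg)
    have comm: "ennreal u * ennreal (v * w) = ennreal v * ennreal (u * w)"
      if "0 \<le> u" "0 \<le> v" "0 \<le> w" for u v w :: real
      using that by (simp add: ennreal_mult mult.left_commute)
    have "(\<integral>\<^sup>+y. ennreal (F (insert i J) b (x(i := y))) \<partial>lborel) =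
        (\<integral>\<^sup>+y. ennreal (of_bool (\<forall>j\<in>J. 0 < x j) * P) *
          ennreal (indicator {0<..<s} y * (y powr (a i - 1) * (s - y) powr (b - 1))) \<partial>lborel)"
      unfolding Fi using P by (intro nn_integral_cong, subst ennreal_mult[symmetric]) (auto simp: indicator_def)
    also have "\<dots> = ennreal (of_bool (\<forall>j\<in>J. 0 < x j) * P) *
        (\<integral>\<^sup>+y. ennreal (indicator {0<..<s} y * (y powr (a i - 1) * (s - y) powr (b - 1))) \<partial>lborel)"
      by (intro nn_integral_cmult) measurable
    also have "(\<integral>\<^sup>+y. ennreal (indicator {0<..<s} y * (y powr (a i - 1) * (s - y) powr (b - 1))) \<partial>lborel) =
        ennreal (Beta (a i) b * (of_bool (0 < s) * s powr (a i + b - 1)))"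
    proof (cases "0 < s")
      case True
      then show ?thesis
        using nn_integral_Beta_scaled[OF ai b True] by simp
    next
      case False
      then have "{0<..<s} = {}"
        by auto
      then show ?thesis
        using False by simp
    qed
    also have "ennreal (of_bool (\<forall>j\<in>J. 0 < x j) * P) * \<dots> = ennreal (Beta (a i) b) * ennreal (F J (a i + b) x)"
      unfolding FJ by (rule comm) (use P ai b in \<open>auto intro: Beta_real_nonneg\<close>)
    finally show ?thesis .
  qed
  have "(\<integral>\<^sup>+x. ennreal (F (insert i J) b x) \<partial>(\<Pi>\<^sub>M i\<in>insert i J. lborel)) =
      (\<integral>\<^sup>+x. \<integral>\<^sup>+y. ennreal (F (insert i J) b (x(i := y))) \<partial>lborel \<partial>(\<Pi>\<^sub>M i\<in>J. lborel))"
    using insert.hyps by (intro product_nn_integral_insert meas) auto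
  also have "\<dots> = ennreal (Beta (a i) b) * (\<integral>\<^sup>+x. ennreal (F J (a i + b) x) \<partial>(\<Pi>\<^sub>M i\<in>J. lborel))"
    unfolding inner using insert.hyps by (intro nn_integral_cmult meas)
  also have "(\<integral>\<^sup>+x. ennreal (F J (a i + b) x) \<partial>(\<Pi>\<^sub>M i\<in>J. lborel)) =
      ennreal ((\<Prod>i\<in>J. Gamma (a i)) * Gamma (a i + b) / Gamma ((\<Sum>i\<in>J. a i) + (a i + b)))"
    unfolding F_def using insert.prems ai b by (intro insert.IH) (auto intro: add_pos_pos)
  also have "ennreal (Beta (a i) b) * \<dots> =
      ennreal (Beta (a i) b * ((\<Prod>i\<in>J. Gamma (a i)) * Gamma (a i + b) / Gamma ((\<Sum>i\<in>J. a i) + (a i + b))))"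
  proof (rule ennreal_mult[symmetric])
    show "0 \<le> Beta (a i) b"
      using ai b by (rule Beta_real_nonneg)
    have "0 \<le> (\<Sum>i\<in>J. a i)"
      using insert.prems by (intro sum_nonneg) (auto intro: less_imp_le)
    then have "0 < a i + b" "0 < (\<Sum>i\<in>J. a i) + (a i + b)"
      using ai b by linarith+
    then show "0 \<le> (\<Prod>i\<in>J. Gamma (a i)) * Gamma (a i + b) / Gamma ((\<Sum>i\<in>J. a i) + (a i + b))"
      using insert.prems
      by (intro divide_nonneg_nonneg mult_nonneg_nonneg prod_nonneg Gamma_real_nonneg) (auto intro: less_imp_le)
  qed
  also have "Beta (a i) b * ((\<Prod>i\<in>J. Gamma (a i)) * Gamma (a i + b) / Gamma ((\<Sum>i\<in>J. a i) + (a i + b))) =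
      (\<Prod>i\<in>insert i J. Gamma (a i)) * Gamma b / Gamma ((\<Sum>i\<in>insert i J. a i) + b)"
  proof -
    have "Gamma (a i + b) \<noteq> 0"
      using Gamma_real_pos[of "a i + b"] ai b by (metis add_pos_pos less_irrefl)
    then show ?thesis
      using insert.hyps by (simp add: Beta_def ac_simps)
  qed
  finally show ?case
    by (simp only: F_def)
qed

lemma sets_prob_simplex: "(prob_simplex :: ('k::finite \<Rightarrow> real) set) \<in> sets (\<Pi>\<^sub>M k\<in>UNIV. borel)"
proof -
  have "{x \<in> space (\<Pi>\<^sub>M k\<in>(UNIV::'k set). borel). (\<forall>k\<in>UNIV. 0 < x k \<and> x k \<le> 1) \<and> (\<Sum>k\<in>UNIV. x k) = (1::real)} \<in>
      sets (\<Pi>\<^sub>M k\<in>UNIV. borel)"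
    by measurable
  then show ?thesis
    by (simp add: prob_simplex_def space_PiM)
qed

text \<open>Multiplying the density by a monomial shifts the parameters to
  \<open>\<alpha> k + N k\<close>; the quotient of the two normalising constants is a quotient of
  Pochhammer symbols.\<close>

lemma nn_integral_dirichlet_monomial:
  fixes \<alpha> :: "'k::finite \<Rightarrow> real" and N :: "'k \<Rightarrow> nat"
  assumes \<alpha>: "\<And>k. 0 < \<alpha> k"
  shows "(\<integral>\<^sup>+x. ennreal (\<Prod>k\<in>UNIV. x k ^ N k) \<partial>dirichlet \<alpha>) = ennreal (urn_weight \<alpha> N)"
proof -
  define l :: 'k where "l = (SOME l. True)"
  define J where "J = UNIV - {l}"
  have J: "finite J" "l \<notin> J" "UNIV = insert l J"
    by (auto simp: J_def)
  define a where "a k = \<alpha> k + real (N k)" for k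
  have a: "0 < a k" for k
    using \<alpha>[of k] by (simp add: a_def)
  define c where "c = Gamma (\<Sum>k\<in>UNIV. \<alpha> k) / (\<Prod>k\<in>UNIV. Gamma (\<alpha> k))"
  have sum_\<alpha>: "0 < sum \<alpha> UNIV" "0 < sum a UNIV"
    using \<alpha> a by (auto intro!: sum_pos)
  have c: "0 \<le> c"
    using \<alpha> sum_\<alpha> unfolding c_def
    by (intro divide_nonneg_nonneg prod_nonneg Gamma_real_nonneg) (auto intro: less_imp_le)
  define g where "g x = ennreal (c * (\<Prod>k\<in>UNIV. x k powr (\<alpha> k - 1)))" for x
  define h where "h x = ennreal (\<Prod>k\<in>UNIV. x k ^ N k)" for x :: "'k \<Rightarrow> real"
  define \<phi> where "\<phi> x = x(l := 1 - (\<Sum>k\<in>J. x k))" for x :: "'k \<Rightarrow> real"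
  have [measurable]: "\<phi> \<in> measurable (\<Pi>\<^sub>M k\<in>J. lborel) (\<Pi>\<^sub>M k\<in>UNIV. borel)"
    unfolding \<phi>_def[abs_def] J_def by (rule measurable_hyperplane_map)
  have [measurable]: "g \<in> borel_measurable (\<Pi>\<^sub>M k\<in>UNIV. borel)" "h \<in> borel_measurable (\<Pi>\<^sub>M k\<in>UNIV. borel)"
    unfolding g_def[abs_def] h_def[abs_def] by measurable
  note sets_prob_simplex [measurable]
  have S: "prob_simplex \<inter> space (hyperplane_lebesgue l) \<in> sets (hyperplane_lebesgue l)"
    using sets_prob_simplex by simp
  have meas: "f \<in> borel_measurable (restrict_space (hyperplane_lebesgue l) prob_simplex)"
    if "f \<in> borel_measurable (\<Pi>\<^sub>M k\<in>UNIV. borel)" for f :: "('k \<Rightarrow> real) \<Rightarrow> ennreal"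
    using that by (intro measurable_restrict_space1) (simp cong: measurable_cong_sets add: hyperplane_lebesgue_def)
  have "(\<integral>\<^sup>+x. h x \<partial>dirichlet \<alpha>) = (\<integral>\<^sup>+x. g x * h x \<partial>restrict_space (hyperplane_lebesgue l) prob_simplex)"
    unfolding dirichlet_def l_def[symmetric] g_def[symmetric] c_def[symmetric]
    by (rule nn_integral_density) (auto intro!: meas)
  also have "\<dots> = (\<integral>\<^sup>+x. g x * h x * indicator prob_simplex x \<partial>hyperplane_lebesgue l)"
    by (rule nn_integral_restrict_space[OF S])
  also have "\<dots> = (\<integral>\<^sup>+x. g (\<phi> x) * h (\<phi> x) * indicator prob_simplex (\<phi> x) \<partial>(\<Pi>\<^sub>M k\<in>J. lborel))"
    unfolding hyperplane_lebesgue_def J_def[symmetric] \<phi>_def[symmetric]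
    by (rule nn_integral_distr) measurable
  also have "\<dots> = (\<integral>\<^sup>+x. ennreal c * ennreal (of_bool ((\<forall>i\<in>J. 0 < x i) \<and> (\<Sum>i\<in>J. x i) < 1) *
      ((\<Prod>i\<in>J. x i powr (a i - 1)) * (1 - (\<Sum>i\<in>J. x i)) powr (a l - 1))) \<partial>(\<Pi>\<^sub>M k\<in>J. lborel))"
  proof (rule nn_integral_cong)
    fix x :: "'k \<Rightarrow> real"
    have \<phi>: "\<phi> x k = (if k = l then 1 - (\<Sum>k\<in>J. x k) else x k)" for k
      by (simp add: \<phi>_def)
    have sum_\<phi>: "(\<Sum>k\<in>UNIV. \<phi> x k) = 1"
    proof -
      have "(\<Sum>k\<in>J. \<phi> x k) = (\<Sum>k\<in>J. x k)"
        using J by (intro sum.cong) (auto simp: \<phi>)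
      then show ?thesis
        unfolding J(3) using J(1,2) by (simp add: \<phi>)
    qed
    \<comment> \<open>Positive coordinates with sum 1 are automatically at most 1, so the upper
      bounds in \<open>prob_simplex\<close> follow.\<close>
    have simplex: "\<phi> x \<in> prob_simplex \<longleftrightarrow> (\<forall>i\<in>J. 0 < x i) \<and> (\<Sum>i\<in>J. x i) < 1"
    proof -
      have "\<phi> x k \<le> 1" if "\<And>k. 0 < \<phi> x k" for k
        using member_le_sum[of k UNIV "\<phi> x"] that by (auto simp: sum_\<phi> intro: less_imp_le)
      then have "\<phi> x \<in> prob_simplex \<longleftrightarrow> (\<forall>k\<in>insert l J. 0 < \<phi> x k)"
        unfolding J(3)[symmetric] by (auto simp: prob_simplex_def sum_\<phi>)
      also have "\<dots> \<longleftrightarrow> (\<forall>i\<in>J. 0 < x i) \<and> (\<Sum>i\<in>J. x i) < 1"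
        using J(2) by (auto simp: \<phi>)
      finally show ?thesis .
    qed
    show "g (\<phi> x) * h (\<phi> x) * indicator prob_simplex (\<phi> x) =
        ennreal c * ennreal (of_bool ((\<forall>i\<in>J. 0 < x i) \<and> (\<Sum>i\<in>J. x i) < 1) *
          ((\<Prod>i\<in>J. x i powr (a i - 1)) * (1 - (\<Sum>i\<in>J. x i)) powr (a l - 1)))"
    proof (cases "\<phi> x \<in> prob_simplex")
      case True
      then have pos: "0 < \<phi> x k" for k
        by (simp add: prob_simplex_def)
      have "\<phi> x k powr (\<alpha> k - 1) * \<phi> x k ^ N k = \<phi> x k powr (a k - 1)" for k
        using pos[of k] by (simp add: powr_realpow[symmetric] powr_add[symmetric] a_def algebra_simps)
      then have "(\<Prod>k\<in>UNIV. \<phi> x k powr (\<alpha> k - 1)) * (\<Prod>k\<in>UNIV. \<phi> x k ^ N k) = (\<Prod>k\<in>UNIV. \<phi> x k powr (a k - 1))"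
        by (simp add: prod.distrib[symmetric])
      also have "\<dots> = \<phi> x l powr (a l - 1) * (\<Prod>k\<in>J. \<phi> x k powr (a k - 1))"
        unfolding J(3) using J(1,2) by (rule prod.insert)
      also have "(\<Prod>k\<in>J. \<phi> x k powr (a k - 1)) = (\<Prod>k\<in>J. x k powr (a k - 1))"
        using J(2) by (intro prod.cong) (auto simp: \<phi>)
      finally have *: "(\<Prod>k\<in>UNIV. \<phi> x k powr (\<alpha> k - 1)) * (\<Prod>k\<in>UNIV. \<phi> x k ^ N k) =
          (\<Prod>k\<in>J. x k powr (a k - 1)) * (1 - (\<Sum>i\<in>J. x i)) powr (a l - 1)"
        by (simp add: \<phi>)
      have "g (\<phi> x) * h (\<phi> x) = ennreal (c * ((\<Prod>k\<in>UNIV. \<phi> x k powr (\<alpha> k - 1)) * (\<Prod>k\<in>UNIV. \<phi> x k ^ N k)))"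
        unfolding g_def h_def using pos c
        by (subst ennreal_mult[symmetric]) (auto intro!: mult_nonneg_nonneg prod_nonneg simp: less_imp_le mult.assoc)
      also have "\<dots> = ennreal c * ennreal ((\<Prod>k\<in>J. x k powr (a k - 1)) * (1 - (\<Sum>i\<in>J. x i)) powr (a l - 1))"
        unfolding * using c by (intro ennreal_mult) (auto intro!: mult_nonneg_nonneg prod_nonneg)
      finally show ?thesis
        using True simplex by simp
    next
      case False
      then have "\<not> ((\<forall>i\<in>J. 0 < x i) \<and> (\<Sum>i\<in>J. x i) < 1)"
        using simplex by blast
      then show ?thesis
        by (simp only:) (simp add: False)
    qed
  qed
  also have "\<dots> = ennreal c * (\<integral>\<^sup>+x. ennreal (of_bool ((\<forall>i\<in>J. 0 < x i) \<and> (\<Sum>i\<in>J. x i) < 1) *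
      ((\<Prod>i\<in>J. x i powr (a i - 1)) * (1 - (\<Sum>i\<in>J. x i)) powr (a l - 1))) \<partial>(\<Pi>\<^sub>M k\<in>J. lborel))"
  proof (rule nn_integral_cmult)
    have [measurable]: "Measurable.pred (\<Pi>\<^sub>M i\<in>J. lborel) (\<lambda>x. (\<forall>i\<in>J. 0 < x i) \<and> (\<Sum>i\<in>J. x i) < (1::real))"
      using J(1) by measurable
    show "(\<lambda>x. ennreal (of_bool ((\<forall>i\<in>J. 0 < x i) \<and> (\<Sum>i\<in>J. x i) < 1) *
      ((\<Prod>i\<in>J. x i powr (a i - 1)) * (1 - (\<Sum>i\<in>J. x i)) powr (a l - 1)))) \<in> borel_measurable (\<Pi>\<^sub>M k\<in>J. lborel)"
      by measurable
  qed
  also have "\<dots> = ennreal c * ennreal ((\<Prod>i\<in>J. Gamma (a i)) * Gamma (a l) / Gamma ((\<Sum>i\<in>J. a i) + a l))"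
    using J(1) a by (subst dirichlet_integral) auto
  also have "(\<Prod>i\<in>J. Gamma (a i)) * Gamma (a l) = (\<Prod>k\<in>UNIV. Gamma (a k))"
    unfolding J(3) using J(1,2) by (simp add: mult.commute)
  also have "(\<Sum>i\<in>J. a i) + a l = sum a UNIV"
    unfolding J(3) using J(1,2) by simp
  also have "ennreal c * ennreal ((\<Prod>k\<in>UNIV. Gamma (a k)) / Gamma (sum a UNIV)) =
      ennreal (c * ((\<Prod>k\<in>UNIV. Gamma (a k)) / Gamma (sum a UNIV)))"
    using c a sum_\<alpha>
    by (intro ennreal_mult[symmetric] divide_nonneg_nonneg prod_nonneg Gamma_real_nonneg) (auto intro: less_imp_le)
  also have "c * ((\<Prod>k\<in>UNIV. Gamma (a k)) / Gamma (sum a UNIV)) = urn_weight \<alpha> N"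
  proof -
    have poch: "pochhammer z n = Gamma (z + real n) / Gamma z" if "0 < z" for z :: real and n
      using that by (intro pochhammer_Gamma) (auto simp: nonpos_Ints_def)
    have "(\<Prod>k\<in>UNIV. pochhammer (\<alpha> k) (N k)) = (\<Prod>k\<in>UNIV. Gamma (a k)) / (\<Prod>k\<in>UNIV. Gamma (\<alpha> k))"
      using \<alpha> by (simp add: poch a_def prod_dividef)
    moreover have "pochhammer (sum \<alpha> UNIV) (sum N UNIV) = Gamma (sum a UNIV) / Gamma (sum \<alpha> UNIV)"
      using sum_\<alpha>(1) by (simp add: poch a_def sum.distrib)
    ultimately show ?thesis
      by (simp add: urn_weight_def c_def)
  qed
  finally show ?thesis
    by (simp only: h_def)
qed

lemma prob_space_dirichlet:
  fixes \<alpha> :: "'k::finite \<Rightarrow> real"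
  assumes "\<And>k. 0 < \<alpha> k"
  shows "prob_space (dirichlet \<alpha>)"
proof
  have "emeasure (dirichlet \<alpha>) (space (dirichlet \<alpha>)) = (\<integral>\<^sup>+x. 1 \<partial>dirichlet \<alpha>)"
    by simp
  also have "\<dots> = 1"
    using nn_integral_dirichlet_monomial[where \<alpha> = \<alpha> and N = "\<lambda>_. 0", OF assms] by simp
  finally show "emeasure (dirichlet \<alpha>) (space (dirichlet \<alpha>)) = 1" .
qed

section \<open>The annealed walk\<close>

lemma prod_mset_eq_prod_power:
  fixes f :: "'p \<Rightarrow> real"
  assumes "finite T" "set_mset M \<subseteq> T"
  shows "(\<Prod>p\<in>#M. f p) = (\<Prod>p\<in>T. f p ^ count M p)"
  using assms(2)
proof (induction M)
  case (add p M)
  have "(\<Prod>q\<in>T. f q ^ count (add_mset p M) q) = (\<Prod>q\<in>T. f q ^ count M q * (if q = p then f q else 1))"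
    by (rule prod.cong) auto
  also have "\<dots> = (\<Prod>q\<in>T. f q ^ count M q) * f p"
    using assms(1) add.prems by (simp add: prod.distrib)
  finally show ?case
    using add by (simp add: mult.commute)
qed simp

lemma prod_edges:
  fixes f :: "'a::ab_group_add \<Rightarrow> 'k \<Rightarrow> real"
  shows "(\<Prod>i<length w. f (endpoint e x (take i w)) (w ! i)) = (\<Prod>(y, k)\<in>#edges e x w. f y k)"
proof (induction w arbitrary: x)
  case (Cons k w)
  show ?case
    unfolding length_Cons by (subst prod.lessThan_Suc_shift) (simp add: Cons)
qed simp

lemma measurable_dirichlet_component [measurable]: "(\<lambda>y. y k) \<in> borel_measurable (dirichlet \<alpha>)"
proof -
  have "(\<lambda>y. y k) \<in> borel_measurable (hyperplane_lebesgue l)" for l :: 'a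
    unfolding hyperplane_lebesgue_def by simp
  then show ?thesis
    unfolding dirichlet_def by (simp add: measurable_restrict_space1)
qed

text \<open>Only finitely many sites occur in \<open>M\<close>. By independence the expectation
  factors into one Dirichlet moment per site, and these are the urn weights.\<close>

lemma nn_integral_environment_prod:
  fixes \<alpha> :: "'d::finite + 'd \<Rightarrow> real" and M :: "((int ^ 'd) \<times> ('d + 'd)) multiset"
  assumes \<alpha>: "\<And>k. 0 < \<alpha> k"
  shows "(\<integral>\<^sup>+\<omega>. ennreal (\<Prod>(x, k)\<in>#M. \<omega> x k) \<partial>dirichlet_environment \<alpha>) = ennreal (edge_weight \<alpha> M)"
proof -
  interpret prob_space "dirichlet \<alpha>"
    by (rule prob_space_dirichlet[OF \<alpha>])
  interpret product_prob_space "\<lambda>_ :: int ^ 'd. dirichlet \<alpha>" UNIV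
    by standard
  define S where "S = fst ` set_mset M"
  have S: "finite S"
    by (simp add: S_def)
  define h where "h x y = ennreal (\<Prod>k\<in>UNIV. y k ^ count M (x, k))" for x and y :: "'d + 'd \<Rightarrow> real"
  have [measurable]: "h x \<in> borel_measurable (dirichlet \<alpha>)" for x
    unfolding h_def[abs_def] by measurable
  have eq: "ennreal (\<Prod>(x, k)\<in>#M. \<omega> x k) = (\<Prod>x\<in>S. h x (restrict \<omega> S x))"
    if "\<omega> \<in> space (dirichlet_environment \<alpha>)" for \<omega>
  proof -
    have "(\<Prod>(x, k)\<in>#M. \<omega> x k) = (\<Prod>(x, k)\<in>S \<times> UNIV. \<omega> x k ^ count M (x, k))"
      by (subst prod_mset_eq_prod_power[of "S \<times> UNIV"]) (force simp: S_def case_prod_unfold)+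
    also have "\<dots> = (\<Prod>x\<in>S. \<Prod>k\<in>UNIV. \<omega> x k ^ count M (x, k))"
      by (rule prod.cartesian_product[symmetric])
    also have "ennreal \<dots> = (\<Prod>x\<in>S. h x (restrict \<omega> S x))"
      using that unfolding h_def
      by (subst prod_ennreal[symmetric])
        (auto intro!: prod_nonneg prod.cong simp: space_dirichlet_environment prob_simplex_def less_imp_le)
    finally show ?thesis .
  qed
  have "(\<integral>\<^sup>+\<omega>. ennreal (\<Prod>(x, k)\<in>#M. \<omega> x k) \<partial>dirichlet_environment \<alpha>) =
      (\<integral>\<^sup>+\<omega>. (\<Prod>x\<in>S. h x (restrict \<omega> S x)) \<partial>(\<Pi>\<^sub>M x\<in>UNIV. dirichlet \<alpha>))"
    unfolding dirichlet_environment_def[symmetric] by (rule nn_integral_cong) (rule eq)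
  also have "\<dots> = (\<integral>\<^sup>+y. (\<Prod>x\<in>S. h x (y x)) \<partial>distr (\<Pi>\<^sub>M x\<in>UNIV. dirichlet \<alpha>) (\<Pi>\<^sub>M x\<in>S. dirichlet \<alpha>) (\<lambda>\<omega>. restrict \<omega> S))"
    by (rule nn_integral_distr[symmetric]) measurable
  also have "\<dots> = (\<integral>\<^sup>+y. (\<Prod>x\<in>S. h x (y x)) \<partial>(\<Pi>\<^sub>M x\<in>S. dirichlet \<alpha>))"
    using S by (subst distr_PiM_restrict_finite) auto
  also have "\<dots> = (\<Prod>x\<in>S. \<integral>\<^sup>+y. h x y \<partial>dirichlet \<alpha>)"
    using S by (intro product_nn_integral_prod) auto
  also have "\<dots> = ennreal (edge_weight \<alpha> M)"
    unfolding h_def nn_integral_dirichlet_monomial[OF \<alpha>] edge_weight_def S_def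
    by (rule prod_ennreal) (simp add: urn_weight_nonneg \<alpha>)
  finally show ?thesis .
qed

lemma sum_edge_weight_words:
  fixes \<alpha> :: "'k::finite \<Rightarrow> real"
  assumes "\<And>k. 0 < \<alpha> k"
  shows "(\<Sum>w | length w = n. edge_weight \<alpha> (edges e x w)) = 1"
proof (induction n)
  case (Suc n)
  then show ?case
    by (simp add: sum_words_Suc sum_edge_weight_add_mset assms)
qed simp

section \<open>From the walk to its sequence of steps\<close>

definition follows :: "('d::finite + 'd) list \<Rightarrow> (nat \<Rightarrow> int ^ 'd) set" where
  "follows w = {X. \<forall>i\<le>length w. X i = endpoint unit_vec 0 (take i w)}"

text \<open>For a jump that is not a unit vector the value of \<open>inv\<close> is arbitrary; such
  paths have probability zero by \<open>AE_follows\<close>.\<close>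

definition directions :: "(nat \<Rightarrow> int ^ 'd::finite) \<Rightarrow> nat \<Rightarrow> 'd + 'd" where
  "directions X n = inv unit_vec (X (Suc n) - X n)"

definition direction_law :: "('d::finite + 'd \<Rightarrow> real) \<Rightarrow> (nat \<Rightarrow> 'd + 'd) measure" where
  "direction_law \<alpha> = distr (annealed_law \<alpha>) path_space directions"

context
  fixes \<alpha> :: "'d::finite + 'd \<Rightarrow> real"
  assumes \<alpha>: "\<And>k. 0 < \<alpha> k"
begin

lemma dirichlet_environment_in_prob_algebra:
  "dirichlet_environment \<alpha> \<in> space (prob_algebra (dirichlet_environment \<alpha>))"
  unfolding space_prob_algebra dirichlet_environment_def
  by (intro CollectI conjI refl prob_space_PiM prob_space_dirichlet \<alpha>)

lemma prob_space_annealed: "prob_space (annealed_law \<alpha>)"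
  and sets_annealed [measurable_cong]: "sets (annealed_law \<alpha>) = sets path_space"
  unfolding annealed_law_def
  using prob_space_bind'[OF dirichlet_environment_in_prob_algebra measurable_quenched_law]
    sets_bind'[OF dirichlet_environment_in_prob_algebra measurable_quenched_law] by auto

lemma space_annealed [simp]: "space (annealed_law \<alpha>) = UNIV"
  using sets_eq_imp_space_eq[OF sets_annealed] by (simp add: space_PiM)

lemma sets_follows: "follows w \<in> sets (annealed_law \<alpha>)"
proof -
  have "follows w = {X. \<forall>i\<le>length w. X i = (\<lambda>i. endpoint unit_vec 0 (take i w)) i}"
    by (simp add: follows_def)
  also have "\<dots> \<in> sets path_space"
    unfolding sets_path_space_eq_cylinders
    by (intro sigma_sets.Basic insertI2 CollectI exI conjI TrueI) (rule refl)
  finally show ?thesis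
    by (simp add: sets_annealed)
qed

text \<open>The quenched probability of a path is the product of the environment over its edges,
  counted with multiplicity, so averaging over the environment yields the urn weight.\<close>

lemma emeasure_follows: "emeasure (annealed_law \<alpha>) (follows w) = ennreal (edge_weight \<alpha> (edges unit_vec 0 w))"
proof -
  define p where "p i = endpoint unit_vec 0 (take i w)" for i
  have p_Suc: "p (Suc i) = p i + unit_vec (w ! i)" if "i < length w" for i
    using that by (simp add: p_def take_Suc_conv_app_nth)
  have "emeasure (annealed_law \<alpha>) (follows w) =
      (\<integral>\<^sup>+\<omega>. emeasure (quenched_law \<omega>) (follows w) \<partial>dirichlet_environment \<alpha>)"
    unfolding annealed_law_def
  proof (rule emeasure_bind)
    show "space (dirichlet_environment \<alpha>) \<noteq> {}"
      using dirichlet_environment_in_prob_algebra prob_space.not_empty by (auto simp: space_prob_algebra)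
    show "quenched_law \<in> dirichlet_environment \<alpha> \<rightarrow>\<^sub>M subprob_algebra path_space"
      by (rule measurable_prob_algebraD[OF measurable_quenched_law])
  qed (use sets_follows in \<open>simp add: sets_annealed\<close>)
  also have "\<dots> = (\<integral>\<^sup>+\<omega>. ennreal (\<Prod>(x, k)\<in>#edges unit_vec 0 w. \<omega> x k) \<partial>dirichlet_environment \<alpha>)"
  proof (rule nn_integral_cong)
    fix \<omega> assume "\<omega> \<in> space (dirichlet_environment \<alpha>)"
    then have \<omega>: "\<omega> x \<in> prob_simplex" for x
      by (simp add: space_dirichlet_environment)
    have "follows w = {X. \<forall>i\<le>length w. X i = p i}"
      by (simp add: follows_def p_def)
    then have "emeasure (quenched_law \<omega>) (follows w) =
        ennreal (\<Prod>i<length w. pmf (walk_step \<omega> (p i)) (p (Suc i)))"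
      unfolding quenched_law_def by (simp add: emeasure_markov_law_cylinder p_def)
    also have "(\<Prod>i<length w. pmf (walk_step \<omega> (p i)) (p (Suc i))) = (\<Prod>i<length w. \<omega> (p i) (w ! i))"
      by (rule prod.cong) (auto simp: p_Suc pmf_walk_step \<omega>)
    also have "\<dots> = (\<Prod>(x, k)\<in>#edges unit_vec 0 w. \<omega> x k)"
      unfolding p_def by (rule prod_edges)
    finally show "emeasure (quenched_law \<omega>) (follows w) = ennreal (\<Prod>(x, k)\<in>#edges unit_vec 0 w. \<omega> x k)" .
  qed
  also have "\<dots> = ennreal (edge_weight \<alpha> (edges unit_vec 0 w))"
    by (rule nn_integral_environment_prod[OF \<alpha>])
  finally show ?thesis .
qed

lemma measurable_directions [measurable]: "directions \<in> measurable (annealed_law \<alpha>) path_space"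
  unfolding measurable_cong_sets[OF sets_annealed refl]
proof (rule measurable_PiM_single')
  fix n
  define F where "F w = (inv unit_vec (w ! Suc n - w ! n) :: 'd + 'd)" for w
  have eq: "(\<lambda>X. directions X n) = (\<lambda>X. F (pre (Suc (Suc n)) X))"
    by (simp add: F_def directions_def fun_eq_iff)
  show "(\<lambda>X :: nat \<Rightarrow> int ^ 'd. directions X n) \<in> path_space \<rightarrow>\<^sub>M count_space UNIV"
    unfolding eq by (rule measurable_pre_fun)
qed auto

lemma pre_directions:
  assumes "X \<in> follows w"
  shows "pre (length w) (directions X) = w"
proof -
  have "directions X i = w ! i" if "i < length w" for i
  proof -
    have "X (Suc i) = X i + unit_vec (w ! i)"
      using assms that by (simp add: follows_def take_Suc_conv_app_nth)
    then show ?thesis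
      by (simp add: directions_def inv_f_f[OF inj_unit_vec])
  qed
  then show ?thesis
    by (simp add: pre_eq_iff)
qed

lemma follows_disjoint: "length v = length w \<Longrightarrow> X \<in> follows v \<Longrightarrow> X \<in> follows w \<Longrightarrow> v = w"
  using pre_directions by metis

text \<open>The events for distinct words of length \<open>n\<close> are disjoint and their weights
  already add up to 1, which leaves no mass for any other path.\<close>

lemma AE_follows: "AE X in annealed_law \<alpha>. \<exists>w. length w = n \<and> X \<in> follows w"
proof -
  interpret P: prob_space "annealed_law \<alpha>"
    by (rule prob_space_annealed)
  have prob: "P.prob (follows w) = edge_weight \<alpha> (edges unit_vec 0 w)" for w
    unfolding measure_def emeasure_follows by (intro enn2real_ennreal edge_weight_nonneg \<alpha>)
  have "P.prob (\<Union>w\<in>{w. length w = n}. follows w) = (\<Sum>w | length w = n. P.prob (follows w))"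
    by (rule P.finite_measure_finite_Union)
      (use sets_follows follows_disjoint in \<open>auto simp: disjoint_family_on_def\<close>)
  also have "\<dots> = 1"
    by (simp add: prob sum_edge_weight_words \<alpha>)
  finally have "AE X in annealed_law \<alpha>. X \<in> (\<Union>w\<in>{w. length w = n}. follows w)"
    using sets_follows by (subst (asm) P.prob_eq_1) auto
  then show ?thesis
    by eventually_elim auto
qed

lemma polya_walk_direction_law: "polya_walk (direction_law \<alpha>) unit_vec \<alpha>"
proof -
  interpret P: prob_space "annealed_law \<alpha>"
    by (rule prob_space_annealed)
  have prob: "prob_space (direction_law \<alpha>)"
    unfolding direction_law_def by (rule P.prob_space_distr[OF measurable_directions])
  have sets: "sets (direction_law \<alpha>) = sets path_space"
    by (simp add: direction_law_def)
  have "measure (direction_law \<alpha>) {\<omega>. pre (length w) \<omega> = w} = edge_weight \<alpha> (edges unit_vec 0 w)"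
    for w :: "('d + 'd) list"
  proof -
    have "{\<omega> \<in> space path_space. pre (length w) \<omega> = w} \<in> sets path_space"
      using measurable_pre_fun[of "\<lambda>u. u = w" "length w"] unfolding pred_def .
    then have cyl: "{\<omega>. pre (length w) \<omega> = w} \<in> sets path_space"
      by (simp add: space_PiM)
    have "measure (direction_law \<alpha>) {\<omega>. pre (length w) \<omega> = w} =
        P.prob {X. pre (length w) (directions X) = w}"
      unfolding direction_law_def measure_distr[OF measurable_directions cyl] by (simp add: vimage_def)
    also have "\<dots> = P.prob (follows w)"
    proof (rule P.finite_measure_eq_AE)
      show "AE X in annealed_law \<alpha>. (X \<in> {X. pre (length w) (directions X) = w}) = (X \<in> follows w)"
        using AE_follows[of "length w"]
      proof eventually_elim
        fix X :: "nat \<Rightarrow> int ^ 'd" assume "\<exists>v. length v = length w \<and> X \<in> follows v"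
        then obtain v where "length v = length w" "X \<in> follows v"
          by blast
        then show "(X \<in> {X. pre (length w) (directions X) = w}) = (X \<in> follows w)"
          using pre_directions[of X v] pre_directions[of X w] by auto
      qed
      show "{X. pre (length w) (directions X) = w} \<in> sets (annealed_law \<alpha>)"
        using measurable_sets[OF measurable_directions cyl] by (simp add: vimage_def)
    qed (rule sets_follows)
    also have "\<dots> = edge_weight \<alpha> (edges unit_vec 0 w)"
      unfolding measure_def emeasure_follows by (intro enn2real_ennreal edge_weight_nonneg \<alpha>)
    finally show ?thesis .
  qed
  with prob sets \<alpha> show ?thesis
    by (simp add: polya_walk_def polya_walk_axioms_def)
qed

lemma AE_path_eq: "AE X in annealed_law \<alpha>. \<forall>n. X n = endpoint unit_vec 0 (pre n (directions X))"
proof -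
  have "AE X in annealed_law \<alpha>. \<forall>n. \<exists>w. length w = n \<and> X \<in> follows w"
    unfolding AE_all_countable by (intro allI AE_follows)
  then show ?thesis
  proof eventually_elim
    fix X assume *: "\<forall>n. \<exists>w. length w = n \<and> X \<in> follows w"
    show "\<forall>n. X n = endpoint unit_vec 0 (pre n (directions X))"
    proof
      fix n
      obtain w where "length w = n" "X \<in> follows w"
        using * by blast
      then show "X n = endpoint unit_vec 0 (pre n (directions X))"
        using pre_directions[of X w] by (auto simp: follows_def)
    qed
  qed
qed

end

lemma sum_unit_vec_component:
  "real_of_int (endpoint unit_vec 0 (pre n \<omega>) $ i) =
    partial_sum (\<lambda>k. of_bool (k = Inl i) - of_bool (k = Inr i)) n \<omega>"
proof (induction n)
  case (Suc n)
  have "real_of_int (unit_vec k $ i) = of_bool (k = Inl i) - of_bool (k = Inr i)" for k :: "'a + 'a"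
    by (cases k) (auto simp: axis_def)
  then show ?case
    using Suc by (simp add: pre_Suc partial_sum_def endpoint_def)
qed (simp add: partial_sum_def)

theorem theorem1:
  fixes \<alpha> :: "'d::finite + 'd \<Rightarrow> real"
  assumes pos: "\<And>k. 0 < \<alpha> k"
    and drift: "\<exists>k. weight_at \<alpha> (unit_vec k) > 1 + weight_at \<alpha> (- unit_vec k)"
  shows "transient (annealed_law \<alpha>) \<and>
    (\<exists>v :: real ^ 'd. v \<noteq> 0 \<and>
      \<P>(X in annealed_law \<alpha>. (\<lambda>n. real_vec (X n) /\<^sub>R real n) \<longlonglongrightarrow> v) = 1 \<and>
      (\<forall>i :: 'd.
        (weight_at \<alpha> (unit_vec (Inl i)) - weight_at \<alpha> (- unit_vec (Inl i)) - 1) / ((\<Sum>k\<in>UNIV. \<alpha> k) - 1)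
          \<le> v \<bullet> real_vec (unit_vec (Inl i)) \<and>
        v \<bullet> real_vec (unit_vec (Inl i))
          \<le> (weight_at \<alpha> (unit_vec (Inl i)) - weight_at \<alpha> (- unit_vec (Inl i)) + 1) / ((\<Sum>k\<in>UNIV. \<alpha> k) - 1)))"
proof -
  obtain k0 where k0: "weight_at \<alpha> (unit_vec k0) > 1 + weight_at \<alpha> (- unit_vec k0)"
    using drift by blast
  define opp where "opp = (case k0 of Inl i \<Rightarrow> Inr i | Inr i \<Rightarrow> Inl i)"
  define i0 where "i0 = (case k0 of Inl i \<Rightarrow> i | Inr i \<Rightarrow> i)"
  \<comment> \<open>The drift may point along a negative axis; the sign is absorbed into the
    height.\<close>
  define \<eta> where "\<eta> x = (case k0 of Inl i \<Rightarrow> x $ i | Inr i \<Rightarrow> - (x $ i))" for x :: "int ^ 'd"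
  have k0_gt: "\<alpha> opp + 1 < \<alpha> k0"
    using k0 by (cases k0) (simp_all add: opp_def weight_at_unit_vec weight_at_uminus_unit_vec del: unit_vec.simps)
  have drifted: "drifted_walk (direction_law \<alpha>) unit_vec \<alpha> \<eta> k0 opp"
  proof (intro drifted_walk.intro drifted_walk_axioms.intro polya_walk_direction_law pos)
    show "\<eta> (x + y) = \<eta> x + \<eta> y" for x y
      by (cases k0) (simp_all add: \<eta>_def)
    show "\<eta> (unit_vec k) = of_bool (k = k0) - of_bool (k = opp)" for k
      by (cases k0; cases k) (auto simp: \<eta>_def opp_def axis_def)
    show "k0 \<noteq> opp"
      by (cases k0) (auto simp: opp_def)
  qed (rule k0_gt)
  interpret W: drifted_walk "direction_law \<alpha>" unit_vec \<alpha> \<eta> k0 opp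
    by (rule drifted)
  interpret P: prob_space "annealed_law \<alpha>"
    by (rule prob_space_annealed[OF pos])
  define u where "u i k = (of_bool (k = Inl i) - of_bool (k = Inr i) :: real)" for i :: 'd and k
  define v where "v = (\<chi> i. W.speed (u i))"
  have inner: "v \<bullet> real_vec (unit_vec (Inl i)) = W.speed (u i)" for i
  proof -
    have "real_vec (unit_vec (Inl i)) = axis i 1"
      by (simp add: real_vec_def vec_eq_iff axis_def)
    then show ?thesis
      by (simp add: inner_axis v_def)
  qed
  have bounds: "(\<alpha> (Inl i) - \<alpha> (Inr i) - 1) / (sum \<alpha> UNIV - 1) \<le> W.speed (u i)"
    "W.speed (u i) \<le> (\<alpha> (Inl i) - \<alpha> (Inr i) + 1) / (sum \<alpha> UNIV - 1)" for i
    using W.speed_bounds[of "Inl i" "Inr i"] by (simp_all add: u_def[abs_def])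
  \<comment> \<open>Along the drift axis the lower bound is positive, or, if the drift points in the
    negative direction, the upper bound is negative.\<close>
  have v_i0: "v $ i0 \<noteq> 0"
  proof (cases k0)
    case (Inl i)
    then have "0 < (\<alpha> (Inl i) - \<alpha> (Inr i) - 1) / (sum \<alpha> UNIV - 1)"
      using k0_gt W.sum_\<alpha>_gt_1 by (simp add: opp_def)
    then show ?thesis
      using bounds(1)[of i] Inl by (simp add: v_def i0_def)
  next
    case (Inr i)
    then have "(\<alpha> (Inl i) - \<alpha> (Inr i) + 1) / (sum \<alpha> UNIV - 1) < 0"
      using k0_gt W.sum_\<alpha>_gt_1 by (simp add: opp_def divide_neg_pos)
    then show ?thesis
      using bounds(2)[of i] Inr by (simp add: v_def i0_def)
  qed
  have "AE \<omega> in direction_law \<alpha>. \<forall>i. (\<lambda>n. partial_sum (u i) n \<omega> / real n) \<longlonglongrightarrow> W.speed (u i)"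
    by (intro AE_finite_allI[of UNIV, simplified] W.law_of_large_numbers) simp
  then have "AE X in annealed_law \<alpha>. \<forall>i. (\<lambda>n. partial_sum (u i) n (directions X) / real n) \<longlonglongrightarrow> W.speed (u i)"
    unfolding direction_law_def by (rule AE_distrD[OF measurable_directions[OF pos]])
  then have lim: "AE X in annealed_law \<alpha>. (\<lambda>n. real_vec (X n) /\<^sub>R real n) \<longlonglongrightarrow> v"
    using AE_path_eq[OF pos]
  proof eventually_elim
    fix X assume X: "\<forall>i. (\<lambda>n. partial_sum (u i) n (directions X) / real n) \<longlonglongrightarrow> W.speed (u i)"
      and path: "\<forall>n. X n = endpoint unit_vec 0 (pre n (directions X))"
    have eq: "(real_vec (X n) /\<^sub>R real n) $ i = partial_sum (u i) n (directions X) / real n" for n i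
      using path sum_unit_vec_component[of n "directions X" i]
      by (simp add: real_vec_def u_def[abs_def] divide_inverse mult.commute)
    show "(\<lambda>n. real_vec (X n) /\<^sub>R real n) \<longlonglongrightarrow> v"
    proof (rule vec_tendstoI)
      fix i
      show "(\<lambda>n. (real_vec (X n) /\<^sub>R real n) $ i) \<longlonglongrightarrow> v $ i"
        unfolding eq using X by (simp add: v_def)
    qed
  qed
  \<comment> \<open>At a visit to \<open>x\<close> the quotient of position and time is
    \<open>x\<close> over the time, which tends to 0 and so cannot stay close to the nonzero
    coordinate of \<open>v\<close>.\<close>
  have "transient (annealed_law \<alpha>)"
    unfolding transient_def using lim
  proof eventually_elim
    fix X assume X: "(\<lambda>n. real_vec (X n) /\<^sub>R real n) \<longlonglongrightarrow> v"
    show "\<forall>x. finite {n. X n = x}"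
    proof (rule allI, rule ccontr)
      fix x assume inf: "infinite {n. X n = x}"
      have "(\<lambda>n. (real_vec (X n) /\<^sub>R real n) $ i0) \<longlonglongrightarrow> v $ i0"
        using X by (rule tendsto_vec_nth)
      moreover have "(\<lambda>n. (real_vec x /\<^sub>R real n) $ i0) \<longlonglongrightarrow> 0"
        using tendsto_mult_left_zero[OF lim_inverse_n, of "real_vec x $ i0"] by simp
      ultimately have "(\<lambda>n. (real_vec (X n) /\<^sub>R real n) $ i0 - (real_vec x /\<^sub>R real n) $ i0) \<longlonglongrightarrow> v $ i0 - 0"
        by (rule tendsto_diff)
      then have "\<forall>\<^sub>F n in sequentially. (real_vec (X n) /\<^sub>R real n) $ i0 - (real_vec x /\<^sub>R real n) $ i0 \<noteq> 0"
        using v_i0 by (intro tendsto_imp_eventually_ne) auto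
      then obtain N where N: "\<And>n. N \<le> n \<Longrightarrow> X n \<noteq> x"
        by (auto simp: eventually_sequentially)
      have "{n. X n = x} \<subseteq> {..<N}"
      proof
        fix n assume "n \<in> {n. X n = x}"
        then have "\<not> N \<le> n"
          using N[of n] by blast
        then show "n \<in> {..<N}"
          by simp
      qed
      then show False
        using inf finite_subset by blast
    qed
  qed
  moreover have "\<P>(X in annealed_law \<alpha>. (\<lambda>n. real_vec (X n) /\<^sub>R real n) \<longlonglongrightarrow> v) = 1"
  proof (subst P.prob_Collect_eq_1)
    have "(\<lambda>X. real_vec (X n) /\<^sub>R real n) \<in> borel_measurable (annealed_law \<alpha>)" for n
    proof -
      have "(\<lambda>X. real_vec (X n) /\<^sub>R real n) \<in> borel_measurable path_space"
        by (rule measurable_compose[OF measurable_component_singleton, of n]) auto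
      then show ?thesis
        unfolding measurable_cong_sets[OF sets_annealed[OF pos] refl] .
    qed
    then show "{X \<in> space (annealed_law \<alpha>). (\<lambda>n. real_vec (X n) /\<^sub>R real n) \<longlonglongrightarrow> v} \<in> P.events"
      unfolding pred_def[symmetric] by (rule measurable_limit)
  qed (use lim in simp)
  moreover have "v \<noteq> 0"
    using v_i0 by auto
  ultimately show ?thesis
    using bounds
    by (intro conjI exI[of _ v] allI)
      (simp_all add: inner weight_at_unit_vec weight_at_uminus_unit_vec del: unit_vec.simps)
qed

end
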